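(* Let $Q$ be a probability distribution on $\mathbb{R}$ with $\int x\,Q(dx)=0$, $\int x^2\,Q(dx)=1/2$ and $b:=\int x^4\,Q(dx)<\infty$, let $X_N$ be the associated $N\times N$ Hermitian Wigner matrix, and let $f(N;\mu,\nu):=\mathbb{E}\big(\det(X_N-\mu I_N)\cdot\det(X_N-\nu I_N)\big)$. Let $\xi\in(-2,2)$ and $\mu,\nu\in\mathbb{R}$. Then $$\lim_{N\to\infty}\sqrt{\frac{1}{2\pi N}}\cdot\frac{1}{N!}\cdot e^{-N\xi^2/2}\cdot f\!\left(N;\sqrt{N}\,\xi+\frac{\mu}{\sqrt{N}\,\varrho(\xi)},\ \sqrt{N}\,\xi+\frac{\nu}{\sqrt{N}\,\varrho(\xi)}\right)=\exp\!\Big(b-\tfrac34\Big)\cdot \exp\!\left(\frac{\xi(\mu+\nu)}{2\varrho(\xi)}\right)\cdot\varrho(\xi)\cdot\frac{\sin\pi(\mu-\nu)}{\pi(\mu-\nu)},$$ where $\varrho(\xi):=\frac{1}{2\pi}\sqrt{4-\xi^2}$ and $\sin 0/0:=1$.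
   Context: Wigner matrix associated with $Q$: let $(X_{ii}/\sqrt2)_{i\in\mathbb{N}}$, $(X^{\mathrm{Re}}_{ij})_{i<j}$ and $(X^{\mathrm{Im}}_{ij})_{i<j}$ ($i,j\in\mathbb{N}$) be independent families of independent real random variables, all with distribution $Q$, on some probability space $(\Omega,\mathcal{F},\mathbb{P})$ with expectation $\mathbb{E}$. For $i<j$ put $X_{ij}:=X^{\mathrm{Re}}_{ij}+\mathbf{i}X^{\mathrm{Im}}_{ij}$ and $X_{ji}:=X^{\mathrm{Re}}_{ij}-\mathbf{i}X^{\mathrm{Im}}_{ij}$, where $\mathbf{i}$ is the imaginary unit. Then $X_N:=(X_{ij})_{1\le i,j\le N}$. $I_N$ denotes the $N\times N$ identity matrix. *)

theory Defs
  imports "HOL-Probability.Probability" "Jordan_Normal_Form.Determinant"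
begin

text \<open>
  All the real random variables from which the Wigner matrix is built are collected in one
  family, so that ``independent families of independent random variables'' is the joint
  independence of that family. Rows and columns are numbered from 0, as for the matrices of
  \<^theory>\<open>Jordan_Normal_Form.Matrix\<close>.
\<close>

datatype wigner_index = Diag nat | RePart nat nat | ImPart nat nat

definition wigner_indices :: "wigner_index set" where
  "wigner_indices = range Diag \<union> {RePart i j | i j. i < j} \<union> {ImPart i j | i j. i < j}"

fun wigner_var ::
  "(nat \<Rightarrow> 'a \<Rightarrow> real) \<Rightarrow> (nat \<Rightarrow> nat \<Rightarrow> 'a \<Rightarrow> real) \<Rightarrow> (nat \<Rightarrow> nat \<Rightarrow> 'a \<Rightarrow> real) \<Rightarrow>
    wigner_index \<Rightarrow> 'a \<Rightarrow> real" where
  "wigner_var Xd Xre Xim (Diag i) \<omega> = Xd i \<omega> / sqrt 2"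
| "wigner_var Xd Xre Xim (RePart i j) \<omega> = Xre i j \<omega>"
| "wigner_var Xd Xre Xim (ImPart i j) \<omega> = Xim i j \<omega>"

text \<open>\<open>Xd i\<close> is the diagonal entry itself; the values of \<open>Xre i j\<close> and \<open>Xim i j\<close> for
  \<open>i \<ge> j\<close> are irrelevant.\<close>

locale wigner_family = prob_space M for M :: "'a measure" +
  fixes Q :: "real measure"
    and Xd :: "nat \<Rightarrow> 'a \<Rightarrow> real"
    and Xre Xim :: "nat \<Rightarrow> nat \<Rightarrow> 'a \<Rightarrow> real"
  assumes indep: "indep_vars (\<lambda>_. borel) (wigner_var Xd Xre Xim) wigner_indices"
    and distr_eq: "k \<in> wigner_indices \<Longrightarrow> distr M borel (wigner_var Xd Xre Xim k) = Q"

definition wigner_entry ::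
  "(nat \<Rightarrow> 'a \<Rightarrow> real) \<Rightarrow> (nat \<Rightarrow> nat \<Rightarrow> 'a \<Rightarrow> real) \<Rightarrow> (nat \<Rightarrow> nat \<Rightarrow> 'a \<Rightarrow> real) \<Rightarrow>
    nat \<Rightarrow> nat \<Rightarrow> 'a \<Rightarrow> complex" where
  "wigner_entry Xd Xre Xim i j \<omega> =
    (if i = j then complex_of_real (Xd i \<omega>)
     else if i < j then complex_of_real (Xre i j \<omega>) + \<i> * complex_of_real (Xim i j \<omega>)
     else complex_of_real (Xre j i \<omega>) - \<i> * complex_of_real (Xim j i \<omega>))"

definition wigner_matrix ::
  "(nat \<Rightarrow> 'a \<Rightarrow> real) \<Rightarrow> (nat \<Rightarrow> nat \<Rightarrow> 'a \<Rightarrow> real) \<Rightarrow> (nat \<Rightarrow> nat \<Rightarrow> 'a \<Rightarrow> real) \<Rightarrow>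
    nat \<Rightarrow> 'a \<Rightarrow> complex mat" where
  "wigner_matrix Xd Xre Xim N \<omega> = Matrix.mat N N (\<lambda>(i, j). wigner_entry Xd Xre Xim i j \<omega>)"

text \<open>The determinants, and hence the correlation, are formally complex-valued, although the
  matrices are Hermitian.\<close>

definition wigner_corr ::
  "'a measure \<Rightarrow> (nat \<Rightarrow> 'a \<Rightarrow> real) \<Rightarrow> (nat \<Rightarrow> nat \<Rightarrow> 'a \<Rightarrow> real) \<Rightarrow> (nat \<Rightarrow> nat \<Rightarrow> 'a \<Rightarrow> real) \<Rightarrow>
    nat \<Rightarrow> real \<Rightarrow> real \<Rightarrow> complex" where
  "wigner_corr M Xd Xre Xim N \<mu> \<nu> =
    (\<integral>\<omega>. Determinant.det (wigner_matrix Xd Xre Xim N \<omega> - complex_of_real \<mu> \<cdot>\<^sub>m 1\<^sub>m N) *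
         Determinant.det (wigner_matrix Xd Xre Xim N \<omega> - complex_of_real \<nu> \<cdot>\<^sub>m 1\<^sub>m N) \<partial>M)"

definition semicircle_density :: "real \<Rightarrow> real" where
  "semicircle_density \<xi> = 1 / (2 * pi) * sqrt (4 - \<xi>\<^sup>2)"

end

theory Submission
  imports Defs "HOL-Real_Asymp.Real_Asymp"
begin

text \<open>The proof rests on an exact formula: for every \<open>N\<close>,
\<open>f(N; \<mu>, \<nu>) / N! = (\<Sum>j with 2 j \<le> N. (b - 3/4)^j / j! * (\<Sum>k\<le>N - 2 j. He_k(\<mu>) He_k(\<nu>) / k!))\<close>,
where \<open>He_k\<close> are the Hermite polynomials (\<open>wigner_corr_eq\<close>). The inner sum is the value for
the Gaussian unitary ensemble, for which \<open>b = 3/4\<close>; the distribution \<open>Q\<close> enters only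
through the coefficients of the outer sum, which add up to \<open>exp (b - 3/4)\<close>.

\<^bold>\<open>The exact formula.\<close> Expand both determinants over permutations \<open>\<sigma>\<close> and \<open>\<tau>\<close>. The
expectation factorises over the diagonal positions and the unordered pairs \<open>{i, j}\<close>, and it vanishes unless \<open>\<sigma>\<close> and
\<open>\<tau>\<close> together run through every pair equally often in both directions. The mixed third moments
\<open>E X\<^sub>i\<^sub>j\<^sup>2 X\<^sub>j\<^sub>i\<close> need not be zero, but wherever one occurs another pair is run through in one
direction only (\<open>unbalanced_imp_unmatched\<close>). Balance forces each cycle of \<open>\<sigma>\<close> of length at
least 3 to be a cycle of \<open>\<tau>\<close> run backwards; on the remaining points both are involutions. A
common fixed point has weight \<open>1 + \<mu> \<nu>\<close> and a common transposition has weight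
\<open>E |X\<^sub>i\<^sub>j|^4 = 1 + c\<close> with \<open>c = 2 b - 1/2\<close>. Multiplying out these binomials amounts to
choosing which of the common orbits join the long cycles, so the sum runs over a subset \<open>D\<close>, a
permutation of \<open>D\<close> with weight \<open>c\<close> for each of its transpositions, and two independent
involutions off \<open>D\<close> (\<open>pair_weight_splittings\<close>, \<open>bij_betw_splitting_pairs\<close>). The signed
involutions, with weight \<open>-\<mu>\<close> for each fixed point, add up to a Hermite polynomial
(\<open>hermite_involutions\<close>). In the permutations of \<open>D\<close> the same binomial argument, now for
\<open>c = 1 + (c - 1)\<close>, produces the factors \<open>((c - 1) / 2)^j / j! = (b - 3/4)^j / j!\<close>
(\<open>sum_cycle2_weight_eq\<close>).

\<^bold>\<open>The asymptotics of the inner sum.\<close> The function \<open>h(x) = He_n(x) exp (- x\<^sup>2 / 4) / sqrt n!\<close> solves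
the oscillator equation \<open>h'' = - p h\<close> with \<open>p(x) = n + 1/2 - x\<^sup>2 / 4\<close>. For
\<open>|x| \<le> a sqrt n\<close> with \<open>a < 2\<close> its frequency \<open>sqrt p\<close> is of order \<open>sqrt n\<close> and varies
slowly, so the action \<open>h'\<^sup>2 / sqrt p + sqrt p h\<^sup>2\<close> is an adiabatic invariant: it keeps its value at 0
up to a factor \<open>1 + O(1/n)\<close> (\<open>action_transport\<close>), and that value tends to \<open>sqrt (2/\<pi>)\<close> by
Wallis' product. The Christoffel-Darboux formula expresses the inner sum through \<open>h\<close> and \<open>h'\<close>. On
the diagonal it is \<open>sqrt p\<close> times the action, up to lower order. Off the diagonal it is a
difference quotient of \<open>h(x) h'(y) - h'(x) h(y)\<close>, where the distance of \<open>x\<close> and \<open>y\<close> is of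
order \<open>1 / sqrt n\<close>. On this scale the frequency is constant, and the expression is the action times the
sine of the phase difference (\<open>wronskian_estimate\<close>). This is how the sine kernel arises; the phase
of \<open>h\<close> itself is never computed.

Tannery's theorem then passes to the limit in the outer sum, since shifting \<open>N\<close> by \<open>2 j\<close> does not
change the limit of the inner sum (\<open>weighted_kernel_sum_tendsto\<close>).\<close>

section \<open>Hermite polynomials and signed involutions\<close>

fun hermite :: "nat \<Rightarrow> real \<Rightarrow> real" where
  "hermite 0 x = 1"
| "hermite (Suc 0) x = x"
| "hermite (Suc (Suc n)) x = x * hermite (Suc n) x - real (Suc n) * hermite n x"

definition involutions :: "'a set \<Rightarrow> ('a \<Rightarrow> 'a) set" where
  "involutions T = {p. p permutes T \<and> (\<forall>x. p (p x) = x)}"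

lemma finite_involutions: "finite T \<Longrightarrow> finite (involutions T)"
  by (rule finite_subset[OF _ finite_permutations[of T]]) (auto simp: involutions_def)

lemma involutions_empty: "involutions {} = {id}"
  by (auto simp: involutions_def)

lemma involutions_insert:
  assumes a: "a \<notin> T"
  shows "involutions (insert a T) =
    involutions T \<union> (\<Union>b\<in>T. (\<lambda>p. Transposition.transpose a b \<circ> p) ` involutions (T - {b}))"
    (is "?L = ?A \<union> ?B")
proof (intro equalityI subsetI)
  fix p assume "p \<in> ?L"
  then have p: "p permutes insert a T" and pp: "\<And>x. p (p x) = x"
    by (auto simp: involutions_def)
  show "p \<in> ?A \<union> ?B"
  proof (cases "p a = a")
    case True
    then have "p permutes T"
      using p by (metis a permutes_superset Diff_iff insertE singletonI)
    then show ?thesis using pp by (auto simp: involutions_def)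
  next
    case False
    define b where "b = p a"
    have b: "b \<in> T" using p False unfolding b_def by (metis permutes_in_image insertI1 insertE)
    have ba: "p b = a" using pp b_def by simp
    \<comment> \<open>Undoing the exchange of \<open>a\<close> and \<open>b\<close> leaves an involution of the other points.\<close>
    define q where "q = Transposition.transpose a b \<circ> p"
    have qa: "q a = a" and qb: "q b = b" using ba by (auto simp: q_def b_def)
    have qo: "q x = p x" if "x \<noteq> a" "x \<noteq> b" for x
    proof -
      have "p x \<noteq> a" using that(2) pp by (metis b_def)
      moreover have "p x \<noteq> b" using that(1) pp by (metis b_def)
      ultimately show ?thesis by (simp add: q_def)
    qed
    have qq: "q (q x) = x" for x
      using qa qb qo pp by (metis b_def)
    have "q permutes insert a T"
      unfolding q_def using p b by (intro permutes_compose) (auto intro: permutes_swap_id)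
    then have "q permutes T - {b}"
      by (rule permutes_superset) (use qa qb in auto)
    moreover have "p = Transposition.transpose a b \<circ> q" by (simp add: q_def fun_eq_iff)
    ultimately have "p \<in> (\<lambda>p. Transposition.transpose a b \<circ> p) ` involutions (T - {b})"
      using qq by (auto simp: involutions_def)
    then show ?thesis using b by blast
  qed
next
  fix p assume "p \<in> ?A \<union> ?B"
  then show "p \<in> ?L"
  proof
    assume "p \<in> ?A"
    then show ?thesis by (auto simp: involutions_def intro: permutes_subset)
  next
    assume "p \<in> ?B"
    then obtain b q where b: "b \<in> T" and q: "q permutes T - {b}" "\<And>x. q (q x) = x"
      and p: "p = Transposition.transpose a b \<circ> q" by (auto simp: involutions_def)
    have qa: "q a = a" and qb: "q b = b" using q a by (auto intro!: permutes_not_in[OF q(1)])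
    have 1: "p permutes insert a T"
      unfolding p using q b
      by (intro permutes_compose) (auto intro: permutes_swap_id permutes_subset)
    have 2: "q x \<noteq> a \<and> q x \<noteq> b" if "x \<noteq> a" "x \<noteq> b" for x
      using that qa qb q(2) by metis
    have "p (p x) = x" for x
      using 2[of x] 2[of "q x"] qa qb q(2) by (cases "x = a"; cases "x = b") (auto simp: p transpose_def)
    then show ?thesis using 1 by (auto simp: involutions_def)
  qed
qed

text \<open>An involution either fixes the new point \<open>a\<close> or exchanges it with some \<open>b\<close>. All recursions below,
for Hermite polynomials as for matchings, are this case distinction.\<close>

lemma sum_involutions_insert:
  assumes fin: "finite T" and a: "a \<notin> T"
  shows "(\<Sum>p\<in>involutions (insert a T). f p) =
    (\<Sum>p\<in>involutions T. f p) + (\<Sum>b\<in>T. \<Sum>p\<in>involutions (T - {b}). f (Transposition.transpose a b \<circ> p))"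
proof -
  have at: "p a = a" if "p \<in> involutions (T - X)" for p X
    using that a by (auto simp: involutions_def intro: permutes_not_in)
  have inj: "inj_on (\<lambda>p. Transposition.transpose a b \<circ> p) X" for b X
    by (rule inj_onI) (metis (no_types, lifting) comp_assoc id_comp transpose_comp_involutory)
  have val: "(Transposition.transpose a b \<circ> p) a = b" if "p \<in> involutions (T - {b})" for p b
    using at[OF that] by simp
  let ?g = "\<lambda>b. (\<lambda>p. Transposition.transpose a b \<circ> p) ` involutions (T - {b})"
  have valg: "p a = b" if "p \<in> ?g b" for p b using that val by blast
  have fing: "\<forall>b\<in>T. finite (?g b)" using fin by (intro ballI finite_imageI finite_involutions) simp
  have 1: "(\<Sum>p\<in>\<Union>(?g ` T). f p) = (\<Sum>b\<in>T. \<Sum>p\<in>?g b. f p)"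
  proof (rule sum.UNION_disjoint)
    show "\<forall>i\<in>T. \<forall>j\<in>T. i \<noteq> j \<longrightarrow> ?g i \<inter> ?g j = {}"
    proof (intro ballI impI)
      fix i j assume "i \<in> T" "j \<in> T" "i \<noteq> j"
      show "?g i \<inter> ?g j = {}"
      proof (rule equals0I)
        fix p assume "p \<in> ?g i \<inter> ?g j"
        then have "p a = i" "p a = j" using valg by blast+
        then show False using \<open>i \<noteq> j\<close> by simp
      qed
    qed
  next
    show "finite T" by (rule fin)
    show "\<forall>b\<in>T. finite (?g b)" by (rule fing)
  qed
  have 2: "(\<Sum>p\<in>?g b. f p) = (\<Sum>p\<in>involutions (T - {b}). f (Transposition.transpose a b \<circ> p))" for b
    by (subst sum.reindex[OF inj]) simp
  have 3: "involutions T \<inter> \<Union>(?g ` T) = {}"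
  proof -
    have "p \<notin> ?g b" if "p \<in> involutions T" "b \<in> T" for p b
    proof
      assume "p \<in> ?g b"
      then have "p a = b" using valg by blast
      then show False using at[of p "{}"] that a by auto
    qed
    then show ?thesis by blast
  qed
  have finU: "finite (\<Union>(?g ` T))" using fin fing by blast
  show ?thesis
    unfolding involutions_insert[OF a]
    unfolding sum.union_disjoint[OF finite_involutions[OF fin] finU 3] 1 2 ..
qed

lemma sign_transpose_involution:
  assumes "finite T" "a \<notin> T" "b \<in> T" "p \<in> involutions (T - {b})"
  shows "sign (Transposition.transpose a b \<circ> p) = - sign p"
proof -
  have "permutation p" using assms unfolding involutions_def permutation_permutes by blast
  then show ?thesis using assms
    by (subst sign_compose) (auto simp: permutation_swap_id sign_swap_id)
qed

text \<open>The case distinction for a point of \<open>T\<close> gives \<open>H\<^sub>n\<^sub>+\<^sub>1 = - \<mu> H\<^sub>n - n H\<^sub>n\<^sub>-\<^sub>1\<close>, the minus sign of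
the second term being the sign of the split-off transposition; up to the factor \<open>(-1)^n\<close> this is the
recursion of the Hermite polynomials.\<close>

lemma hermite_involutions:
  assumes "finite T"
  shows "(\<Sum>p\<in>involutions T. of_int (sign p) * (\<Prod>x\<in>T. if p x = x then - \<mu> else 1)) =
    (- 1) ^ card T * hermite (card T) \<mu>"
  using assms
proof (induction "card T" arbitrary: T rule: less_induct)
  case less
  define h where "h T = (\<Sum>p\<in>involutions T. of_int (sign p) * (\<Prod>x\<in>T. if p x = x then - \<mu> else (1::real)))" for T :: "'a set"
  show ?case
  proof (cases "T = {}")
    case True
    then show ?thesis by (simp add: involutions_empty)
  next
    case False
    then obtain a T' where T: "T = insert a T'" and a: "a \<notin> T'" by (meson Set.set_insert ex_in_conv)
    have fin: "finite T'" using less.prems T by simp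
    have "h T = (\<Sum>p\<in>involutions T'. of_int (sign p) * (\<Prod>x\<in>T. if p x = x then - \<mu> else 1)) +
      (\<Sum>b\<in>T'. \<Sum>p\<in>involutions (T' - {b}). of_int (sign (Transposition.transpose a b \<circ> p)) *
        (\<Prod>x\<in>T. if (Transposition.transpose a b \<circ> p) x = x then - \<mu> else 1))"
      unfolding h_def T by (rule sum_involutions_insert[OF fin a])
    also have "(\<Sum>p\<in>involutions T'. of_int (sign p) * (\<Prod>x\<in>T. if p x = x then - \<mu> else 1)) = - \<mu> * h T'"
      unfolding h_def sum_distrib_left
    proof (rule sum.cong)
      fix p assume "p \<in> involutions T'"
      then have "p a = a" using a by (auto simp: involutions_def intro: permutes_not_in)
      then show "of_int (sign p) * (\<Prod>x\<in>T. if p x = x then - \<mu> else 1) =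
         - \<mu> * (of_int (sign p) * (\<Prod>x\<in>T'. if p x = x then - \<mu> else 1))"
        using fin a by (simp add: T)
    qed simp
    also have "(\<Sum>b\<in>T'. \<Sum>p\<in>involutions (T' - {b}). of_int (sign (Transposition.transpose a b \<circ> p)) *
        (\<Prod>x\<in>T. if (Transposition.transpose a b \<circ> p) x = x then - \<mu> else 1)) = (\<Sum>b\<in>T'. - h (T' - {b}))"
      unfolding h_def sum_negf[symmetric]
    proof (intro sum.cong refl)
      fix b p assume b: "b \<in> T'" and p: "p \<in> involutions (T' - {b})"
      have pa: "p a = a" using p a by (auto simp: involutions_def intro: permutes_not_in)
      have pb: "p b = b" using p by (auto simp: involutions_def intro: permutes_not_in)
      have pp: "p (p x) = x" for x using p by (auto simp: involutions_def)
      have ab: "a \<noteq> b" using a b by auto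
      have eq: "T = insert a (insert b (T' - {b}))" using T b by auto
      have "(\<Prod>x\<in>T. if (Transposition.transpose a b \<circ> p) x = x then - \<mu> else 1) =
        (\<Prod>x\<in>T' - {b}. if (Transposition.transpose a b \<circ> p) x = x then - \<mu> else 1)"
        unfolding eq using fin a ab pa pb
        by (subst prod.insert, simp, simp, subst prod.insert, simp_all)
      also have "\<dots> = (\<Prod>x\<in>T' - {b}. if p x = x then - \<mu> else 1)"
      proof (rule prod.cong)
        fix x assume "x \<in> T' - {b}"
        then have "p x \<noteq> a" "p x \<noteq> b" using pa pb pp a by (metis DiffD1, metis DiffD2 singletonI)
        then show "(if (Transposition.transpose a b \<circ> p) x = x then - \<mu> else 1) = (if p x = x then - \<mu> else 1)"
          by simp
      qed simp
      finally show "of_int (sign (Transposition.transpose a b \<circ> p)) *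
         (\<Prod>x\<in>T. if (Transposition.transpose a b \<circ> p) x = x then - \<mu> else 1) =
         - (of_int (sign p) * (\<Prod>x\<in>T' - {b}. if p x = x then - \<mu> else 1))"
        using sign_transpose_involution[OF fin a b p] by simp
    qed
    finally have rec: "h T = - \<mu> * h T' + (\<Sum>b\<in>T'. - h (T' - {b}))" .
    have cT: "card T = Suc (card T')" using T a fin by simp
    have hT': "h T' = (- 1) ^ card T' * hermite (card T') \<mu>"
      unfolding h_def using less.hyps[of T'] fin cT by simp
    have hT'b: "h (T' - {b}) = (- 1) ^ (card T' - 1) * hermite (card T' - 1) \<mu>" if "b \<in> T'" for b
      unfolding h_def using less.hyps[of "T' - {b}"] fin cT that
      by (simp add: card_Diff_singleton less_Suc_eq_le)
    have "h T = - \<mu> * ((- 1) ^ card T' * hermite (card T') \<mu>) -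
        real (card T') * ((- 1) ^ (card T' - 1) * hermite (card T' - 1) \<mu>)"
      using rec hT' hT'b by simp
    also have "\<dots> = (- 1) ^ card T * hermite (card T) \<mu>"
      unfolding cT by (cases "card T'") (auto simp: algebra_simps)
    finally show ?thesis by (simp add: h_def)
  qed
qed

text \<open>Perfect matchings, encoded as involutions without fixed points.\<close>

definition matchings :: "'a set \<Rightarrow> ('a \<Rightarrow> 'a) set" where
  "matchings T = {p \<in> involutions T. \<forall>x\<in>T. p x \<noteq> x}"

lemma card_matchings_insert:
  assumes fin: "finite T" and a: "a \<notin> T"
  shows "card (matchings (insert a T)) = (\<Sum>b\<in>T. card (matchings (T - {b})))"
proof -
  have 0: "card (matchings T) = (\<Sum>p\<in>involutions T. if \<forall>x\<in>T. p x \<noteq> x then 1 else 0)" if "finite T" for T :: "'a set"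
    unfolding matchings_def using finite_involutions[OF that]
    by (simp add: sum.If_cases Int_def)
  have "card (matchings (insert a T)) =
    (\<Sum>p\<in>involutions T. if \<forall>x\<in>insert a T. p x \<noteq> x then 1 else 0) +
    (\<Sum>b\<in>T. \<Sum>p\<in>involutions (T - {b}). if \<forall>x\<in>insert a T. (Transposition.transpose a b \<circ> p) x \<noteq> x then 1 else 0)"
    unfolding 0[OF finite.insertI[OF fin]] by (rule sum_involutions_insert[OF fin a])
  also have "(\<Sum>p\<in>involutions T. if \<forall>x\<in>insert a T. p x \<noteq> x then 1 else 0) = (0::nat)"
  proof (rule sum.neutral, intro ballI)
    fix p assume "p \<in> involutions T"
    then have "p a = a" using a by (auto simp: involutions_def intro: permutes_not_in)
    then show "(if \<forall>x\<in>insert a T. p x \<noteq> x then 1 else 0) = (0::nat)" by auto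
  qed
  also have "(\<Sum>b\<in>T. \<Sum>p\<in>involutions (T - {b}). if \<forall>x\<in>insert a T. (Transposition.transpose a b \<circ> p) x \<noteq> x then 1 else 0) =
    (\<Sum>b\<in>T. card (matchings (T - {b})))"
  proof (rule sum.cong[OF refl])
    fix b assume b: "b \<in> T"
    have "(\<Sum>p\<in>involutions (T - {b}). if \<forall>x\<in>insert a T. (Transposition.transpose a b \<circ> p) x \<noteq> x then 1 else 0) =
      (\<Sum>p\<in>involutions (T - {b}). if \<forall>x\<in>T - {b}. p x \<noteq> x then 1 else (0::nat))"
    proof (rule sum.cong[OF refl])
      fix p assume p: "p \<in> involutions (T - {b})"
      have pa: "p a = a" using p a by (auto simp: involutions_def intro: permutes_not_in)
      have pb: "p b = b" using p by (auto simp: involutions_def intro: permutes_not_in)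
      have pp: "p (p x) = x" for x using p by (auto simp: involutions_def)
      have ab: "a \<noteq> b" using a b by auto
      have "(Transposition.transpose a b \<circ> p) x = p x" if "x \<in> T - {b}" for x
      proof -
        have "p x \<noteq> a" "p x \<noteq> b" using that pa pb pp a by (metis DiffD1, metis DiffD2 singletonI)
        then show ?thesis by simp
      qed
      moreover have "(Transposition.transpose a b \<circ> p) a \<noteq> a" "(Transposition.transpose a b \<circ> p) b \<noteq> b"
        using pa pb ab by auto
      moreover have "insert a T = insert a (insert b (T - {b}))" using b by auto
      ultimately have "(\<forall>x\<in>insert a T. (Transposition.transpose a b \<circ> p) x \<noteq> x) \<longleftrightarrow> (\<forall>x\<in>T - {b}. p x \<noteq> x)"
        by (metis insert_iff)
      then show "(if \<forall>x\<in>insert a T. (Transposition.transpose a b \<circ> p) x \<noteq> x then 1 else 0) =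
         (if \<forall>x\<in>T - {b}. p x \<noteq> x then 1 else (0::nat))" by simp
    qed
    then show "(\<Sum>p\<in>involutions (T - {b}). if \<forall>x\<in>insert a T. (Transposition.transpose a b \<circ> p) x \<noteq> x then 1 else 0) =
      card (matchings (T - {b}))" using fin by (simp add: 0)
  qed
  finally show ?thesis by simp
qed

lemma card_matchings:
  assumes "finite T"
  shows "real (card (matchings T)) =
    (if even (card T) then fact (card T) / (2 ^ (card T div 2) * fact (card T div 2)) else 0)"
  using assms
proof (induction "card T" arbitrary: T rule: less_induct)
  case less
  show ?case
  proof (cases "T = {}")
    case True
    then show ?thesis by (simp add: matchings_def involutions_empty)
  next
    case False
    then obtain a T' where T: "T = insert a T'" and a: "a \<notin> T'" by (meson Set.set_insert ex_in_conv)
    have fin: "finite T'" using less.prems T by simp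
    have cT: "card T = Suc (card T')" using T a fin by simp
    define m where "m = card T'"
    have IH: "real (card (matchings (T' - {b}))) =
      (if even (m - 1) then fact (m - 1) / (2 ^ ((m - 1) div 2) * fact ((m - 1) div 2)) else 0)"
      if "b \<in> T'" for b
      using less.hyps[of "T' - {b}"] fin cT that
      by (simp add: card_Diff_singleton less_Suc_eq_le m_def)
    have "real (card (matchings T)) = real m *
       (if even (m - 1) then fact (m - 1) / (2 ^ ((m - 1) div 2) * fact ((m - 1) div 2)) else 0)"
      unfolding T card_matchings_insert[OF fin a] of_nat_sum using IH by (simp add: m_def)
    also have "\<dots> = (if even (Suc m) then fact (Suc m) / (2 ^ (Suc m div 2) * fact (Suc m div 2)) else 0)"
    proof (cases m)
      case (Suc k)
      show ?thesis
      proof (cases "even k")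
        case True
        then obtain j where j: "k = 2 * j" by blast
        show ?thesis unfolding Suc j by (simp add: divide_simps)
      qed (use Suc in simp)
    qed simp
    finally show ?thesis by (simp add: cT m_def)
  qed
qed

section \<open>Permutations weighted by their transpositions\<close>

definition pairs_below :: "nat set \<Rightarrow> (nat \<times> nat) set" where
  "pairs_below S = {(i, j). i \<in> S \<and> j \<in> S \<and> i < j}"

definition swaps :: "(nat \<Rightarrow> nat) \<Rightarrow> nat set \<Rightarrow> (nat \<times> nat) set" where
  "swaps p S = {(i, j) \<in> pairs_below S. p i = j \<and> p j = i}"

lemma finite_pairs_below: "finite S \<Longrightarrow> finite (pairs_below S)"
  by (rule finite_subset[of _ "S \<times> S"]) (auto simp: pairs_below_def)

lemma finite_swaps: "finite S \<Longrightarrow> finite (swaps p S)"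
  by (rule finite_subset[OF _ finite_pairs_below[of S]]) (auto simp: swaps_def)

text \<open>The points that lie in one of the given pairs.\<close>

definition cover :: "(nat \<times> nat) set \<Rightarrow> nat set" where
  "cover B = fst ` B \<union> snd ` B"

text \<open>If the pairs in \<open>U\<close> are orbits of \<open>p\<close>, they are disjoint. So a set of them is determined by its
union, and the unions are the \<open>p\<close>-invariant subsets. This translates the subsets of factors that
arise from multiplying out a product over \<open>U\<close> into sets of points.\<close>

lemma bij_betw_cover:
  assumes U: "\<And>i j. (i, j) \<in> U \<Longrightarrow> i \<le> j \<and> p i = j \<and> p j = i"
  shows "bij_betw cover (Pow U) {E. E \<subseteq> cover U \<and> (\<forall>x\<in>E. p x \<in> E)}"
proof (rule bij_betw_byWitness[where f' = "\<lambda>E. {(i, j) \<in> U. i \<in> E}"])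
  show "\<forall>B\<in>Pow U. {(i, j) \<in> U. i \<in> cover B} = B"
  proof (intro ballI equalityI subsetI)
    fix B x assume B: "B \<in> Pow U" and x: "x \<in> {(i, j) \<in> U. i \<in> cover B}"
    then obtain i j where ij: "x = (i, j)" "(i, j) \<in> U" "i \<in> cover B" by auto
    then consider k where "(i, k) \<in> B" | k where "(k, i) \<in> B" by (auto simp: cover_def)
    then show "x \<in> B"
    proof cases
      case 1
      then have "k = j" using U B ij by (metis PowD subsetD)
      then show ?thesis using 1 ij by simp
    next
      case 2
      then have "p i = k" "k \<le> i" "p i = j" "i \<le> j" using U B ij by (metis PowD subsetD)+
      then show ?thesis using 2 ij by auto
    qed
  next
    fix B x assume "B \<in> Pow U" "x \<in> B"
    then show "x \<in> {(i, j) \<in> U. i \<in> cover B}"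
      by (cases x) (force simp: cover_def)
  qed
  show "\<forall>E\<in>{E. E \<subseteq> cover U \<and> (\<forall>x\<in>E. p x \<in> E)}. cover {(i, j) \<in> U. i \<in> E} = E"
  proof (intro ballI equalityI subsetI)
    fix E x assume E: "E \<in> {E. E \<subseteq> cover U \<and> (\<forall>x\<in>E. p x \<in> E)}"
      and "x \<in> cover {(i, j) \<in> U. i \<in> E}"
    then obtain i j where "(i, j) \<in> U" "i \<in> E" "x = i \<or> x = j" by (auto simp: cover_def)
    then show "x \<in> E" using U[of i j] E by auto
  next
    fix E x assume E: "E \<in> {E. E \<subseteq> cover U \<and> (\<forall>x\<in>E. p x \<in> E)}" and x: "x \<in> E"
    then have "x \<in> cover U" by auto
    then obtain i j where ij: "(i, j) \<in> U" "x = i \<or> x = j" by (auto simp: cover_def)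
    then have "i \<in> E" using U[OF ij(1)] E x by auto
    then show "x \<in> cover {(i, j) \<in> U. i \<in> E}" using ij by (force simp: cover_def)
  qed
  show "cover ` Pow U \<subseteq> {E. E \<subseteq> cover U \<and> (\<forall>x\<in>E. p x \<in> E)}"
  proof -
    have "cover B \<subseteq> cover U" if "B \<subseteq> U" for B using that by (auto simp: cover_def)
    moreover have "p x \<in> cover B" if B: "B \<subseteq> U" and x: "x \<in> cover B" for B x
    proof -
      obtain i j where ij: "(i, j) \<in> B" "x = i \<or> x = j" using x by (auto simp: cover_def)
      then have "p x = j \<or> p x = i" using U[of i j] B by auto
      then show ?thesis using ij by (force simp: cover_def)
    qed
    ultimately show ?thesis by blast
  qed
  show "(\<lambda>E. {(i, j) \<in> U. i \<in> E}) ` {E. E \<subseteq> cover U \<and> (\<forall>x\<in>E. p x \<in> E)} \<subseteq> Pow U"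
    by auto
qed

lemma card_cover:
  assumes U: "\<And>i j. (i, j) \<in> U \<Longrightarrow> i < j \<and> p i = j \<and> p j = i" and fin: "finite U"
  shows "card (cover U) = 2 * card U"
proof -
  have "inj_on fst U" by (rule inj_onI) (metis U prod.collapse)
  moreover have "inj_on snd U" by (rule inj_onI) (metis U prod.collapse)
  moreover have "fst ` U \<inter> snd ` U = {}"
  proof -
    have False if "(a, b) \<in> U" "(c, a) \<in> U" for a b c
      using U[OF that(1)] U[OF that(2)] by simp
    then show ?thesis by (force simp: set_eq_iff)
  qed
  ultimately show ?thesis using fin unfolding cover_def
    by (subst card_Un_disjoint) (auto simp: card_image)
qed

lemma bij_betw_permutes_split:
  assumes D: "D \<subseteq> S"
  shows "bij_betw (\<lambda>(p, q). p \<circ> q) ({p. p permutes D} \<times> {q. q permutes S - D})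
    {s. s permutes S \<and> s ` D = D}"
proof -
  have in_D: "(p \<circ> q) x = p x" if "q permutes S - D" "x \<in> D" for p q x
    using that permutes_not_in[of q "S - D" x] by auto
  have out_D: "(p \<circ> q) x = q x" if "p permutes D" "q permutes S - D" "x \<notin> D" for p q x
  proof (cases "x \<in> S")
    case True
    then have "q x \<notin> D" using that permutes_in_image[of q "S - D" x] by auto
    then show ?thesis using that(1) by (simp add: permutes_not_in)
  next
    case False
    then have "q x = x" using that by (intro permutes_not_in[of q "S - D"]) auto
    then show ?thesis using that by (simp add: permutes_not_in)
  qed
  show ?thesis
  proof (rule bij_betw_byWitness[where f' = "\<lambda>s. (restrict_id s D, restrict_id s (S - D))"])
    show "\<forall>a\<in>{p. p permutes D} \<times> {q. q permutes S - D}.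
       (case case a of (p, q) \<Rightarrow> p \<circ> q of s \<Rightarrow> (restrict_id s D, restrict_id s (S - D))) = a"
    proof
      fix a assume "a \<in> {p. p permutes D} \<times> {q. q permutes S - D}"
      then obtain p q where a: "a = (p, q)" and pq: "p permutes D" "q permutes S - D" by auto
      have "restrict_id (p \<circ> q) D x = p x" for x
        using in_D[OF pq(2)] pq by (auto simp: restrict_id_def permutes_not_in simp del: o_apply)
      moreover have "restrict_id (p \<circ> q) (S - D) x = q x" for x
        using out_D[OF pq] permutes_not_in[OF pq(2)] by (auto simp: restrict_id_def simp del: o_apply)
      ultimately show "(case case a of (p, q) \<Rightarrow> p \<circ> q of s \<Rightarrow> (restrict_id s D, restrict_id s (S - D))) = a"
        by (simp add: a fun_eq_iff)
    qed
    show "\<forall>s\<in>{s. s permutes S \<and> s ` D = D}. (case (restrict_id s D, restrict_id s (S - D)) of (p, q) \<Rightarrow> p \<circ> q) = s"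
    proof (intro ballI, unfold prod.case, rule ext)
      fix s x assume "s \<in> {s. s permutes S \<and> s ` D = D}"
      then have s: "s permutes S" "s ` D = D" by auto
      have "s x \<in> D \<longleftrightarrow> x \<in> D" using s by (metis inj_image_mem_iff permutes_inj)
      then show "(restrict_id s D \<circ> restrict_id s (S - D)) x = s x"
        using s D by (auto simp: restrict_id_def permutes_not_in)
    qed
    show "(\<lambda>(p, q). p \<circ> q) ` ({p. p permutes D} \<times> {q. q permutes S - D}) \<subseteq> {s. s permutes S \<and> s ` D = D}"
    proof (rule image_subsetI)
      fix a assume "a \<in> {p. p permutes D} \<times> {q. q permutes S - D}"
      then obtain p q where a: "a = (p, q)" and pq: "p permutes D" "q permutes S - D" by auto
      have "(p \<circ> q) ` D = p ` D" using in_D[OF pq(2)] by (intro image_cong) auto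
      then show "(case a of (p, q) \<Rightarrow> p \<circ> q) \<in> {s. s permutes S \<and> s ` D = D}"
        unfolding a using pq D by (auto intro!: permutes_compose intro: permutes_subset simp: permutes_image)
    qed
    show "(\<lambda>s. (restrict_id s D, restrict_id s (S - D))) ` {s. s permutes S \<and> s ` D = D}
       \<subseteq> {p. p permutes D} \<times> {q. q permutes S - D}"
    proof (rule image_subsetI)
      fix s assume "s \<in> {s. s permutes S \<and> s ` D = D}"
      then have s: "s permutes S" "s ` D = D" by auto
      have inj: "inj s" using s permutes_inj by blast
      have "s ` (S - D) = S - D" using s by (simp add: image_set_diff[OF inj] permutes_image)
      then have "bij_betw s D D" "bij_betw s (S - D) (S - D)"
        using s inj by (auto simp: bij_betw_def inj_on_def)
      then show "(restrict_id s D, restrict_id s (S - D)) \<in> {p. p permutes D} \<times> {q. q permutes S - D}"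
        by (simp add: permutes_restrict_id)
    qed
  qed
qed

text \<open>Write \<open>c = (c - 1) + 1\<close> for each 2-cycle and multiply out: this marks some of the 2-cycles with weight
\<open>c - 1\<close>. Summing over the set \<open>E\<close> of marked points first, the marked part is any matching of
\<open>E\<close> and the rest is any permutation of \<open>S - E\<close>.\<close>

lemma sum_cycle2_weight:
  fixes c :: real
  assumes fin: "finite S"
  shows "(\<Sum>p | p permutes S. c ^ card (swaps p S)) =
    (\<Sum>E\<in>Pow S. real (card (matchings E)) * (c - 1) ^ (card E div 2) * fact (card S - card E))"
proof -
  \<comment> \<open>The possible sets of marked points: unions of 2-cycles of \<open>p\<close>.\<close>
  define V where "V p = {E. E \<subseteq> S \<and> (\<forall>x\<in>E. p x \<in> E \<and> p (p x) = x \<and> p x \<noteq> x)}" for p :: "nat \<Rightarrow> nat"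
  have VS: "V p = {E. E \<subseteq> cover (swaps p S) \<and> (\<forall>x\<in>E. p x \<in> E)}" for p
  proof -
    have *: "x \<in> cover (swaps p S)" if "E \<subseteq> S" "\<forall>x\<in>E. p x \<in> E \<and> p (p x) = x \<and> p x \<noteq> x" "x \<in> E" for E x
    proof -
      have "(x, p x) \<in> swaps p S \<or> (p x, x) \<in> swaps p S"
        using that unfolding swaps_def pairs_below_def by (auto simp: neq_iff)
      then show ?thesis by (force simp: cover_def)
    qed
    have **: "x \<in> S \<and> p (p x) = x \<and> p x \<noteq> x" if "x \<in> cover (swaps p S)" for x
      using that by (auto simp: cover_def swaps_def pairs_below_def)
    show ?thesis unfolding V_def
    proof (intro equalityI subsetI CollectI; elim CollectE conjE)
      fix E assume "E \<subseteq> S" "\<forall>x\<in>E. p x \<in> E \<and> p (p x) = x \<and> p x \<noteq> x"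
      then show "E \<subseteq> cover (swaps p S) \<and> (\<forall>x\<in>E. p x \<in> E)" using * by simp blast
    next
      fix E assume "E \<subseteq> cover (swaps p S)" "\<forall>x\<in>E. p x \<in> E"
      then show "E \<subseteq> S \<and> (\<forall>x\<in>E. p x \<in> E \<and> p (p x) = x \<and> p x \<noteq> x)" using ** by simp blast
    qed
  qed
  have 1: "c ^ card (swaps p S) = (\<Sum>E\<in>V p. (c - 1) ^ (card E div 2))" for p
  proof -
    let ?U = "swaps p S"
    have "c ^ card ?U = (\<Prod>u\<in>?U. (c - 1) + 1)" by simp
    also have "\<dots> = (\<Sum>B\<in>Pow ?U. (c - 1) ^ card B)"
      by (subst prod_add[OF finite_swaps[OF fin]]) simp
    also have "\<dots> = (\<Sum>B\<in>Pow ?U. (c - 1) ^ (card (cover B) div 2))"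
    proof (rule sum.cong[OF refl])
      fix B assume B: "B \<in> Pow ?U"
      then have "finite B" using finite_swaps[OF fin, of p] finite_subset by auto
      then have "card (cover B) = 2 * card B"
        using B by (intro card_cover[where p = p]) (auto simp: swaps_def pairs_below_def)
      then show "(c - 1) ^ card B = (c - 1) ^ (card (cover B) div 2)" by simp
    qed
    also have "\<dots> = (\<Sum>E\<in>V p. (c - 1) ^ (card E div 2))"
      unfolding VS by (rule sum.reindex_bij_betw[OF bij_betw_cover])
        (auto simp: swaps_def pairs_below_def)
    finally show ?thesis .
  qed
  have V_Pow: "V p \<subseteq> Pow S" for p by (auto simp: V_def)
  have "(\<Sum>p | p permutes S. c ^ card (swaps p S)) =
      (\<Sum>p | p permutes S. \<Sum>E | E \<in> Pow S \<and> E \<in> V p. (c - 1) ^ (card E div 2))"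
    unfolding 1 by (intro sum.cong refl) (use V_Pow in blast)
  also have "\<dots> = (\<Sum>E\<in>Pow S. \<Sum>p | p \<in> {p. p permutes S} \<and> E \<in> V p. (c - 1) ^ (card E div 2))"
    using sum.swap_restrict[of "{p. p permutes S}" "Pow S" "\<lambda>p E. (c - 1) ^ (card E div 2)" "\<lambda>p E. E \<in> V p"]
      fin finite_permutations[OF fin] by simp
  also have "\<dots> = (\<Sum>E\<in>Pow S. real (card (matchings E)) * (c - 1) ^ (card E div 2) * fact (card S - card E))"
  proof (rule sum.cong[OF refl])
    fix E assume "E \<in> Pow S"
    then have E: "E \<subseteq> S" and finE: "finite E" using fin finite_subset by auto
    have "bij_betw (\<lambda>(p, q). p \<circ> q) (matchings E \<times> {q. q permutes S - E}) {p \<in> {p. p permutes S}. E \<in> V p}"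
    proof (rule bij_betw_subset[OF bij_betw_permutes_split[OF E]])
      show "matchings E \<times> {q. q permutes S - E} \<subseteq> {p. p permutes E} \<times> {q. q permutes S - E}"
        by (auto simp: matchings_def involutions_def)
      have val: "(p \<circ> q) x = p x" if "q permutes S - E" "x \<in> E" for p q x
        using that permutes_not_in[of q "S - E" x] by auto
      show "(\<lambda>(p, q). p \<circ> q) ` (matchings E \<times> {q. q permutes S - E}) = {p \<in> {p. p permutes S}. E \<in> V p}"
      proof (intro equalityI subsetI)
        fix s assume "s \<in> (\<lambda>(p, q). p \<circ> q) ` (matchings E \<times> {q. q permutes S - E})"
        then obtain p q where s: "s = p \<circ> q" and p: "p permutes E" "\<And>x. p (p x) = x" "\<And>x. x \<in> E \<Longrightarrow> p x \<noteq> x"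
          and q: "q permutes S - E" by (auto simp: matchings_def involutions_def)
        have "s permutes S" unfolding s using p q E
          by (auto intro!: permutes_compose intro: permutes_subset)
        moreover have "s x = p x" if "x \<in> E" for x unfolding s using val[OF q that] .
        ultimately show "s \<in> {p \<in> {p. p permutes S}. E \<in> V p}"
          using p E by (auto simp: V_def permutes_in_image)
      next
        fix s assume "s \<in> {p \<in> {p. p permutes S}. E \<in> V p}"
        then have s: "s permutes S" and sE: "\<And>x. x \<in> E \<Longrightarrow> s x \<in> E \<and> s (s x) = x \<and> s x \<noteq> x"
          by (auto simp: V_def)
        have "s ` E = E"
        proof (intro equalityI subsetI)
          fix x assume "x \<in> E"
          then show "x \<in> s ` E" using sE by (metis imageI)
        qed (use sE in auto)
        then have "s \<in> (\<lambda>(p, q). p \<circ> q) ` ({p. p permutes E} \<times> {q. q permutes S - E})"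
          using s bij_betw_imp_surj_on[OF bij_betw_permutes_split[OF E]] by simp
        then obtain p q where pq: "p permutes E" "q permutes S - E" "s = p \<circ> q" by auto
        have pE: "p x = s x" if "x \<in> E" for x using val[OF pq(2) that, of p] pq(3) by simp
        have "p (p x) = x" for x
          using pE sE[of x] pq(1) by (cases "x \<in> E") (auto simp: permutes_not_in)
        then have "p \<in> matchings E" using pq(1) pE sE by (auto simp: matchings_def involutions_def)
        then show "s \<in> (\<lambda>(p, q). p \<circ> q) ` (matchings E \<times> {q. q permutes S - E})"
          unfolding pq(3) using pq(2) by (intro image_eqI[of _ _ "(p, q)"]) auto
      qed
    qed
    note bij_betw_same_card[OF this]
    then have c1: "card {p \<in> {p. p permutes S}. E \<in> V p} = card (matchings E) * card {q. q permutes S - E}"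
      unfolding card_cartesian_product by (rule sym)
    have c2: "card {q. q permutes S - E} = fact (card S - card E)"
      using fin E by (intro card_permutations) (simp_all add: card_Diff_subset finE)
    show "(\<Sum>p | p \<in> {p. p permutes S} \<and> E \<in> V p. (c - 1) ^ (card E div 2)) =
      real (card (matchings E)) * (c - 1) ^ (card E div 2) * fact (card S - card E)"
      unfolding sum_constant c1 c2 by (simp add: mult_ac)
  qed
  finally show ?thesis .
qed

section \<open>Balanced pairs of permutations\<close>

text \<open>The condition for a nonzero expectation: with multiplicity, the edges \<open>i \<mapsto> \<sigma> i\<close> and \<open>i \<mapsto> \<tau> i\<close>
between two distinct points are as many in one direction as in the other.\<close>

definition balanced :: "nat set \<Rightarrow> (nat \<Rightarrow> nat) \<Rightarrow> (nat \<Rightarrow> nat) \<Rightarrow> bool" where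
  "balanced S \<sigma> \<tau> \<longleftrightarrow> (\<forall>i\<in>S. \<forall>j\<in>S. i \<noteq> j \<longrightarrow>
     of_bool (\<sigma> i = j) + of_bool (\<tau> i = j) = (of_bool (\<sigma> j = i) + of_bool (\<tau> j = i) :: nat))"

definition common_orbits :: "nat set \<Rightarrow> (nat \<Rightarrow> nat) \<Rightarrow> (nat \<Rightarrow> nat) \<Rightarrow> (nat \<times> nat) set" where
  "common_orbits S \<sigma> \<tau> =
    {(i, j). i \<in> S \<and> j \<in> S \<and> i \<le> j \<and> \<sigma> i = j \<and> \<sigma> j = i \<and> \<tau> i = j \<and> \<tau> j = i}"

text \<open>The admissible sets \<open>D\<close>: a pair \<open>(\<sigma>, \<tau>)\<close> splits along \<open>D\<close> if \<open>\<tau>\<close> inverts \<open>\<sigma>\<close> on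
\<open>D\<close> and both are involutions off \<open>D\<close>.\<close>

definition splittings :: "nat set \<Rightarrow> (nat \<Rightarrow> nat) \<Rightarrow> (nat \<Rightarrow> nat) \<Rightarrow> nat set set" where
  "splittings S \<sigma> \<tau> = {D. D \<subseteq> S \<and> \<sigma> ` D = D \<and> (\<forall>x\<in>D. \<tau> (\<sigma> x) = x) \<and>
     (\<forall>x\<in>S - D. \<sigma> (\<sigma> x) = x \<and> \<tau> (\<tau> x) = x)}"

text \<open>Follow the edge from \<open>x\<close> to \<open>\<sigma> x\<close>: it has to be traversed backwards, by \<open>\<sigma>\<close> or by
\<open>\<tau>\<close>. The same holds for the edge from \<open>x\<close> to \<open>\<tau> x\<close>, and injectivity excludes the mixed
cases.\<close>

lemma balanced_dichotomy:
  assumes bal: "balanced S \<sigma> \<tau>" and p: "\<sigma> permutes S" "\<tau> permutes S" and x: "x \<in> S"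
  shows "\<sigma> (\<sigma> x) = x \<and> \<tau> (\<tau> x) = x \<or> \<tau> (\<sigma> x) = x \<and> \<sigma> (\<tau> x) = x"
proof -
  have inj: "\<sigma> a = \<sigma> b \<Longrightarrow> a = b" "\<tau> a = \<tau> b \<Longrightarrow> a = b" for a b
    using p by (meson injD permutes_inj)+
  have inS: "\<sigma> x \<in> S" "\<tau> x \<in> S" using p x by (simp_all add: permutes_in_image)
  have bal': "of_bool (\<sigma> x = j) + of_bool (\<tau> x = j) = (of_bool (\<sigma> j = x) + of_bool (\<tau> j = x) :: nat)"
    if "j \<in> S" "j \<noteq> x" for j using bal that x unfolding balanced_def by metis
  have 1: "\<sigma> (\<sigma> x) = x \<or> \<tau> (\<sigma> x) = x" if "\<sigma> x \<noteq> x"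
    using bal'[OF inS(1) that] by (auto split: if_splits simp: of_bool_def)
  have 2: "\<sigma> (\<tau> x) = x \<or> \<tau> (\<tau> x) = x" if "\<tau> x \<noteq> x"
    using bal'[OF inS(2) that] by (auto split: if_splits simp: of_bool_def)
  have 3: "\<sigma> (\<sigma> x) = x \<and> \<tau> (\<sigma> x) = x" if "\<sigma> x = \<tau> x" "\<sigma> x \<noteq> x"
    using bal'[OF inS(1) that(2)] that(1) by (auto split: if_splits simp: of_bool_def)
  show ?thesis
  proof (cases "\<sigma> x = \<tau> x")
    case True
    then show ?thesis using 3 by metis
  next
    case False
    then show ?thesis using 1 2 inj by metis
  qed
qed

lemma splittings_imp_balanced:
  assumes D: "D \<in> splittings S \<sigma> \<tau>" and p: "\<sigma> permutes S" "\<tau> permutes S"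
  shows "balanced S \<sigma> \<tau>"
  unfolding balanced_def
proof (intro ballI impI)
  fix i j assume ij: "i \<in> S" "j \<in> S" "i \<noteq> j"
  have inj: "\<sigma> a = \<sigma> b \<longleftrightarrow> a = b" "\<tau> a = \<tau> b \<longleftrightarrow> a = b" for a b
    using p by (meson injD permutes_inj)+
  have sD: "\<sigma> ` D = D" and ts: "\<And>x. x \<in> D \<Longrightarrow> \<tau> (\<sigma> x) = x"
    and off: "\<And>x. x \<in> S - D \<Longrightarrow> \<sigma> (\<sigma> x) = x \<and> \<tau> (\<tau> x) = x"
    using D by (auto simp: splittings_def)
  have st: "\<sigma> (\<tau> x) = x" if x: "x \<in> D" for x
  proof -
    from x sD obtain k where "x = \<sigma> k" "k \<in> D" by blast
    then show ?thesis using ts by simp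
  qed
  consider "i \<in> D" "j \<in> D" | "i \<notin> D" "j \<notin> D" | "i \<in> D" "j \<notin> D" | "i \<notin> D" "j \<in> D" by blast
  then show "of_bool (\<sigma> i = j) + of_bool (\<tau> i = j) = (of_bool (\<sigma> j = i) + of_bool (\<tau> j = i) :: nat)"
  proof cases
    case 1
    then have "\<sigma> i = j \<longleftrightarrow> \<tau> j = i" "\<tau> i = j \<longleftrightarrow> \<sigma> j = i" using ts st by metis+
    then show ?thesis by simp
  next
    case 2
    then have "\<sigma> i = j \<longleftrightarrow> \<sigma> j = i" "\<tau> i = j \<longleftrightarrow> \<tau> j = i" using off ij by (metis DiffI)+
    then show ?thesis by simp
  next
    case 3
    then have "\<sigma> i \<noteq> j" "\<tau> i \<noteq> j" "\<sigma> j \<noteq> i" "\<tau> j \<noteq> i" using ts st sD inj by (metis imageI imageE)+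
    then show ?thesis by simp
  next
    case 4
    then have "\<sigma> i \<noteq> j" "\<tau> i \<noteq> j" "\<sigma> j \<noteq> i" "\<tau> j \<noteq> i" using ts st sD inj by (metis imageI imageE)+
    then show ?thesis by simp
  qed
qed

text \<open>The points with \<open>\<sigma> (\<sigma> x) \<noteq> x\<close> are those of the long cycles, and they belong to every admissible
\<open>D\<close>. The rest of \<open>D\<close> is a union of common orbits, which can be chosen freely.\<close>

lemma bij_betw_splittings:
  assumes bal: "balanced S \<sigma> \<tau>" and p: "\<sigma> permutes S" "\<tau> permutes S"
  shows "bij_betw (\<lambda>B. {x \<in> S. \<sigma> (\<sigma> x) \<noteq> x} \<union> cover B) (Pow (common_orbits S \<sigma> \<tau>)) (splittings S \<sigma> \<tau>)"
proof -
  define A where "A = {x \<in> S. \<sigma> (\<sigma> x) \<noteq> x}"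
  define C where "C = cover (common_orbits S \<sigma> \<tau>)"
  have inj: "\<sigma> a = \<sigma> b \<longleftrightarrow> a = b" "\<tau> a = \<tau> b \<longleftrightarrow> a = b" for a b
    using p by (meson injD permutes_inj)+
  have inS: "\<sigma> x \<in> S \<longleftrightarrow> x \<in> S" "\<tau> x \<in> S \<longleftrightarrow> x \<in> S" for x using p by (simp_all add: permutes_in_image)
  note dich = balanced_dichotomy[OF bal p]
  have C: "x \<in> C \<longleftrightarrow> x \<in> S \<and> \<sigma> (\<sigma> x) = x \<and> \<tau> x = \<sigma> x \<and> \<tau> (\<sigma> x) = x" for x
  proof
    assume "x \<in> C"
    then show "x \<in> S \<and> \<sigma> (\<sigma> x) = x \<and> \<tau> x = \<sigma> x \<and> \<tau> (\<sigma> x) = x"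
      by (auto simp: C_def cover_def common_orbits_def)
  next
    assume x: "x \<in> S \<and> \<sigma> (\<sigma> x) = x \<and> \<tau> x = \<sigma> x \<and> \<tau> (\<sigma> x) = x"
    then have "(x, \<sigma> x) \<in> common_orbits S \<sigma> \<tau> \<or> (\<sigma> x, x) \<in> common_orbits S \<sigma> \<tau>"
      using inS by (auto simp: common_orbits_def)
    then show "x \<in> C" by (force simp: C_def cover_def)
  qed
  have AC: "A \<inter> C = {}" using C by (auto simp: A_def)
  have A\<sigma>: "\<sigma> x \<in> A \<longleftrightarrow> x \<in> A" for x using inS inj by (auto simp: A_def)
  have \<tau>A: "\<tau> (\<sigma> x) = x" if "x \<in> A" for x using dich[of x] that by (auto simp: A_def)
  let ?W = "{E. E \<subseteq> C \<and> (\<forall>x\<in>E. \<sigma> x \<in> E)}"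
  have 1: "bij_betw cover (Pow (common_orbits S \<sigma> \<tau>)) ?W"
    unfolding C_def by (rule bij_betw_cover) (auto simp: common_orbits_def)
  have 2: "bij_betw (\<lambda>E. A \<union> E) ?W (splittings S \<sigma> \<tau>)"
  proof (rule bij_betw_byWitness[where f' = "\<lambda>D. D - A"])
    show "\<forall>E\<in>?W. A \<union> E - A = E" using AC by blast
    have sub: "A \<subseteq> D" if "D \<in> splittings S \<sigma> \<tau>" for D
      using that by (auto simp: splittings_def A_def)
    then show "\<forall>D\<in>splittings S \<sigma> \<tau>. A \<union> (D - A) = D" by blast
    show "(\<lambda>E. A \<union> E) ` ?W \<subseteq> splittings S \<sigma> \<tau>"
    proof (rule image_subsetI)
      fix E assume "E \<in> ?W"
      then have E: "E \<subseteq> C" "\<And>x. x \<in> E \<Longrightarrow> \<sigma> x \<in> E" by auto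
      have surj: "x \<in> \<sigma> ` (A \<union> E)" if x: "x \<in> A \<union> E" for x
      proof (cases "x \<in> A")
        case True
        obtain y where y: "x = \<sigma> y" using p(1) by (metis permutes_surj surjD)
        then have "y \<in> A" using A\<sigma> True by simp
        then show ?thesis using y by blast
      next
        case False
        then have "x \<in> E" using x by simp
        then have "x = \<sigma> (\<sigma> x)" "\<sigma> x \<in> E" using E C by auto
        then show ?thesis by blast
      qed
      have "\<sigma> ` (A \<union> E) = A \<union> E" using surj A\<sigma> E(2) by blast
      moreover have "A \<union> E \<subseteq> S" using E(1) C by (auto simp: A_def)
      moreover have "\<forall>x\<in>A \<union> E. \<tau> (\<sigma> x) = x" using \<tau>A E(1) C by auto
      moreover have "\<sigma> (\<sigma> x) = x \<and> \<tau> (\<tau> x) = x" if x: "x \<in> S - (A \<union> E)" for x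
      proof -
        have s: "\<sigma> (\<sigma> x) = x" using x by (auto simp: A_def)
        have "\<tau> (\<tau> x) = x" using dich[of x] x s inj by (metis DiffD1)
        then show ?thesis using s by simp
      qed
      ultimately show "A \<union> E \<in> splittings S \<sigma> \<tau>" by (auto simp: splittings_def)
    qed
    show "(\<lambda>D. D - A) ` splittings S \<sigma> \<tau> \<subseteq> ?W"
    proof (rule image_subsetI)
      fix D assume D: "D \<in> splittings S \<sigma> \<tau>"
      then have D1: "D \<subseteq> S" "\<sigma> ` D = D" "\<And>x. x \<in> D \<Longrightarrow> \<tau> (\<sigma> x) = x" by (auto simp: splittings_def)
      have "x \<in> C" if x: "x \<in> D - A" for x
      proof -
        have "\<sigma> (\<sigma> x) = x" using x D1 by (auto simp: A_def)
        moreover have "\<sigma> x \<in> D" using x D1 by blast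
        ultimately show ?thesis unfolding C using D1 x by (metis DiffD1 subsetD)
      qed
      moreover have "\<sigma> x \<in> D - A" if "x \<in> D - A" for x using that D1 A\<sigma> by blast
      ultimately show "D - A \<in> ?W" by blast
    qed
  qed
  show ?thesis using bij_betw_trans[OF 1 2] by (simp add: o_def A_def)
qed

definition diag_weight :: "real \<Rightarrow> real \<Rightarrow> bool \<Rightarrow> bool \<Rightarrow> real" where
  "diag_weight \<mu> \<nu> s t = (if s \<and> t then 1 + \<mu> * \<nu> else (if s then - \<mu> else 1) * (if t then - \<nu> else 1))"

text \<open>The expectation belonging to \<open>\<sigma>\<close> and \<open>\<tau>\<close>, up to their signs, when the absolute fourth moment of
the off-diagonal entries is \<open>c + 1\<close>.\<close>

definition pair_weight :: "real \<Rightarrow> real \<Rightarrow> real \<Rightarrow> nat set \<Rightarrow> (nat \<Rightarrow> nat) \<Rightarrow> (nat \<Rightarrow> nat) \<Rightarrow> real" where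
  "pair_weight c \<mu> \<nu> S \<sigma> \<tau> = (if balanced S \<sigma> \<tau>
     then (\<Prod>i\<in>S. diag_weight \<mu> \<nu> (\<sigma> i = i) (\<tau> i = i)) *
       (\<Prod>(i, j)\<in>pairs_below S. if \<sigma> i = j \<and> \<sigma> j = i \<and> \<tau> i = j \<and> \<tau> j = i then c + 1 else 1)
     else 0)"

text \<open>Each common orbit has a weight of the form \<open>\<alpha> + \<beta>\<close>, namely \<open>1 + \<mu> \<nu>\<close> or
\<open>c + 1\<close>. In the expanded product the orbits that contribute \<open>\<alpha>\<close> are those put into \<open>D\<close>, and those
that contribute \<open>\<beta>\<close> are counted with the involutions off \<open>D\<close>.\<close>

lemma pair_weight_splittings:
  assumes fin: "finite S" and p: "\<sigma> permutes S" "\<tau> permutes S"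
  shows "pair_weight c \<mu> \<nu> S \<sigma> \<tau> = (\<Sum>D\<in>splittings S \<sigma> \<tau>. c ^ card (swaps \<sigma> D) *
    (\<Prod>i\<in>S - D. (if \<sigma> i = i then - \<mu> else 1) * (if \<tau> i = i then - \<nu> else 1)))"
proof (cases "balanced S \<sigma> \<tau>")
  case False
  then have "splittings S \<sigma> \<tau> = {}" using splittings_imp_balanced[OF _ p] by blast
  then show ?thesis using False by (simp add: pair_weight_def)
next
  case bal: True
  define U where "U = common_orbits S \<sigma> \<tau>"
  define A where "A = {x \<in> S. \<sigma> (\<sigma> x) \<noteq> x}"
  define F where "F = {i \<in> S. \<sigma> i = i \<and> \<tau> i = i}"
  define O' where "O' = {(i, j) \<in> U. i < j}"
  define d where "d i = (if \<sigma> i = i then - \<mu> else 1) * (if \<tau> i = i then - \<nu> else 1)" for i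
  define \<alpha> where "\<alpha> = (\<lambda>(i, j). if i = (j::nat) then 1 else c)"
  define \<beta> where "\<beta> = (\<lambda>(i, j). if i = (j::nat) then \<mu> * \<nu> else 1)"
  have finU: "finite U"
    by (rule finite_subset[of _ "S \<times> S"]) (use fin in \<open>auto simp: U_def common_orbits_def\<close>)
  have finO: "finite O'" using finU by (auto simp: O'_def intro: finite_subset)
  have U_split: "U = (\<lambda>i. (i, i)) ` F \<union> O'"
    by (auto simp: U_def O'_def F_def common_orbits_def)
  have prodU: "(\<Prod>u\<in>U. g u) = (\<Prod>i\<in>F. g (i, i)) * (\<Prod>u\<in>O'. g u)" for g :: "nat \<times> nat \<Rightarrow> real"
  proof -
    have "(\<Prod>u\<in>U. g u) = (\<Prod>u\<in>(\<lambda>i. (i, i)) ` F. g u) * (\<Prod>u\<in>O'. g u)"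
      unfolding U_split
      by (rule prod.union_disjoint) (use fin finO in \<open>auto simp: F_def O'_def\<close>)
    also have "(\<Prod>u\<in>(\<lambda>i. (i, i)) ` F. g u) = (\<Prod>i\<in>F. g (i, i))"
      by (subst prod.reindex) (auto simp: inj_on_def)
    finally show ?thesis .
  qed
  have "(\<Prod>i\<in>S. diag_weight \<mu> \<nu> (\<sigma> i = i) (\<tau> i = i)) =
      (\<Prod>i\<in>S - F. d i) * (\<Prod>i\<in>F. 1 + \<mu> * \<nu>)"
  proof -
    have "(\<Prod>i\<in>S. diag_weight \<mu> \<nu> (\<sigma> i = i) (\<tau> i = i)) =
      (\<Prod>i\<in>S - F. diag_weight \<mu> \<nu> (\<sigma> i = i) (\<tau> i = i)) * (\<Prod>i\<in>F. diag_weight \<mu> \<nu> (\<sigma> i = i) (\<tau> i = i))"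
      by (rule prod.subset_diff) (use fin in \<open>auto simp: F_def\<close>)
    also have "(\<Prod>i\<in>S - F. diag_weight \<mu> \<nu> (\<sigma> i = i) (\<tau> i = i)) = (\<Prod>i\<in>S - F. d i)"
      by (rule prod.cong) (auto simp: F_def diag_weight_def d_def)
    also have "(\<Prod>i\<in>F. diag_weight \<mu> \<nu> (\<sigma> i = i) (\<tau> i = i)) = (\<Prod>i\<in>F. 1 + \<mu> * \<nu>)"
      by (rule prod.cong) (auto simp: F_def diag_weight_def)
    finally show ?thesis .
  qed
  moreover have "(\<Prod>(i, j)\<in>pairs_below S. if \<sigma> i = j \<and> \<sigma> j = i \<and> \<tau> i = j \<and> \<tau> j = i then c + 1 else 1) =
    (\<Prod>u\<in>O'. c + 1)"
    by (rule prod.mono_neutral_cong_right[OF finite_pairs_below[OF fin]])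
       (auto simp: O'_def U_def common_orbits_def pairs_below_def split: if_splits)
  ultimately have "pair_weight c \<mu> \<nu> S \<sigma> \<tau> =
      (\<Prod>i\<in>S - F. d i) * ((\<Prod>i\<in>F. \<alpha> (i, i) + \<beta> (i, i)) * (\<Prod>u\<in>O'. \<alpha> u + \<beta> u))"
    using bal unfolding pair_weight_def
    by (auto simp: \<alpha>_def \<beta>_def O'_def case_prod_beta intro!: prod.cong)
  also have "\<dots> = (\<Prod>i\<in>S - F. d i) * (\<Sum>B\<in>Pow U. prod \<alpha> B * prod \<beta> (U - B))"
    using prodU[of "\<lambda>u. \<alpha> u + \<beta> u"] prod_add[OF finU, of \<alpha> \<beta>] by simp
  also have "\<dots> = (\<Sum>B\<in>Pow U. c ^ card (swaps \<sigma> (A \<union> cover B)) * (\<Prod>i\<in>S - (A \<union> cover B). d i))"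
    unfolding sum_distrib_left
  proof (rule sum.cong[OF refl])
    fix B assume "B \<in> Pow U"
    then have B: "B \<subseteq> U" by simp
    define D where "D = A \<union> cover B"
    have finB: "finite B" using B finU finite_subset by blast
    have DV: "D \<in> splittings S \<sigma> \<tau>"
      using bij_betw_splittings[OF bal p] B unfolding D_def A_def U_def bij_betw_def by blast
    then have DS: "D \<subseteq> S" and sD: "\<sigma> ` D = D" and ts: "\<And>x. x \<in> D \<Longrightarrow> \<tau> (\<sigma> x) = x"
      by (auto simp: splittings_def)
    have inB: "(i, j) \<in> B" if "(i, j) \<in> U" "i \<in> D" for i j
    proof -
      have "i \<in> cover B" using that by (auto simp: D_def A_def U_def common_orbits_def)
      then consider k where "(i, k) \<in> B" | k where "(k, i) \<in> B" by (auto simp: cover_def)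
      then show ?thesis
      proof cases
        case 1
        then have "k = j" using B that(1) by (auto simp: U_def common_orbits_def)
        then show ?thesis using 1 by simp
      next
        case 2
        then have "(k, i) \<in> U" using B by auto
        then have "k = i \<and> i = j" using that(1) by (auto simp: U_def common_orbits_def)
        then show ?thesis using 2 by simp
      qed
    qed
    have Bin: "i \<in> D" "j \<in> D" if "(i, j) \<in> B" for i j
      using that by (force simp: D_def cover_def)+
    have swaps_eq: "swaps \<sigma> D = {(i, j) \<in> B. i \<noteq> j}"
    proof (intro equalityI subsetI; clarify)
      fix i j assume "(i, j) \<in> swaps \<sigma> D"
      then have *: "i \<in> D" "j \<in> D" "i < j" "\<sigma> i = j" "\<sigma> j = i" by (auto simp: swaps_def pairs_below_def)
      then have "(i, j) \<in> U" using ts[of i] ts[of j] DS by (auto simp: U_def common_orbits_def)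
      then show "(i, j) \<in> B \<and> i \<noteq> j" using * inB by auto
    next
      fix i j assume "(i, j) \<in> B" "i \<noteq> j"
      then show "(i, j) \<in> swaps \<sigma> D"
        using Bin[of i j] B by (auto simp: swaps_def pairs_below_def U_def common_orbits_def)
    qed
    have "prod \<alpha> B = (\<Prod>u\<in>{(i, j) \<in> B. i \<noteq> j}. c)"
      by (rule prod.mono_neutral_cong_right) (use finB in \<open>auto simp: \<alpha>_def\<close>)
    then have pa: "prod \<alpha> B = c ^ card (swaps \<sigma> D)" by (simp add: swaps_eq)
    have "prod \<beta> (U - B) = (\<Prod>u\<in>(\<lambda>i. (i, i)) ` (F - D). \<mu> * \<nu>)"
    proof (rule prod.mono_neutral_cong_right)
      show "\<forall>u\<in>U - B - (\<lambda>i. (i, i)) ` (F - D). \<beta> u = 1"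
      proof
        fix u assume u: "u \<in> U - B - (\<lambda>i. (i, i)) ` (F - D)"
        obtain i j where ij: "u = (i, j)" by (cases u)
        show "\<beta> u = 1"
        proof (cases "i = j")
          case True
          then have "i \<in> F" using u ij by (auto simp: U_def common_orbits_def F_def)
          then have "i \<in> D" using u ij True by auto
          then show ?thesis using inB[of i j] u ij by auto
        qed (simp add: ij \<beta>_def)
      qed
      show "(\<lambda>i. (i, i)) ` (F - D) \<subseteq> U - B" using Bin by (auto simp: U_split)
    qed (use finU in \<open>auto simp: \<beta>_def\<close>)
    also have "\<dots> = (\<Prod>i\<in>F - D. d i)"
      by (subst prod.reindex) (auto simp: inj_on_def F_def d_def)
    finally have pb: "prod \<beta> (U - B) = (\<Prod>i\<in>F - D. d i)" .
    \<comment> \<open>A point of \<open>D\<close> that only one of the two permutations fixed would have an edge without return.\<close>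
    have one: "d i = 1" if "i \<in> D" "i \<notin> F" for i
    proof -
      have iS: "i \<in> S" using that DS by auto
      have "\<sigma> i \<noteq> i" using ts[OF that(1)] that iS by (auto simp: F_def)
      moreover have "\<tau> i \<noteq> i"
      proof
        assume t: "\<tau> i = i"
        have "i \<in> \<sigma> ` D" using sD that(1) by simp
        then obtain k where k: "i = \<sigma> k" "k \<in> D" by (rule imageE)
        then have "k = i" using ts[of k] t by simp
        then show False using k t that iS by (auto simp: F_def)
      qed
      ultimately show ?thesis by (simp add: d_def)
    qed
    have "(\<Prod>i\<in>S - F. d i) = (\<Prod>i\<in>S - F - D. d i)"
      by (rule prod.mono_neutral_right) (use fin one in auto)
    moreover have "(\<Prod>i\<in>S - D. d i) = (\<Prod>i\<in>(S - F - D) \<union> (F - D). d i)"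
      by (rule prod.cong) (auto simp: F_def)
    moreover have "\<dots> = (\<Prod>i\<in>S - F - D. d i) * (\<Prod>i\<in>F - D. d i)"
      by (rule prod.union_disjoint) (use fin in \<open>auto simp: F_def\<close>)
    ultimately show "(\<Prod>i\<in>S - F. d i) * (prod \<alpha> B * prod \<beta> (U - B)) =
        c ^ card (swaps \<sigma> (A \<union> cover B)) * (\<Prod>i\<in>S - (A \<union> cover B). d i)"
      by (simp add: pa pb D_def[symmetric])
  qed
  also have "\<dots> = (\<Sum>D\<in>splittings S \<sigma> \<tau>. c ^ card (swaps \<sigma> D) * (\<Prod>i\<in>S - D. d i))"
    using sum.reindex_bij_betw[OF bij_betw_splittings[OF bal p],
        of "\<lambda>D. c ^ card (swaps \<sigma> D) * (\<Prod>i\<in>S - D. d i)"]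
    by (simp add: A_def U_def)
  finally show ?thesis by (simp add: d_def)
qed

text \<open>For fixed \<open>D\<close> the pairs that split along \<open>D\<close> consist of one permutation \<open>p\<close> of \<open>D\<close>, used
forwards by \<open>\<sigma>\<close> and backwards by \<open>\<tau>\<close>, and of two unrelated involutions.\<close>

lemma bij_betw_splitting_pairs:
  assumes D: "D \<subseteq> S"
  shows "bij_betw (\<lambda>(p, q, r). (p \<circ> q, inv_into UNIV p \<circ> r))
    ({p. p permutes D} \<times> involutions (S - D) \<times> involutions (S - D))
    {(\<sigma>, \<tau>). \<sigma> permutes S \<and> \<tau> permutes S \<and> D \<in> splittings S \<sigma> \<tau>}"
    (is "bij_betw ?f ?X ?Y")
proof -
  have in_D: "(p \<circ> q) x = p x" if "q permutes S - D" "x \<in> D" for p q :: "nat \<Rightarrow> nat" and x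
    using that permutes_not_in[of q "S - D" x] by auto
  have out_D: "(p \<circ> q) x = q x" if "p permutes D" "q permutes S - D" "x \<in> S - D" for p q :: "nat \<Rightarrow> nat" and x
    using that permutes_in_image[of q "S - D" x] permutes_not_in[of p D "q x"] by auto
  have inj: "p = p' \<and> q = q'"
    if "p permutes D" "q permutes S - D" "p' permutes D" "q' permutes S - D" "p \<circ> q = p' \<circ> q'" for p q p' q'
    using bij_betw_imp_inj_on[OF bij_betw_permutes_split[OF D]] that
    by (auto dest!: inj_onD[of _ _ "(p, q)" "(p', q')"])
  have surj: "\<exists>p q. p permutes D \<and> q permutes S - D \<and> s = p \<circ> q" if "s permutes S" "s ` D = D" for s
  proof -
    have "s \<in> (\<lambda>(p, q). p \<circ> q) ` ({p. p permutes D} \<times> {q. q permutes S - D})"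
      using that bij_betw_imp_surj_on[OF bij_betw_permutes_split[OF D]] by simp
    then show ?thesis by auto
  qed
  have invol: "q permutes T" "\<And>x. q (q x) = x" if "q \<in> involutions T" for q :: "nat \<Rightarrow> nat" and T
    using that by (auto simp: involutions_def)
  show ?thesis
    unfolding bij_betw_def
  proof
    show "inj_on ?f ?X"
    proof (rule inj_onI)
      fix u v assume u: "u \<in> ?X" and v: "v \<in> ?X" and eq: "?f u = ?f v"
      obtain p q r where u': "u = (p, q, r)" by (cases u)
      obtain p' q' r' where v': "v = (p', q', r')" by (cases v)
      have "p = p' \<and> q = q'" using u v eq by (intro inj) (auto simp: u' v' intro: invol)
      moreover have "inv_into UNIV p = inv_into UNIV p' \<and> r = r'"
        using u v eq by (intro inj) (auto simp: u' v' intro: invol permutes_inv)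
      ultimately show "u = v" by (simp add: u' v')
    qed
    show "?f ` ?X = ?Y"
    proof (intro equalityI image_subsetI subsetI)
      fix u assume u: "u \<in> ?X"
      obtain p q r where u': "u = (p, q, r)" by (cases u)
      have p: "p permutes D" "inv_into UNIV p permutes D" and q: "q permutes S - D" "\<And>x. q (q x) = x"
        and r: "r permutes S - D" "\<And>x. r (r x) = x"
        using u u' invol permutes_inv by auto
      have perm: "p \<circ> q permutes S" "inv_into UNIV p \<circ> r permutes S"
        using p q r D by (auto intro!: permutes_compose intro: permutes_subset)
      have "(p \<circ> q) ` D = p ` D" using in_D[OF q(1)] by (intro image_cong) auto
      then have img: "(p \<circ> q) ` D = D" using p by (simp add: permutes_image)
      have "(inv_into UNIV p \<circ> r) ((p \<circ> q) x) = x" if "x \<in> D" for x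
      proof -
        have "p x \<in> D" using that p by (simp add: permutes_in_image)
        then show ?thesis using in_D[OF q(1) that, of p] in_D[OF r(1), of "p x" "inv_into UNIV p"] p(1)
          by (simp add: permutes_inverses del: o_apply)
      qed
      moreover have "(p \<circ> q) ((p \<circ> q) x) = x \<and> (inv_into UNIV p \<circ> r) ((inv_into UNIV p \<circ> r) x) = x" if x: "x \<in> S - D" for x
      proof -
        have "q x \<in> S - D" "r x \<in> S - D" using x permutes_in_image[OF q(1)] permutes_in_image[OF r(1)] by auto
        then show ?thesis
          using out_D[OF p(1) q(1)] out_D[OF p(2) r(1)] x q(2) r(2) by (simp del: o_apply)
      qed
      ultimately have "D \<in> splittings S (p \<circ> q) (inv_into UNIV p \<circ> r)"
        unfolding splittings_def using D img by blast
      then show "?f u \<in> ?Y" using perm by (simp add: u')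
    next
      fix w assume w: "w \<in> ?Y"
      obtain \<sigma> \<tau> where w': "w = (\<sigma>, \<tau>)" by (cases w)
      have perm: "\<sigma> permutes S" "\<tau> permutes S" and s\<sigma>: "\<sigma> ` D = D"
        and ts: "\<And>x. x \<in> D \<Longrightarrow> \<tau> (\<sigma> x) = x"
        and off: "\<And>x. x \<in> S - D \<Longrightarrow> \<sigma> (\<sigma> x) = x \<and> \<tau> (\<tau> x) = x"
        using w by (auto simp: w' splittings_def)
      have s\<tau>: "\<tau> ` D = D"
      proof -
        have "\<tau> ` D = (\<lambda>x. \<tau> (\<sigma> x)) ` D" by (subst s\<sigma>[symmetric]) (simp add: image_image)
        also have "\<dots> = D" using ts by force
        finally show ?thesis .
      qed
      obtain p q where pq: "p permutes D" "q permutes S - D" "\<sigma> = p \<circ> q" using surj[OF perm(1) s\<sigma>] by blast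
      obtain p' r where pr: "p' permutes D" "r permutes S - D" "\<tau> = p' \<circ> r" using surj[OF perm(2) s\<tau>] by blast
      have "p' (p x) = x" for x
      proof (cases "x \<in> D")
        case True
        have "p x \<in> D" using True pq by (simp add: permutes_in_image)
        then show ?thesis using ts[OF True] in_D[OF pq(2) True, of p] in_D[OF pr(2), of "p x" p']
          by (simp add: pq(3) pr(3) del: o_apply)
      qed (use pq(1) pr(1) in \<open>simp add: permutes_not_in\<close>)
      then have "p' y = inv_into UNIV p y" for y using permutes_inverses[OF pq(1)] by metis
      then have p': "p' = inv_into UNIV p" by blast
      have "q (q x) = x" for x
      proof (cases "x \<in> S - D")
        case True
        then have "q x \<in> S - D" using permutes_in_image[OF pq(2)] by blast
        then show ?thesis using off[OF True] out_D[OF pq(1,2)] True by (simp add: pq(3) del: o_apply)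
      qed (use pq(2) in \<open>simp add: permutes_not_in\<close>)
      moreover have "r (r x) = x" for x
      proof (cases "x \<in> S - D")
        case True
        then have "r x \<in> S - D" using permutes_in_image[OF pr(2)] by blast
        then show ?thesis using off[OF True] out_D[OF pr(1,2)] True by (simp add: pr(3) del: o_apply)
      qed (use pr(2) in \<open>simp add: permutes_not_in\<close>)
      ultimately have "(p, q, r) \<in> ?X" using pq pr by (simp add: involutions_def)
      moreover have "w = ?f (p, q, r)" by (simp add: w' pq pr p')
      ultimately show "w \<in> ?f ` ?X" by blast
    qed
  qed
qed

text \<open>Exchange the sum over the pairs with the sum over \<open>D\<close>. The signs of \<open>p\<close> and of its inverse cancel, and
so do the factors \<open>(-1)^n\<close> of the two involution sums.\<close>

lemma sum_pair_weight_split: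
  assumes fin: "finite S"
  shows "(\<Sum>\<sigma> | \<sigma> permutes S. \<Sum>\<tau> | \<tau> permutes S.
      of_int (sign \<sigma>) * of_int (sign \<tau>) * pair_weight c \<mu> \<nu> S \<sigma> \<tau>) =
    (\<Sum>D\<in>Pow S. (\<Sum>p | p permutes D. c ^ card (swaps p D)) *
       (hermite (card S - card D) \<mu> * hermite (card S - card D) \<nu>))"
proof -
  let ?P = "{\<sigma>. \<sigma> permutes S}"
  define g where "g = (\<lambda>(\<sigma>, \<tau>) D. of_int (sign \<sigma>) * of_int (sign \<tau>) * (c ^ card (swaps \<sigma> D) *
    (\<Prod>i\<in>S - D. (if \<sigma> i = i then - \<mu> else 1) * (if \<tau> i = i then - \<nu> else 1))))"
  define H where "H T \<mu> = (\<Sum>p\<in>involutions T. of_int (sign p) * (\<Prod>x\<in>T. if p x = x then - \<mu> else 1))"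
    for T :: "nat set" and \<mu> :: real
  have finP: "finite ?P" using fin by (rule finite_permutations)
  have "(\<Sum>\<sigma> | \<sigma> permutes S. \<Sum>\<tau> | \<tau> permutes S. of_int (sign \<sigma>) * of_int (sign \<tau>) * pair_weight c \<mu> \<nu> S \<sigma> \<tau>)
      = (\<Sum>w\<in>?P \<times> ?P. \<Sum>D | D \<in> Pow S \<and> D \<in> splittings S (fst w) (snd w). g w D)"
    unfolding sum.cartesian_product
  proof (rule sum.cong[OF refl], clarify)
    fix \<sigma> \<tau> assume p: "\<sigma> permutes S" "\<tau> permutes S"
    have "{D \<in> Pow S. D \<in> splittings S \<sigma> \<tau>} = splittings S \<sigma> \<tau>" by (auto simp: splittings_def)
    then show "real_of_int (sign \<sigma>) * real_of_int (sign \<tau>) * pair_weight c \<mu> \<nu> S \<sigma> \<tau> =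
       (\<Sum>D | D \<in> Pow S \<and> D \<in> splittings S (fst (\<sigma>, \<tau>)) (snd (\<sigma>, \<tau>)). g (\<sigma>, \<tau>) D)"
      unfolding pair_weight_splittings[OF fin p] by (simp add: g_def sum_distrib_left)
  qed
  also have "\<dots> = (\<Sum>D\<in>Pow S. \<Sum>w | w \<in> ?P \<times> ?P \<and> D \<in> splittings S (fst w) (snd w). g w D)"
    by (rule sum.swap_restrict) (use fin finP in auto)
  also have "\<dots> = (\<Sum>D\<in>Pow S. (\<Sum>p | p permutes D. c ^ card (swaps p D)) *
       (hermite (card S - card D) \<mu> * hermite (card S - card D) \<nu>))"
  proof (rule sum.cong[OF refl])
    fix D assume "D \<in> Pow S"
    then have D: "D \<subseteq> S" and finD: "finite D" using fin finite_subset by auto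
    have Y: "{w. w \<in> ?P \<times> ?P \<and> D \<in> splittings S (fst w) (snd w)} =
       {(\<sigma>, \<tau>). \<sigma> permutes S \<and> \<tau> permutes S \<and> D \<in> splittings S \<sigma> \<tau>}" by auto
    let ?I = "involutions (S - D)"
    have "(\<Sum>w | w \<in> ?P \<times> ?P \<and> D \<in> splittings S (fst w) (snd w). g w D) =
      (\<Sum>u\<in>{p. p permutes D} \<times> ?I \<times> ?I. g ((\<lambda>(p, q, r). (p \<circ> q, inv_into UNIV p \<circ> r)) u) D)"
      unfolding Y by (rule sum.reindex_bij_betw[OF bij_betw_splitting_pairs[OF D], symmetric])
    also have "\<dots> = (\<Sum>(p, q, r)\<in>{p. p permutes D} \<times> ?I \<times> ?I. c ^ card (swaps p D) *
        ((of_int (sign q) * (\<Prod>i\<in>S - D. if q i = i then - \<mu> else 1)) *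
         (of_int (sign r) * (\<Prod>i\<in>S - D. if r i = i then - \<nu> else 1))))"
    proof (rule sum.cong[OF refl])
      fix u assume u: "u \<in> {p. p permutes D} \<times> ?I \<times> ?I"
      obtain p q r where u': "u = (p, q, r)" by (cases u)
      have p: "p permutes D" and q: "q \<in> ?I" and r: "r \<in> ?I" using u u' by auto
      have q': "q permutes S - D" and r': "r permutes S - D" using q r by (auto simp: involutions_def)
      have ip: "inv_into UNIV p permutes D" using p by (rule permutes_inv)
      have perms: "permutation p" "permutation (inv_into UNIV p)" "permutation q" "permutation r"
        using p ip q' r' finD fin by (auto intro: permutes_imp_permutation)
      have sg: "real_of_int (sign (p \<circ> q)) * real_of_int (sign (inv_into UNIV p \<circ> r)) = of_int (sign q) * of_int (sign r)"
      proof -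
        have "sign (p \<circ> q) * sign (inv_into UNIV p \<circ> r) = (sign p * sign p) * (sign q * sign r)"
          using perms by (simp add: sign_compose sign_inverse mult_ac del: sign_idempotent)
        then show ?thesis unfolding of_int_mult[symmetric] by simp
      qed
      have val: "(p \<circ> q) x = p x" if "x \<in> D" for x
        using that permutes_not_in[OF q', of x] by auto
      have sw: "swaps (p \<circ> q) D = swaps p D"
        unfolding swaps_def pairs_below_def using val by (auto simp del: o_apply)
      have off: "(p \<circ> q) x = q x" "(inv_into UNIV p \<circ> r) x = r x" if "x \<in> S - D" for x
        using that permutes_in_image[OF q', of x] permutes_in_image[OF r', of x]
          permutes_not_in[OF p, of "q x"] permutes_not_in[OF ip, of "r x"] by auto
      have "(\<Prod>i\<in>S - D. (if (p \<circ> q) i = i then - \<mu> else 1) * (if (inv_into UNIV p \<circ> r) i = i then - \<nu> else 1)) =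
         (\<Prod>i\<in>S - D. (if q i = i then - \<mu> else 1)) * (\<Prod>i\<in>S - D. if r i = i then - \<nu> else 1)"
        unfolding prod.distrib[symmetric] using off by (intro prod.cong refl) (simp del: o_apply)
      then show "g ((\<lambda>(p, q, r). (p \<circ> q, inv_into UNIV p \<circ> r)) u) D = (case u of (p, q, r) \<Rightarrow> c ^ card (swaps p D) *
        ((of_int (sign q) * (\<Prod>i\<in>S - D. if q i = i then - \<mu> else 1)) *
         (of_int (sign r) * (\<Prod>i\<in>S - D. if r i = i then - \<nu> else 1))))"
        unfolding u' prod.case g_def sg sw by (simp add: mult_ac del: o_apply)
    qed
    also have "\<dots> = (\<Sum>p | p permutes D. c ^ card (swaps p D)) * (H (S - D) \<mu> * H (S - D) \<nu>)"
      unfolding H_def sum_product sum.cartesian_product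
      by (intro sum.cong) auto
    also have "H (S - D) \<mu> * H (S - D) \<nu> = hermite (card S - card D) \<mu> * hermite (card S - card D) \<nu>"
      unfolding H_def using fin finD D
      by (simp add: hermite_involutions card_Diff_subset power_mult_distrib[symmetric] mult_ac flip: mult.assoc)
    finally show "(\<Sum>w | w \<in> ?P \<times> ?P \<and> D \<in> splittings S (fst w) (snd w). g w D) =
      (\<Sum>p | p permutes D. c ^ card (swaps p D)) *
       (hermite (card S - card D) \<mu> * hermite (card S - card D) \<nu>)" .
  qed
  finally show ?thesis .
qed

lemma sum_Pow_card:
  assumes "finite S"
  shows "(\<Sum>D\<in>Pow S. f (card D)) = (\<Sum>d\<le>card S. of_nat (card S choose d) * (f d :: real))"
proof -
  have "(\<Sum>D\<in>Pow S. f (card D)) = (\<Sum>d\<le>card S. \<Sum>D | D \<in> Pow S \<and> card D = d. f (card D))"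
    by (rule sum.group[symmetric]) (use assms in \<open>auto intro: card_mono\<close>)
  also have "\<dots> = (\<Sum>d\<le>card S. of_nat (card S choose d) * f d)"
    using n_subsets[OF assms] by (intro sum.cong refl) simp
  finally show ?thesis .
qed

text \<open>Only even \<open>e = 2 j\<close> contribute, and
\<open>(n choose 2 j) * (2 j)! / (2^j j!) * (n - 2 j)! = n! / (2^j j!)\<close>.\<close>

lemma sum_cycle2_weight_eq:
  fixes c :: real
  assumes fin: "finite S"
  shows "(\<Sum>p | p permutes S. c ^ card (swaps p S)) =
    fact (card S) * (\<Sum>j | 2 * j \<le> card S. ((c - 1) / 2) ^ j / fact j)"
proof -
  let ?n = "card S"
  have "(\<Sum>p | p permutes S. c ^ card (swaps p S)) =
    (\<Sum>E\<in>Pow S. (if even (card E) then fact (card E) / (2 ^ (card E div 2) * fact (card E div 2)) else 0) *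
       (c - 1) ^ (card E div 2) * fact (?n - card E))"
    unfolding sum_cycle2_weight[OF fin]
  proof (rule sum.cong[OF refl])
    fix E assume "E \<in> Pow S"
    then have "finite E" using fin finite_subset by auto
    then show "real (card (matchings E)) * (c - 1) ^ (card E div 2) * fact (?n - card E) =
      (if even (card E) then fact (card E) / (2 ^ (card E div 2) * fact (card E div 2)) else 0) *
       (c - 1) ^ (card E div 2) * fact (?n - card E)" by (simp add: card_matchings)
  qed
  also have "\<dots> = (\<Sum>e\<le>?n. of_nat (?n choose e) *
      ((if even e then fact e / (2 ^ (e div 2) * fact (e div 2)) else 0) *
       (c - 1) ^ (e div 2) * fact (?n - e)))"
    by (rule sum_Pow_card[OF fin])
  also have "\<dots> = (\<Sum>e\<in>(\<lambda>j. 2 * j) ` {j. 2 * j \<le> ?n}. fact ?n * (((c - 1) / 2) ^ (e div 2) / fact (e div 2)))"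
  proof (rule sum.mono_neutral_cong_right)
    show "\<forall>e\<in>{..?n} - (\<lambda>j. 2 * j) ` {j. 2 * j \<le> ?n}. of_nat (?n choose e) *
      ((if even e then fact e / (2 ^ (e div 2) * fact (e div 2)) else 0) *
       (c - 1) ^ (e div 2) * fact (?n - e)) = 0" by (auto elim!: evenE)
    fix e assume "e \<in> (\<lambda>j. 2 * j) ` {j. 2 * j \<le> ?n}"
    then have e: "even e" "e \<le> ?n" by auto
    then show "of_nat (?n choose e) *
      ((if even e then fact e / (2 ^ (e div 2) * fact (e div 2)) else 0) *
       (c - 1) ^ (e div 2) * fact (?n - e)) = fact ?n * (((c - 1) / 2) ^ (e div 2) / fact (e div 2))"
      by (simp add: binomial_fact field_simps power_divide)
  qed auto
  also have "\<dots> = fact ?n * (\<Sum>j | 2 * j \<le> ?n. ((c - 1) / 2) ^ j / fact j)"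
    by (subst sum.reindex) (auto simp: inj_on_def sum_distrib_left)
  finally show ?thesis .
qed

definition hermite_kernel :: "nat \<Rightarrow> real \<Rightarrow> real \<Rightarrow> real" where
  "hermite_kernel n x y = (\<Sum>k\<le>n. hermite k x * hermite k y / fact k)"

text \<open>Grouped by cardinalities, the sum over \<open>D\<close> is a binomial convolution, that is, the product of the
exponential generating functions \<open>exp (\<beta> x\<^sup>2) / (1 - x)\<close> of the permutations and
\<open>\<Sum>k. He_k(\<mu>) He_k(\<nu>) x^k / k!\<close> of the pairs of involutions, where \<open>\<beta> = (c - 1) / 2\<close>. The
factor \<open>1 / (1 - x)\<close> is what turns the Hermite products into partial sums.\<close>

theorem sum_pair_weight:
  assumes fin: "finite S"
  shows "(\<Sum>\<sigma> | \<sigma> permutes S. \<Sum>\<tau> | \<tau> permutes S.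
      of_int (sign \<sigma>) * of_int (sign \<tau>) * pair_weight c \<mu> \<nu> S \<sigma> \<tau>) =
    fact (card S) * (\<Sum>j | 2 * j \<le> card S. ((c - 1) / 2) ^ j / fact j * hermite_kernel (card S - 2 * j) \<mu> \<nu>)"
proof -
  let ?n = "card S"
  define \<beta> where "\<beta> = (c - 1) / 2"
  define h where "h k = hermite k \<mu> * hermite k \<nu>" for k
  have "(\<Sum>\<sigma> | \<sigma> permutes S. \<Sum>\<tau> | \<tau> permutes S.
      of_int (sign \<sigma>) * of_int (sign \<tau>) * pair_weight c \<mu> \<nu> S \<sigma> \<tau>) =
    (\<Sum>D\<in>Pow S. fact (card D) * (\<Sum>j | 2 * j \<le> card D. \<beta> ^ j / fact j) * h (?n - card D))"
    unfolding sum_pair_weight_split[OF fin] h_def \<beta>_def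
    using fin by (intro sum.cong refl) (auto simp: sum_cycle2_weight_eq finite_subset)
  also have "\<dots> = (\<Sum>d\<le>?n. of_nat (?n choose d) *
      (fact d * (\<Sum>j | 2 * j \<le> d. \<beta> ^ j / fact j) * h (?n - d)))"
    by (rule sum_Pow_card[OF fin])
  also have "\<dots> = (\<Sum>k\<le>?n. of_nat (?n choose (?n - k)) *
      (fact (?n - k) * (\<Sum>j | 2 * j \<le> ?n - k. \<beta> ^ j / fact j) * h (?n - (?n - k))))"
    by (rule sum.reindex_bij_witness[of _ "\<lambda>k. ?n - k" "\<lambda>k. ?n - k"]) auto
  also have "\<dots> = (\<Sum>k\<le>?n. fact ?n * (\<Sum>j | j \<in> {..?n} \<and> 2 * j + k \<le> ?n. \<beta> ^ j / fact j * (h k / fact k)))"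
  proof (rule sum.cong[OF refl])
    fix k assume "k \<in> {..?n}"
    then have k: "k \<le> ?n" by simp
    have set: "{j. 2 * j \<le> ?n - k} = {j. j \<in> {..?n} \<and> 2 * j + k \<le> ?n}" using k by auto
    have "real (?n choose (?n - k)) * fact (?n - k) = fact ?n / fact k"
      using k by (simp add: binomial_fact)
    then have "of_nat (?n choose (?n - k)) *
      (fact (?n - k) * (\<Sum>j | 2 * j \<le> ?n - k. \<beta> ^ j / fact j) * h (?n - (?n - k))) =
      fact ?n / fact k * (\<Sum>j | 2 * j \<le> ?n - k. \<beta> ^ j / fact j) * h k"
      using k by (simp add: mult.assoc[symmetric])
    also have "\<dots> = fact ?n * (\<Sum>j | j \<in> {..?n} \<and> 2 * j + k \<le> ?n. \<beta> ^ j / fact j * (h k / fact k))"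
      unfolding set by (simp add: sum_distrib_left sum_distrib_right mult_ac)
    finally show "of_nat (?n choose (?n - k)) *
      (fact (?n - k) * (\<Sum>j | 2 * j \<le> ?n - k. \<beta> ^ j / fact j) * h (?n - (?n - k))) = \<dots>" .
  qed
  also have "\<dots> = fact ?n * (\<Sum>k\<le>?n. \<Sum>j | j \<in> {..?n} \<and> 2 * j + k \<le> ?n. \<beta> ^ j / fact j * (h k / fact k))"
    by (rule sum_distrib_left[symmetric])
  also have "(\<Sum>k\<le>?n. \<Sum>j | j \<in> {..?n} \<and> 2 * j + k \<le> ?n. \<beta> ^ j / fact j * (h k / fact k)) =
     (\<Sum>j\<le>?n. \<Sum>k | k \<in> {..?n} \<and> 2 * j + k \<le> ?n. \<beta> ^ j / fact j * (h k / fact k))"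
    by (rule sum.swap_restrict) auto
  also have "\<dots> = (\<Sum>j | 2 * j \<le> ?n. \<beta> ^ j / fact j * hermite_kernel (?n - 2 * j) \<mu> \<nu>)"
  proof (rule sum.mono_neutral_cong_right)
    fix j assume "j \<in> {j. 2 * j \<le> ?n}"
    then have "{k. k \<in> {..?n} \<and> 2 * j + k \<le> ?n} = {..?n - 2 * j}" by auto
    then show "(\<Sum>k | k \<in> {..?n} \<and> 2 * j + k \<le> ?n. \<beta> ^ j / fact j * (h k / fact k)) =
      \<beta> ^ j / fact j * hermite_kernel (?n - 2 * j) \<mu> \<nu>"
      by (simp add: hermite_kernel_def h_def sum_distrib_left)
  qed auto
  finally show ?thesis unfolding \<beta>_def .
qed

text \<open>An unbalanced pair \<open>{i, j}\<close> is itself used in one direction only, unless it is used twice in one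
direction and once in the other. If \<open>\<sigma>\<close> and \<open>\<tau>\<close> both run from \<open>i\<close> to \<open>j\<close> but only one of them runs back, the other one
leaves \<open>j\<close> towards a third point \<open>k\<close>. Nothing can lead from \<open>k\<close> to \<open>j\<close>, since \<open>j\<close> already
has both its preimages at \<open>i\<close>. Hence the pair \<open>{j, k}\<close> is used in one direction only.\<close>

lemma unbalanced_imp_unmatched:
  assumes p: "\<sigma> permutes S" "\<tau> permutes S" and unbal: "\<not> balanced S \<sigma> \<tau>"
  shows "\<exists>i\<in>S. \<exists>j\<in>S. i \<noteq> j \<and> (\<sigma> i = j \<or> \<tau> i = j) \<and> \<sigma> j \<noteq> i \<and> \<tau> j \<noteq> i"
proof (rule ccontr)
  assume "\<not> ?thesis"
  then have reverse: "\<sigma> j = i \<or> \<tau> j = i" if "i \<in> S" "j \<in> S" "i \<noteq> j" "\<sigma> i = j \<or> \<tau> i = j" for i j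
    using that by blast
  have inj: "\<sigma> a = \<sigma> b \<Longrightarrow> a = b" "\<tau> a = \<tau> b \<Longrightarrow> a = b" for a b
    using p by (meson injD permutes_inj)+
  have inS: "\<sigma> x \<in> S" "\<tau> x \<in> S" if "x \<in> S" for x using that p by (simp_all add: permutes_in_image)
  have key: "of_bool (\<sigma> i = j) + of_bool (\<tau> i = j) \<le> (of_bool (\<sigma> j = i) + of_bool (\<tau> j = i) :: nat)"
    if ij: "i \<in> S" "j \<in> S" "i \<noteq> j" for i j
  proof (cases "\<sigma> i = j \<and> \<tau> i = j")
    case False
    then show ?thesis using reverse[OF ij] by auto
  next
    case True
    have "\<sigma> j = i"
    proof (rule ccontr)
      assume "\<sigma> j \<noteq> i"
      moreover have "\<sigma> j \<noteq> j" using True inj(1)[of j i] ij(3) by auto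
      ultimately have "\<sigma> (\<sigma> j) = j \<or> \<tau> (\<sigma> j) = j" using reverse[of j "\<sigma> j"] inS ij by auto
      then show False using True inj(1)[of "\<sigma> j" i] inj(2)[of "\<sigma> j" i] \<open>\<sigma> j \<noteq> i\<close> by auto
    qed
    moreover have "\<tau> j = i"
    proof (rule ccontr)
      assume "\<tau> j \<noteq> i"
      moreover have "\<tau> j \<noteq> j" using True inj(2)[of j i] ij(3) by auto
      ultimately have "\<sigma> (\<tau> j) = j \<or> \<tau> (\<tau> j) = j" using reverse[of j "\<tau> j"] inS ij by auto
      then show False using True inj(1)[of "\<tau> j" i] inj(2)[of "\<tau> j" i] \<open>\<tau> j \<noteq> i\<close> by auto
    qed
    ultimately show ?thesis by simp
  qed
  have "balanced S \<sigma> \<tau>" unfolding balanced_def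
    by (intro ballI impI order_antisym key) auto
  then show False using unbal by simp
qed

lemma prod_upper_triangle:
  fixes g :: "nat \<Rightarrow> nat \<Rightarrow> 'b :: comm_monoid_mult"
  assumes fin: "finite S"
  shows "(\<Prod>i\<in>S. \<Prod>j\<in>S. g i j) = (\<Prod>i\<in>S. g i i) * (\<Prod>(i, j)\<in>pairs_below S. g i j * g j i)"
proof -
  let ?P = "pairs_below S"
  have finP: "finite ?P" by (rule finite_pairs_below[OF fin])
  have split: "S \<times> S = (\<lambda>i. (i, i)) ` S \<union> (?P \<union> prod.swap ` ?P)"
    by (auto simp: pairs_below_def image_iff)
  have "(\<Prod>i\<in>S. \<Prod>j\<in>S. g i j) = (\<Prod>u\<in>S \<times> S. g (fst u) (snd u))"
    by (simp add: prod.cartesian_product case_prod_beta)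
  also have "\<dots> = (\<Prod>u\<in>(\<lambda>i. (i, i)) ` S. g (fst u) (snd u)) * (\<Prod>u\<in>?P \<union> prod.swap ` ?P. g (fst u) (snd u))"
    unfolding split by (rule prod.union_disjoint) (use fin finP in \<open>auto simp: pairs_below_def\<close>)
  also have "(\<Prod>u\<in>?P \<union> prod.swap ` ?P. g (fst u) (snd u)) =
      (\<Prod>u\<in>?P. g (fst u) (snd u)) * (\<Prod>u\<in>prod.swap ` ?P. g (fst u) (snd u))"
    by (rule prod.union_disjoint) (use finP in \<open>auto simp: pairs_below_def\<close>)
  also have "(\<Prod>u\<in>prod.swap ` ?P. g (fst u) (snd u)) = (\<Prod>u\<in>?P. g (snd u) (fst u))"
    by (subst prod.reindex) (auto simp: inj_on_def)
  also have "(\<Prod>u\<in>(\<lambda>i. (i, i)) ` S. g (fst u) (snd u)) = (\<Prod>i\<in>S. g i i)"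
    by (subst prod.reindex) (auto simp: inj_on_def)
  finally show ?thesis by (simp add: prod.distrib case_prod_beta)
qed

text \<open>This collects the entries of a permutation term into groups that depend on different random variables.\<close>

lemma prod_permutation_upper_triangle:
  fixes A :: "nat \<Rightarrow> nat \<Rightarrow> 'b :: comm_monoid_mult"
  assumes fin: "finite S" and p: "\<sigma> permutes S"
  shows "(\<Prod>i\<in>S. A i (\<sigma> i)) = (\<Prod>i\<in>S. if \<sigma> i = i then A i i else 1) *
    (\<Prod>(i, j)\<in>pairs_below S. (if \<sigma> i = j then A i j else 1) * (if \<sigma> j = i then A j i else 1))"
proof -
  have "(\<Prod>i\<in>S. A i (\<sigma> i)) = (\<Prod>i\<in>S. \<Prod>j\<in>S. if \<sigma> i = j then A i j else 1)"
  proof (rule prod.cong[OF refl])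
    fix i assume "i \<in> S"
    then have "\<sigma> i \<in> S" using p by (simp add: permutes_in_image)
    then show "A i (\<sigma> i) = (\<Prod>j\<in>S. if \<sigma> i = j then A i j else 1)"
      using fin by (simp add: prod.delta)
  qed
  then show ?thesis using prod_upper_triangle[OF fin, of "\<lambda>i j. if \<sigma> i = j then A i j else 1"] by simp
qed

section \<open>Hermite functions and the Christoffel-Darboux formula\<close>

text \<open>The derivative of \<open>hermite n\<close>; as a name of its own it keeps the case \<open>n = 0\<close>, where \<open>n - 1\<close>
is truncated, out of the calculations.\<close>

definition hermite_pred :: "nat \<Rightarrow> real \<Rightarrow> real" where
  "hermite_pred n x = real n * hermite (n - 1) x"

lemma hermite_Suc: "hermite (Suc n) x = x * hermite n x - hermite_pred n x"
  by (cases n) (simp_all add: hermite_pred_def)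

lemma has_real_derivative_hermite:
  "(hermite n has_real_derivative hermite_pred n x) (at x)"
proof (induction n x rule: hermite.induct)
  case (1 x)
  have "hermite 0 = (\<lambda>x. 1)" by auto
  then show ?case by (simp add: hermite_pred_def)
next
  case (2 x)
  have "hermite (Suc 0) = (\<lambda>x. x)" by auto
  then show ?case by (simp add: hermite_pred_def)
next
  case (3 n x)
  have eq: "hermite (Suc (Suc n)) = (\<lambda>x. x * hermite (Suc n) x - real (Suc n) * hermite n x)" by auto
  have "((\<lambda>x. x * hermite (Suc n) x - real (Suc n) * hermite n x) has_real_derivative
      1 * hermite (Suc n) x + hermite_pred (Suc n) x * x - real (Suc n) * hermite_pred n x) (at x)"
    by (rule derivative_eq_intros 3 refl)+ simp
  moreover have "1 * hermite (Suc n) x + hermite_pred (Suc n) x * x - real (Suc n) * hermite_pred n x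
      = hermite_pred (Suc (Suc n)) x"
  proof -
    have pred: "hermite_pred n x = x * hermite n x - hermite (Suc n) x" using hermite_Suc[of n x] by simp
    show ?thesis
      unfolding hermite_pred_def[of "Suc n"] hermite_pred_def[of "Suc (Suc n)"] pred
      by (simp add: algebra_simps)
  qed
  ultimately show ?case unfolding eq by simp
qed

lemma has_real_derivative_hermite_pred:
  "(hermite_pred n has_real_derivative x * hermite_pred n x - real n * hermite n x) (at x)"
proof -
  have "(hermite_pred n has_real_derivative real n * hermite_pred (n - 1) x) (at x)"
    unfolding hermite_pred_def[abs_def] by (rule DERIV_cmult has_real_derivative_hermite[unfolded hermite_pred_def])+
  moreover have "real n * hermite_pred (n - 1) x = x * hermite_pred n x - real n * hermite n x"
  proof (cases n)
    case (Suc m)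
    have pred: "hermite_pred m x = x * hermite m x - hermite (Suc m) x" using hermite_Suc[of m x] by simp
    show ?thesis unfolding Suc diff_Suc_1 hermite_pred_def[of "Suc m"] pred by (simp add: algebra_simps)
  qed (simp add: hermite_pred_def)
  ultimately show ?thesis by simp
qed

lemma christoffel_darboux:
  "(x - y) * hermite_kernel n x y = (hermite (Suc n) x * hermite n y - hermite n x * hermite (Suc n) y) / fact n"
proof (induction n)
  case 0
  then show ?case by (simp add: hermite_kernel_def)
next
  case (Suc n)
  have "hermite_kernel (Suc n) x y = hermite_kernel n x y + hermite (Suc n) x * hermite (Suc n) y / fact (Suc n)"
    by (simp add: hermite_kernel_def)
  then have "(x - y) * hermite_kernel (Suc n) x y =
     (hermite (Suc n) x * hermite n y - hermite n x * hermite (Suc n) y) / fact n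
     + (x - y) * (hermite (Suc n) x * hermite (Suc n) y / fact (Suc n))"
    by (simp only: distrib_left Suc)
  also have "\<dots> = (hermite (Suc (Suc n)) x * hermite (Suc n) y - hermite (Suc n) x * hermite (Suc (Suc n)) y) / fact (Suc n)"
    by (simp add: divide_simps) (simp add: algebra_simps)
  finally show ?case .
qed

text \<open>The limit \<open>y \<longrightarrow> x\<close> of the previous formula, by a separate induction.\<close>

lemma christoffel_darboux_diag:
  "hermite_kernel n x x = (real (Suc n) * (hermite n x)\<^sup>2 - hermite_pred n x * hermite (Suc n) x) / fact n"
proof (induction n)
  case 0
  then show ?case by (simp add: hermite_kernel_def hermite_pred_def)
next
  case (Suc n)
  have "hermite_kernel (Suc n) x x = hermite_kernel n x x + hermite (Suc n) x * hermite (Suc n) x / fact (Suc n)"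
    by (simp add: hermite_kernel_def)
  also have "\<dots> = (real (Suc n) * (hermite n x)\<^sup>2 - (x * hermite n x - hermite (Suc n) x) * hermite (Suc n) x) / fact n
       + hermite (Suc n) x * hermite (Suc n) x / fact (Suc n)"
    using hermite_Suc[of n x] by (simp add: Suc)
  also have "\<dots> = (real (Suc (Suc n)) * (hermite (Suc n) x)\<^sup>2 - hermite_pred (Suc n) x * hermite (Suc (Suc n)) x) / fact (Suc n)"
    by (simp add: divide_simps hermite_pred_def) (simp add: algebra_simps power2_eq_square)
  finally show ?case .
qed

text \<open>Without the customary factor \<open>(2 \<pi>)^(-1/4)\<close>, so that the kernel below is the inner sum of
\<open>wigner_corr_eq\<close> times a Gaussian factor.\<close>

definition hermite_fun :: "nat \<Rightarrow> real \<Rightarrow> real" where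
  "hermite_fun n x = hermite n x * exp (- x\<^sup>2 / 4) / sqrt (fact n)"

definition hermite_fun_deriv :: "nat \<Rightarrow> real \<Rightarrow> real" where
  "hermite_fun_deriv n x = (hermite_pred n x - x / 2 * hermite n x) * exp (- x\<^sup>2 / 4) / sqrt (fact n)"

text \<open>The squared local frequency of \<open>hermite_fun n\<close> at \<open>x\<close>.\<close>

definition potential :: "nat \<Rightarrow> real \<Rightarrow> real" where
  "potential n x = real n + 1 / 2 - x\<^sup>2 / 4"

definition gauss_kernel :: "nat \<Rightarrow> real \<Rightarrow> real \<Rightarrow> real" where
  "gauss_kernel n x y = hermite_kernel n x y * exp (- (x\<^sup>2 + y\<^sup>2) / 4)"

lemma has_real_derivative_hermite_fun:
  "(hermite_fun n has_real_derivative hermite_fun_deriv n x) (at x)"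
  unfolding hermite_fun_def[abs_def] hermite_fun_deriv_def
  by (rule derivative_eq_intros has_real_derivative_hermite refl DERIV_cdivide[THEN DERIV_cong])+
    (simp_all add: algebra_simps)

lemma has_real_derivative_hermite_fun_deriv:
  "(hermite_fun_deriv n has_real_derivative - potential n x * hermite_fun n x) (at x)"
  unfolding hermite_fun_def hermite_fun_deriv_def[abs_def]
  by (rule DERIV_cdivide[THEN DERIV_cong] derivative_eq_intros has_real_derivative_hermite
       has_real_derivative_hermite_pred refl | simp)+
     (simp add: potential_def divide_simps, simp add: algebra_simps power2_eq_square)

text \<open>Christoffel-Darboux with \<open>He_n\<^sub>+\<^sub>1\<close> eliminated in favour of the derivative of \<open>hermite_fun n\<close>, so
that one solution of one differential equation carries all the information.\<close>

lemma gauss_kernel_eq: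
  "(x - y) * gauss_kernel n x y = (x - y) / 2 * (hermite_fun n x * hermite_fun n y) +
     (hermite_fun n x * hermite_fun_deriv n y - hermite_fun_deriv n x * hermite_fun n y)"
proof -
  have e: "exp (- (x\<^sup>2 + y\<^sup>2) / 4) = exp (- x\<^sup>2 / 4) * exp (- y\<^sup>2 / 4)"
    by (simp add: exp_add[symmetric] field_simps)
  have "(x - y) * gauss_kernel n x y = (x - y) * hermite_kernel n x y * (exp (- x\<^sup>2 / 4) * exp (- y\<^sup>2 / 4))"
    by (simp only: gauss_kernel_def e mult.assoc)
  also have "\<dots> = ((x * hermite n x - hermite_pred n x) * hermite n y - hermite n x * (y * hermite n y - hermite_pred n y))
      / (sqrt (fact n) * sqrt (fact n)) * (exp (- x\<^sup>2 / 4) * exp (- y\<^sup>2 / 4))"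
    unfolding christoffel_darboux hermite_Suc by simp
  also have "\<dots> = (x - y) / 2 * (hermite_fun n x * hermite_fun n y) +
     (hermite_fun n x * hermite_fun_deriv n y - hermite_fun_deriv n x * hermite_fun n y)"
    unfolding hermite_fun_def hermite_fun_deriv_def
    by (simp add: divide_simps del: real_sqrt_mult_self) (simp add: algebra_simps del: real_sqrt_mult_self)
  finally show ?thesis .
qed

lemma gauss_kernel_diag:
  "gauss_kernel n x x = (hermite_fun n x)\<^sup>2 / 2 + ((hermite_fun_deriv n x)\<^sup>2 + potential n x * (hermite_fun n x)\<^sup>2)"
proof -
  have e: "exp (- (x\<^sup>2 + x\<^sup>2) / 4) = (exp (- x\<^sup>2 / 4))\<^sup>2"
    by (simp add: exp_add[symmetric] field_simps power2_eq_square)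
  show ?thesis
    unfolding gauss_kernel_def christoffel_darboux_diag hermite_Suc e hermite_fun_def hermite_fun_deriv_def
      potential_def power_mult_distrib power_divide real_sqrt_pow2_iff[THEN iffD2, OF fact_ge_zero]
    by (simp add: divide_simps) (simp add: algebra_simps power2_eq_square)
qed

lemma gauss_kernel_sum: "gauss_kernel n x y = (\<Sum>k\<le>n. hermite_fun k x * hermite_fun k y)"
proof -
  have e: "exp (- (x\<^sup>2 + y\<^sup>2) / 4) = exp (- x\<^sup>2 / 4) * exp (- y\<^sup>2 / 4)"
    by (simp add: exp_add[symmetric] field_simps)
  show ?thesis unfolding gauss_kernel_def hermite_kernel_def sum_distrib_right e
    by (rule sum.cong[OF refl]) (simp add: hermite_fun_def mult_ac)
qed

lemma gauss_kernel_diag_pos: "gauss_kernel n x x > 0"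
proof -
  have "0 < hermite_fun 0 x * hermite_fun 0 x" by (simp add: hermite_fun_def)
  also have "\<dots> \<le> (\<Sum>k\<le>n. hermite_fun k x * hermite_fun k x)"
    by (rule member_le_sum[of 0 _ "\<lambda>k. hermite_fun k x * hermite_fun k x"]) auto
  finally show ?thesis by (simp add: gauss_kernel_sum)
qed

section \<open>The adiabatic invariant\<close>

text \<open>The action of the oscillator: its energy \<open>h'\<^sup>2 + p h\<^sup>2\<close> divided by the frequency \<open>sqrt p\<close>.\<close>

definition action :: "nat \<Rightarrow> real \<Rightarrow> real" where
  "action n x = (hermite_fun_deriv n x)\<^sup>2 / sqrt (potential n x) + sqrt (potential n x) * (hermite_fun n x)\<^sup>2"

lemma gauss_kernel_action:
  assumes "potential n x > 0"
  shows "gauss_kernel n x x = (hermite_fun n x)\<^sup>2 / 2 + sqrt (potential n x) * action n x"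
  using assms unfolding gauss_kernel_diag action_def
  by (simp add: distrib_left mult.assoc[symmetric])

text \<open>If the action vanished, \<open>h\<close> and \<open>h'\<close> would both vanish and the kernel would be zero on the diagonal; but
its first summand is positive.\<close>

lemma action_pos:
  assumes "potential n x > 0"
  shows "action n x > 0"
proof -
  have "action n x \<noteq> 0"
  proof
    assume 0: "action n x = 0"
    moreover have "0 \<le> (hermite_fun_deriv n x)\<^sup>2 / sqrt (potential n x)"
      "0 \<le> sqrt (potential n x) * (hermite_fun n x)\<^sup>2" using assms by auto
    ultimately have "sqrt (potential n x) * (hermite_fun n x)\<^sup>2 = 0"
      unfolding action_def by linarith
    then have "gauss_kernel n x x = 0" using 0 assms gauss_kernel_action[OF assms] by simp
    then show False using gauss_kernel_diag_pos[of n x] by simp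
  qed
  moreover have "action n x \<ge> 0" unfolding action_def using assms by simp
  ultimately show ?thesis by simp
qed

lemma abs_hermite_fun_mult_deriv_le:
  assumes "potential n x > 0"
  shows "\<bar>hermite_fun n x * hermite_fun_deriv n x\<bar> \<le> action n x / 2"
proof -
  define s where "s = sqrt (sqrt (potential n x))"
  have s: "s > 0" "sqrt (potential n x) = s\<^sup>2" using assms by (simp_all add: s_def)
  have *: "2 * \<bar>a * b\<bar> \<le> a\<^sup>2 + b\<^sup>2" for a b :: real
    using sum_squares_bound[of "\<bar>a\<bar>" "\<bar>b\<bar>"] by (simp add: abs_mult mult.assoc)
  have "2 * \<bar>(s * hermite_fun n x) * (hermite_fun_deriv n x / s)\<bar> \<le> (s * hermite_fun n x)\<^sup>2 + (hermite_fun_deriv n x / s)\<^sup>2"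
    using *[of "s * hermite_fun n x" "hermite_fun_deriv n x / s"] .
  then show ?thesis unfolding action_def s(2) using s(1) by (simp add: power_divide power_mult_distrib)
qed

lemma hermite_fun_sq_le:
  assumes "potential n x > 0"
  shows "(hermite_fun n x)\<^sup>2 \<le> action n x / sqrt (potential n x)"
    and "(hermite_fun_deriv n x)\<^sup>2 \<le> action n x * sqrt (potential n x)"
proof -
  define r where "r = sqrt (potential n x)"
  have "r > 0" using assms by (simp add: r_def)
  then show "(hermite_fun n x)\<^sup>2 \<le> action n x / sqrt (potential n x)"
    "(hermite_fun_deriv n x)\<^sup>2 \<le> action n x * sqrt (potential n x)"
    unfolding action_def r_def[symmetric] by (simp_all add: field_simps)
qed

text \<open>The derivative of the action \<open>I\<close> is \<open>- g (h h')'\<close> with \<open>g = (sqrt p)' / p\<close>, an oscillating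
quantity. Adding \<open>g h h'\<close> integrates it by parts: the derivative of \<open>I + g h h'\<close> is \<open>g' h h'\<close>, and
\<open>g'\<close> is of order \<open>n^(-3/2)\<close> whereas \<open>g\<close> is of order \<open>1/n\<close>.\<close>

definition adiabatic :: "nat \<Rightarrow> real \<Rightarrow> real" where
  "adiabatic n x = action n x - x / (4 * sqrt (potential n x) ^ 3) * (hermite_fun n x * hermite_fun_deriv n x)"

lemma has_real_derivative_adiabatic:
  assumes p: "potential n x > 0"
  shows "(adiabatic n has_real_derivative
    - (1 / (4 * sqrt (potential n x) ^ 3) + 3 * x\<^sup>2 / (16 * sqrt (potential n x) ^ 5)) *
      (hermite_fun n x * hermite_fun_deriv n x)) (at x)"
proof -
  define r where "r = sqrt (potential n x)"
  have r: "r > 0" "potential n x = r\<^sup>2" using p by (simp_all add: r_def)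
  have dr: "((\<lambda>x. sqrt (potential n x)) has_real_derivative - x / (4 * r)) (at x)"
    unfolding potential_def r_def using p
    by (auto intro!: derivative_eq_intros simp: potential_def field_simps)
  note D = dr has_real_derivative_hermite_fun has_real_derivative_hermite_fun_deriv
  show ?thesis
    unfolding adiabatic_def[abs_def] action_def r_def[symmetric]
    apply (rule DERIV_cong)
     apply (rule DERIV_add DERIV_diff DERIV_divide DERIV_mult DERIV_power DERIV_ident DERIV_cmult
        DERIV_const D | (use r in \<open>simp add: r_def[symmetric]; fail\<close>))+
    unfolding r_def[symmetric] unfolding r(2)
    using r(1) by (simp add: divide_simps) (simp add: algebra_simps power2_eq_square power3_eq_cube power_numeral_reduce)
qed

lemma potential_ge:
  assumes a: "\<bar>x\<bar> \<le> a * sqrt (real n)"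
  shows "(1 - a\<^sup>2 / 4) * real n \<le> potential n x"
proof -
  have "x\<^sup>2 \<le> (a * sqrt (real n))\<^sup>2" using a by (rule abs_le_square_iff[THEN iffD1, OF order_trans]) simp
  then show ?thesis by (simp add: potential_def power_mult_distrib algebra_simps)
qed

lemma sqrt_potential_ge:
  assumes a: "\<bar>x\<bar> \<le> a * sqrt (real n)" "a < 2" "0 < a" "n \<ge> 1" and s: "s = sqrt (1 - a\<^sup>2 / 4)"
  shows "0 < s" "s * sqrt (real n) \<le> sqrt (potential n x)" "0 < potential n x"
    "sqrt (potential n x) \<le> 2 * sqrt (real n)"
proof -
  have "a\<^sup>2 < 2\<^sup>2" using a by (intro power_strict_mono) auto
  then have k: "0 < 1 - a\<^sup>2 / 4" by simp
  then show "0 < s" by (simp add: s)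
  show "s * sqrt (real n) \<le> sqrt (potential n x)"
    unfolding s real_sqrt_mult[symmetric] using potential_ge[OF a(1)] by simp
  show "0 < potential n x" using potential_ge[OF a(1)] k a(4)
    by (smt (verit) mult_pos_pos of_nat_0_less_iff One_nat_def Suc_le_lessD)
  have "1 \<le> real n" using a(4) by simp
  then have "potential n x \<le> 4 * real n" using zero_le_power2[of x] unfolding potential_def by linarith
  then have "sqrt (potential n x) \<le> sqrt (4 * real n)" by simp
  then show "sqrt (potential n x) \<le> 2 * sqrt (real n)" by (simp add: real_sqrt_mult)
qed

lemma abs_ln_add_one_le:
  fixes d :: real
  assumes "\<bar>d\<bar> \<le> 1 / 2"
  shows "\<bar>ln (1 + d)\<bar> \<le> 2 * \<bar>d\<bar>"
proof -
  have "\<bar>ln (1 + d) - d\<bar> \<le> 2 * d\<^sup>2" by (rule abs_ln_one_plus_x_minus_x_bound[OF assms])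
  also have "2 * d\<^sup>2 \<le> \<bar>d\<bar>"
    using mult_right_mono[OF assms, of "\<bar>d\<bar>"] by (simp add: power2_eq_square abs_mult_self_eq)
  finally show ?thesis by linarith
qed

text \<open>With \<open>J = I + g h h'\<close> one has \<open>|h h'| \<le> I / 2 \<le> J\<close> for large \<open>n\<close>, so the logarithmic derivative of
\<open>J\<close> is at most \<open>|g'| = O(n^(-3/2))\<close>. Over a distance of order \<open>sqrt n\<close> this changes
\<open>ln J\<close> by \<open>O(1/n)\<close>, and \<open>ln J\<close> differs from \<open>ln I\<close> by \<open>O(1/n)\<close> as well.\<close>

lemma action_transport:
  assumes a: "0 < a" "a < 2"
  obtains C where "\<forall>\<^sub>F n in sequentially. \<forall>x. \<bar>x\<bar> \<le> a * sqrt (real n) \<longrightarrow>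
    \<bar>ln (action n x) - ln (action n 0)\<bar> \<le> C / real n"
proof -
  define s where "s = sqrt (1 - a\<^sup>2 / 4)"
  define G where "G = 1 / (4 * s ^ 3) + 3 * a\<^sup>2 / (16 * s ^ 5)"
  define C where "C = G * a + a / (4 * s ^ 3)"
  have s: "s > 0" using sqrt_potential_ge(1)[of 0 a 1, OF _ a(2,1) _ s_def] a by simp
  have est: "\<bar>ln (action n x) - ln (action n 0)\<bar> \<le> C / real n"
    if n: "n \<ge> 1" "a / (4 * s ^ 3) \<le> real n" and x: "\<bar>x\<bar> \<le> a * sqrt (real n)" for n x
  proof -
    define q where "q = sqrt (real n)"
    have q: "q > 0" "real n = q\<^sup>2" using n by (simp_all add: q_def)
    have P: "0 < potential n z" "s * q \<le> sqrt (potential n z)" if "\<bar>z\<bar> \<le> a * q" for z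
      using sqrt_potential_ge(2,3)[OF _ a(2,1) n(1) s_def] that by (auto simp: q_def)
    define g where "g z = z / (4 * sqrt (potential n z) ^ 3)" for z
    have g: "\<bar>g z\<bar> \<le> a / (4 * s ^ 3) / real n" if z: "\<bar>z\<bar> \<le> a * q" for z
    proof -
      have "\<bar>g z\<bar> = \<bar>z\<bar> / (4 * sqrt (potential n z) ^ 3)" using P[OF z] by (simp add: g_def abs_mult)
      also have "\<dots> \<le> (a * q) / (4 * (s * q) ^ 3)"
        using P[OF z] z s q(1) by (intro frac_le mult_left_mono power_mono) auto
      also have "\<dots> = a / (4 * s ^ 3) / real n" unfolding q(2) using s q(1)
        by (simp add: field_simps power_numeral_reduce)
      finally show ?thesis .
    qed
    define \<delta> where "\<delta> z = - g z * (hermite_fun n z * hermite_fun_deriv n z) / action n z" for z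
    have J: "adiabatic n z = action n z * (1 + \<delta> z)" if "\<bar>z\<bar> \<le> a * q" for z
      using action_pos[OF P(1)[OF that]] by (simp add: adiabatic_def \<delta>_def g_def field_simps)
    have \<delta>: "\<bar>\<delta> z\<bar> \<le> a / (4 * s ^ 3) / real n / 2" "\<bar>\<delta> z\<bar> \<le> 1 / 2" if z: "\<bar>z\<bar> \<le> a * q" for z
    proof -
      note e = action_pos[OF P(1)[OF z]]
      have "\<bar>\<delta> z\<bar> = \<bar>g z\<bar> * (\<bar>hermite_fun n z * hermite_fun_deriv n z\<bar> / action n z)"
        using e by (simp add: \<delta>_def abs_mult)
      also have "\<dots> \<le> \<bar>g z\<bar> * (1 / 2)"
        using abs_hermite_fun_mult_deriv_le[OF P(1)[OF z]] e
        by (intro mult_left_mono) (simp_all add: field_simps)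
      finally have "\<bar>\<delta> z\<bar> \<le> \<bar>g z\<bar> / 2" by simp
      then show 1: "\<bar>\<delta> z\<bar> \<le> a / (4 * s ^ 3) / real n / 2" using g[OF z] by simp
      have "a / (4 * s ^ 3) / real n \<le> 1" using n by (subst divide_le_eq_1_pos) auto
      then have "a / (4 * s ^ 3) / real n / 2 \<le> 1 / 2" by (rule divide_right_mono) simp
      then show "\<bar>\<delta> z\<bar> \<le> 1 / 2" by (rule order_trans[OF 1])
    qed
    have E_le: "action n z \<le> 2 * adiabatic n z" and Jpos: "0 < adiabatic n z" if z: "\<bar>z\<bar> \<le> a * q" for z
    proof -
      note e = action_pos[OF P(1)[OF z]]
      have "1 / 2 \<le> 1 + \<delta> z" using \<delta>(2)[OF z] by (simp add: abs_le_iff)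
      then have "action n z * (1 / 2) \<le> adiabatic n z" unfolding J[OF z] using e by (intro mult_left_mono) auto
      then show "action n z \<le> 2 * adiabatic n z" "0 < adiabatic n z" using e by auto
    qed
    have xq: "\<bar>x\<bar> \<le> a * q" using x by (simp add: q_def)
    \<comment> \<open>\<open>G / (n q)\<close> bounds the logarithmic derivative of \<open>J\<close>, by \<open>sqrt p \<ge> s q\<close> and \<open>|z| \<le> a q\<close>.\<close>
    have "norm (ln (adiabatic n x) - ln (adiabatic n 0)) \<le> (G / (real n * q)) * norm (x - 0)"
    proof (rule field_differentiable_bound[where S = "{- (a * q)..a * q}"])
      fix z assume "z \<in> {- (a * q)..a * q}"
      then have z: "\<bar>z\<bar> \<le> a * q" by auto
      define J' where "J' = - (1 / (4 * sqrt (potential n z) ^ 3) + 3 * z\<^sup>2 / (16 * sqrt (potential n z) ^ 5)) *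
        (hermite_fun n z * hermite_fun_deriv n z)"
      have "(adiabatic n has_real_derivative J') (at z)"
        unfolding J'_def by (rule has_real_derivative_adiabatic[OF P(1)[OF z]])
      then have "((\<lambda>z. ln (adiabatic n z)) has_real_derivative J' / adiabatic n z) (at z)"
        using Jpos[OF z] by (auto intro!: derivative_eq_intros)
      then show "((\<lambda>z. ln (adiabatic n z)) has_real_derivative
         (- (1 / (4 * sqrt (potential n z) ^ 3) + 3 * z\<^sup>2 / (16 * sqrt (potential n z) ^ 5)) *
        (hermite_fun n z * hermite_fun_deriv n z)) / adiabatic n z) (at z within {- (a * q)..a * q})"
        unfolding J'_def by (rule has_field_derivative_at_within)
      have quot: "norm (- c * h / e) \<le> K" if "c * \<bar>h\<bar> \<le> K * e" "0 \<le> c" "0 < e" for c h e K :: real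
        using that by (simp add: abs_mult divide_le_eq)
      let ?c = "1 / (4 * sqrt (potential n z) ^ 3) + 3 * z\<^sup>2 / (16 * sqrt (potential n z) ^ 5)"
      have c0: "0 \<le> ?c" using P[OF z] by simp
      have c: "?c \<le> G / (real n * q)"
      proof -
        have "z\<^sup>2 \<le> (a * q)\<^sup>2" using z by (rule abs_le_square_iff[THEN iffD1, OF order_trans]) simp
        moreover have "(s * q) ^ 5 \<le> sqrt (potential n z) ^ 5" "(s * q) ^ 3 \<le> sqrt (potential n z) ^ 3"
          using P[OF z] s q(1) by (intro power_mono; simp)+
        ultimately have "?c \<le> 1 / (4 * (s * q) ^ 3) + 3 * (a * q)\<^sup>2 / (16 * (s * q) ^ 5)"
          using s q(1) by (intro add_mono frac_le) auto
        also have "\<dots> = G / (real n * q)" unfolding q(2) G_def using s q(1)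
          by (simp add: field_simps power_numeral_reduce)
        finally show ?thesis .
      qed
      have "\<bar>hermite_fun n z * hermite_fun_deriv n z\<bar> \<le> adiabatic n z"
        using abs_hermite_fun_mult_deriv_le[OF P(1)[OF z]] E_le[OF z] by linarith
      then have "?c * \<bar>hermite_fun n z * hermite_fun_deriv n z\<bar> \<le> G / (real n * q) * adiabatic n z"
        using c c0 Jpos[OF z] by (intro mult_mono) auto
      then show "norm (- ?c * (hermite_fun n z * hermite_fun_deriv n z) / adiabatic n z) \<le> G / (real n * q)"
        using c0 Jpos[OF z] by (rule quot)
    qed (use xq a q(1) in auto)
    also have "\<dots> \<le> (G / (real n * q)) * (a * q)"
      using xq s q(1) by (intro mult_left_mono) (auto simp: G_def)
    also have "\<dots> = G * a / real n" using q(1) by simp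
    finally have 1: "\<bar>ln (adiabatic n x) - ln (adiabatic n 0)\<bar> \<le> G * a / real n" by simp
    have "ln (adiabatic n x) = ln (action n x) + ln (1 + \<delta> x)"
      unfolding J[OF xq] using action_pos[OF P(1)[OF xq]] \<delta>(2)[OF xq] by (intro ln_mult_pos) auto
    moreover have "\<bar>ln (1 + \<delta> x)\<bar> \<le> a / (4 * s ^ 3) / real n"
      using abs_ln_add_one_le[OF \<delta>(2)[OF xq]] mult_left_mono[OF \<delta>(1)[OF xq], of 2]
      by (simp add: mult.commute)
    moreover have tri: "\<bar>e - e'\<bar> \<le> A + B" if "j = e + l" "\<bar>l\<bar> \<le> B" "j' = e'" "\<bar>j - j'\<bar> \<le> A" for e e' j j' l A B :: real
      using that by linarith
    moreover have "adiabatic n 0 = action n 0" by (simp add: adiabatic_def)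
    ultimately have "\<bar>ln (action n x) - ln (action n 0)\<bar> \<le> G * a / real n + a / (4 * s ^ 3) / real n"
      using 1 tri by metis
    then show ?thesis by (simp add: C_def add_divide_distrib)
  qed
  have "\<forall>\<^sub>F n in sequentially. a / (4 * s ^ 3) \<le> real n"
    by (rule eventually_sequentiallyI[of "nat \<lceil>a / (4 * s ^ 3)\<rceil>"]) linarith
  then have "\<forall>\<^sub>F n in sequentially. \<forall>x. \<bar>x\<bar> \<le> a * sqrt (real n) \<longrightarrow>
      \<bar>ln (action n x) - ln (action n 0)\<bar> \<le> C / real n"
    using eventually_ge_at_top[of 1] by eventually_elim (use est in blast)
  then show thesis by (rule that)
qed

text \<open>The central binomial probability \<open>(2 m choose m) / 4^m\<close>; its square times \<open>2 m + 1\<close> is the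
reciprocal of a partial Wallis product.\<close>

definition central_prob :: "nat \<Rightarrow> real" where
  "central_prob m = (\<Prod>k=1..m. (2 * real k - 1) / (2 * real k))"

lemma central_prob_Suc: "central_prob (Suc m) = central_prob m * ((2 * real m + 1) / (2 * real m + 2))"
  by (simp add: central_prob_def algebra_simps)

lemma central_prob_pos: "central_prob m > 0"
  unfolding central_prob_def by (rule prod_pos) auto

lemma central_prob_wallis:
  "(\<Prod>k=1..m. (4 * real k ^ 2) / (4 * real k ^ 2 - 1)) = 1 / ((central_prob m)\<^sup>2 * (2 * real m + 1))"
proof (induction m)
  case (Suc m)
  have c: "central_prob m \<noteq> 0" using central_prob_pos[of m] by simp
  have "(\<Prod>k=1..Suc m. (4 * real k ^ 2) / (4 * real k ^ 2 - 1)) =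
     1 / ((central_prob m)\<^sup>2 * (2 * real m + 1)) * (4 * real (Suc m) ^ 2 / (4 * real (Suc m) ^ 2 - 1))"
    unfolding Suc[symmetric] by (subst prod.nat_ivl_Suc') (simp_all add: mult.commute)
  also have "4 * real (Suc m) ^ 2 / (4 * real (Suc m) ^ 2 - 1) =
      (2 * real m + 2)\<^sup>2 / ((2 * real m + 1) * (2 * real m + 3))"
    by (simp add: power2_eq_square algebra_simps)
  also have "1 / ((central_prob m)\<^sup>2 * (2 * real m + 1)) * \<dots> = 1 / ((central_prob (Suc m))\<^sup>2 * (2 * real (Suc m) + 1))"
    unfolding central_prob_Suc using c
    by (simp add: divide_simps power_mult_distrib power_divide) (simp add: power2_eq_square algebra_simps)
  finally show ?case .
qed (simp add: central_prob_def)

lemma central_prob_tendsto: "(\<lambda>m. central_prob m * sqrt (2 * real m + 1)) \<longlonglongrightarrow> sqrt (2 / pi)"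
proof -
  have "(\<lambda>m. sqrt (1 / (\<Prod>k=1..m. (4 * real k ^ 2) / (4 * real k ^ 2 - 1)))) \<longlonglongrightarrow> sqrt (1 / (pi / 2))"
    using pi_gt_zero by (intro tendsto_intros wallis) auto
  moreover have "sqrt (1 / (\<Prod>k=1..m. (4 * real k ^ 2) / (4 * real k ^ 2 - 1))) = central_prob m * sqrt (2 * real m + 1)" for m
    unfolding central_prob_wallis using central_prob_pos[of m] by (simp add: real_sqrt_mult)
  ultimately show ?thesis by simp
qed

lemma hermite_0:
  "(hermite (2 * m) 0)\<^sup>2 = fact (2 * m) * central_prob m" "hermite (Suc (2 * m)) 0 = 0"
proof (induction m)
  case 0
  { case 1 show ?case by (simp add: central_prob_def) }
  { case 2 show ?case by simp }
next
  case (Suc m)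
  { case 1
    have "(hermite (2 * Suc m) 0)\<^sup>2 = (2 * real m + 1)\<^sup>2 * (hermite (2 * m) 0)\<^sup>2"
      by (simp add: power_mult_distrib algebra_simps power2_eq_square)
    then show ?case unfolding Suc(1) central_prob_Suc
      by (simp add: divide_simps) (simp add: power2_eq_square algebra_simps) }
  { case 2 show ?case using Suc(2) by simp }
qed

lemma action_0_even: "action (2 * m) 0 = sqrt (2 * real m + 1 / 2) * central_prob m"
proof -
  have "hermite_pred (2 * m) 0 = 0"
    using hermite_0(2)[of "m - 1"] by (cases m) (simp_all add: hermite_pred_def)
  then show ?thesis
    by (simp add: action_def hermite_fun_def hermite_fun_deriv_def potential_def power_divide hermite_0)
qed

lemma action_0_odd: "action (Suc (2 * m)) 0 = (2 * real m + 1) / sqrt (2 * real m + 3 / 2) * central_prob m"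
proof -
  have "(hermite_pred (Suc (2 * m)) 0)\<^sup>2 = (2 * real m + 1)\<^sup>2 * (fact (2 * m) * central_prob m)"
    by (simp add: hermite_pred_def power_mult_distrib hermite_0 add.commute)
  then have "(hermite_fun_deriv (Suc (2 * m)) 0)\<^sup>2 = (2 * real m + 1)\<^sup>2 * (fact (2 * m) * central_prob m) / fact (Suc (2 * m))"
    by (simp add: hermite_fun_deriv_def power_divide)
  also have "\<dots> = (2 * real m + 1) * central_prob m"
    by (simp add: divide_simps) (simp add: power2_eq_square algebra_simps)
  finally show ?thesis
    by (simp add: action_def hermite_fun_def potential_def hermite_0 add.commute)
qed

text \<open>For even \<open>n\<close> the action at 0 comes from \<open>h\<close> alone and for odd \<open>n\<close> from \<open>h'\<close> alone, but both
subsequences have the same limit by Wallis' product.\<close>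

lemma action_0_tendsto: "(\<lambda>n. action n 0) \<longlonglongrightarrow> sqrt (2 / pi)"
proof -
  have "(\<lambda>m. sqrt ((2 * real m + 1 / 2) / (2 * real m + 1)) * (central_prob m * sqrt (2 * real m + 1)))
     \<longlonglongrightarrow> sqrt 1 * sqrt (2 / pi)"
    by (intro tendsto_intros central_prob_tendsto) real_asymp
  moreover have "sqrt ((2 * real m + 1 / 2) / (2 * real m + 1)) * (central_prob m * sqrt (2 * real m + 1)) = action (2 * m) 0" for m
    by (simp add: action_0_even real_sqrt_divide)
  ultimately have even: "(\<lambda>m. action (2 * m) 0) \<longlonglongrightarrow> sqrt (2 / pi)" by simp
  have "(\<lambda>m. sqrt ((2 * real m + 1) / (2 * real m + 3 / 2)) * (central_prob m * sqrt (2 * real m + 1)))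
     \<longlonglongrightarrow> sqrt 1 * sqrt (2 / pi)"
    by (intro tendsto_intros central_prob_tendsto) real_asymp
  moreover have "sqrt ((2 * real m + 1) / (2 * real m + 3 / 2)) * (central_prob m * sqrt (2 * real m + 1)) = action (Suc (2 * m)) 0" for m
    by (simp add: action_0_odd real_sqrt_divide)
  ultimately have odd: "(\<lambda>m. action (Suc (2 * m)) 0) \<longlonglongrightarrow> sqrt (2 / pi)" by simp
  show ?thesis
  proof (rule LIMSEQ_I)
    fix e :: real assume e: "0 < e"
    obtain N1 where N1: "\<And>m. m \<ge> N1 \<Longrightarrow> norm (action (2 * m) 0 - sqrt (2 / pi)) < e"
      using LIMSEQ_D[OF even e] by blast
    obtain N2 where N2: "\<And>m. m \<ge> N2 \<Longrightarrow> norm (action (Suc (2 * m)) 0 - sqrt (2 / pi)) < e"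
      using LIMSEQ_D[OF odd e] by blast
    have "norm (action n 0 - sqrt (2 / pi)) < e" if "n \<ge> 2 * (N1 + N2)" for n
    proof (cases "even n")
      case True
      then obtain m where "n = 2 * m" by blast
      then show ?thesis using N1[of m] that by simp
    next
      case False
      then obtain m where "n = Suc (2 * m)" by (metis oddE Suc_eq_plus1)
      then show ?thesis using N2[of m] that by simp
    qed
    then show "\<exists>no. \<forall>n\<ge>no. norm (action n 0 - sqrt (2 / pi)) < e" by blast
  qed
qed

lemma action_tendsto:
  assumes a: "0 < a" "a < 2" and x: "\<forall>\<^sub>F n in sequentially. \<bar>x n\<bar> \<le> a * sqrt (real n)"
  shows "(\<lambda>n. action n (x n)) \<longlonglongrightarrow> sqrt (2 / pi)"
proof -
  obtain C where C: "\<forall>\<^sub>F n in sequentially. \<forall>x. \<bar>x\<bar> \<le> a * sqrt (real n) \<longrightarrow>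
    \<bar>ln (action n x) - ln (action n 0)\<bar> \<le> C / real n" using action_transport[OF a] .
  have "(\<lambda>n. ln (action n (x n)) - ln (action n 0)) \<longlonglongrightarrow> 0"
  proof (rule Lim_null_comparison)
    show "\<forall>\<^sub>F n in sequentially. norm (ln (action n (x n)) - ln (action n 0)) \<le> C / real n"
      using C x by eventually_elim auto
    show "(\<lambda>n. C / real n) \<longlonglongrightarrow> 0" by real_asymp
  qed
  then have "(\<lambda>n. exp (ln (action n (x n)) - ln (action n 0)) * action n 0) \<longlonglongrightarrow> exp 0 * sqrt (2 / pi)"
    by (intro tendsto_intros action_0_tendsto)
  moreover have "\<forall>\<^sub>F n in sequentially. exp (ln (action n (x n)) - ln (action n 0)) * action n 0 = action n (x n)"
    using x eventually_ge_at_top[of 1]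
  proof eventually_elim
    case (elim n)
    have "0 < potential n 0" "0 < potential n (x n)"
      using sqrt_potential_ge(3)[OF elim(1) a(2,1) elim(2) refl] by (auto simp: potential_def)
    then show ?case using action_pos[of n 0] action_pos[of n "x n"] by (simp add: exp_diff)
  qed
  ultimately show ?thesis by (simp cong: filterlim_cong add: tendsto_cong)
qed

section \<open>Bulk asymptotics of the Hermite kernel\<close>

lemma eventually_bulk:
  fixes x :: "nat \<Rightarrow> real"
  assumes x: "(\<lambda>n. x n / sqrt (real n)) \<longlonglongrightarrow> \<xi>" and a: "\<bar>\<xi>\<bar> < a"
  shows "\<forall>\<^sub>F n in sequentially. \<bar>x n\<bar> \<le> a * sqrt (real n)"
proof -
  have "(\<lambda>n. \<bar>x n / sqrt (real n)\<bar>) \<longlonglongrightarrow> \<bar>\<xi>\<bar>" by (intro tendsto_intros x)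
  then have "\<forall>\<^sub>F n in sequentially. \<bar>x n / sqrt (real n)\<bar> < a" using a by (rule order_tendstoD)
  then show ?thesis using eventually_gt_at_top[of 0]
    by eventually_elim (simp add: divide_less_eq)
qed

lemma sqrt_potential_tendsto:
  assumes x: "(\<lambda>n. x n / sqrt (real n)) \<longlonglongrightarrow> \<xi>"
  shows "(\<lambda>n. sqrt (potential n (x n)) / sqrt (real n)) \<longlonglongrightarrow> sqrt (1 - \<xi>\<^sup>2 / 4)"
proof -
  have "(\<lambda>n. 1 / real n) \<longlonglongrightarrow> 0" by real_asymp
  then have "(\<lambda>n. sqrt (1 + (1 / real n) / 2 - (x n / sqrt (real n))\<^sup>2 / 4)) \<longlonglongrightarrow> sqrt (1 + 0 / 2 - \<xi>\<^sup>2 / 4)"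
    by (intro tendsto_intros x) auto
  moreover have "\<forall>\<^sub>F n in sequentially. sqrt (1 + (1 / real n) / 2 - (x n / sqrt (real n))\<^sup>2 / 4) =
      sqrt (potential n (x n)) / sqrt (real n)"
    using eventually_gt_at_top[of 0]
    by eventually_elim (simp add: potential_def real_sqrt_divide[symmetric] power_divide field_simps)
  ultimately show ?thesis by (simp add: tendsto_cong)
qed

lemma hermite_fun_sq_tendsto:
  assumes a: "0 < a" "a < 2" and x: "\<forall>\<^sub>F n in sequentially. \<bar>x n\<bar> \<le> a * sqrt (real n)"
  shows "(\<lambda>n. (hermite_fun n (x n))\<^sup>2 / sqrt (real n)) \<longlonglongrightarrow> 0"
proof -
  define s where "s = sqrt (1 - a\<^sup>2 / 4)"
  have s: "0 < s" using sqrt_potential_ge(1)[of 0 a 1, OF _ a(2,1) _ s_def] a by simp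
  have lim: "(\<lambda>n. action n (x n) * (1 / (s * real n))) \<longlonglongrightarrow> sqrt (2 / pi) * 0"
    by (intro tendsto_mult action_tendsto[OF a x] tendsto_divide_0[OF tendsto_const]
        filterlim_tendsto_pos_mult_at_top[OF tendsto_const s] filterlim_real_sequentially
        filterlim_mono[OF _ at_top_le_at_infinity order_refl])
  have "\<forall>\<^sub>F n in sequentially. norm ((hermite_fun n (x n))\<^sup>2 / sqrt (real n)) \<le> action n (x n) * (1 / (s * real n))"
    using x eventually_ge_at_top[of 1]
  proof eventually_elim
    case (elim n)
    note p = sqrt_potential_ge[OF elim(1) a(2,1) elim(2) s_def]
    note e = action_pos[OF p(3)]
    have n: "sqrt (real n) > 0" using elim(2) by simp
    have "(hermite_fun n (x n))\<^sup>2 \<le> action n (x n) / sqrt (potential n (x n))"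
      by (rule hermite_fun_sq_le[OF p(3)])
    also have "\<dots> \<le> action n (x n) / (s * sqrt (real n))"
      using p e n by (intro divide_left_mono) auto
    finally have "(hermite_fun n (x n))\<^sup>2 / sqrt (real n) \<le> action n (x n) / (s * sqrt (real n)) / sqrt (real n)"
      using n by (intro divide_right_mono) auto
    also have "\<dots> = action n (x n) * (1 / (s * real n))" by simp
    finally show ?case by simp
  qed
  then show ?thesis by (rule Lim_null_comparison[OF _ lim[unfolded mult_zero_right]])
qed

lemma gauss_kernel_diag_tendsto:
  assumes x: "(\<lambda>n. x n / sqrt (real n)) \<longlonglongrightarrow> \<xi>" and \<xi>: "\<bar>\<xi>\<bar> < 2"
  shows "(\<lambda>n. gauss_kernel n (x n) (x n) / sqrt (real n)) \<longlonglongrightarrow> sqrt (2 / pi) * sqrt (1 - \<xi>\<^sup>2 / 4)"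
proof -
  define a where "a = (\<bar>\<xi>\<bar> + 2) / 2"
  have a: "0 < a" "a < 2" "\<bar>\<xi>\<bar> < a" using \<xi> by (simp_all add: a_def)
  note ev = eventually_bulk[OF x a(3)]
  have "(\<lambda>n. (hermite_fun n (x n))\<^sup>2 / sqrt (real n) / 2 + action n (x n) * (sqrt (potential n (x n)) / sqrt (real n)))
     \<longlonglongrightarrow> 0 / 2 + sqrt (2 / pi) * sqrt (1 - \<xi>\<^sup>2 / 4)"
    by (intro tendsto_intros hermite_fun_sq_tendsto[OF a(1,2) ev] action_tendsto[OF a(1,2) ev]
        sqrt_potential_tendsto[OF x]) simp
  moreover have "\<forall>\<^sub>F n in sequentially. (hermite_fun n (x n))\<^sup>2 / sqrt (real n) / 2 +
      action n (x n) * (sqrt (potential n (x n)) / sqrt (real n)) = gauss_kernel n (x n) (x n) / sqrt (real n)"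
    using ev eventually_ge_at_top[of 1]
  proof eventually_elim
    case (elim n)
    show ?case
      unfolding gauss_kernel_action[OF sqrt_potential_ge(3)[OF elim(1) a(2,1) elim(2) refl]]
      by (simp add: add_divide_distrib mult.commute)
  qed
  ultimately show ?thesis by (simp add: tendsto_cong)
qed

text \<open>Variation of constants. In the rotating frame \<open>A = \<theta> u cos - u' sin\<close>, \<open>B = \<theta> u sin + u' cos\<close> (all at
the angle \<open>\<theta> s\<close>) an exact solution of \<open>u'' = - \<theta>\<^sup>2 u\<close> is constant, and here the frame coordinates move
at speed at most \<open>K\<close>. The hypothesis \<open>s * t \<ge> 0\<close> restricts \<open>s\<close> to the side of \<open>t\<close>, so that
\<open>t\<close> may have either sign.\<close>

lemma harmonic_comparison:
  fixes u v :: "real \<Rightarrow> real"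
  assumes u: "\<And>s. \<bar>s\<bar> \<le> \<bar>t\<bar> \<Longrightarrow> s * t \<ge> 0 \<Longrightarrow> (u has_real_derivative v s) (at s)"
    and v: "\<And>s. \<bar>s\<bar> \<le> \<bar>t\<bar> \<Longrightarrow> s * t \<ge> 0 \<Longrightarrow> (v has_real_derivative g s) (at s)"
    and u0: "u 0 = 0" and \<theta>: "\<theta> > 0"
    and bound: "\<And>s. \<bar>s\<bar> \<le> \<bar>t\<bar> \<Longrightarrow> s * t \<ge> 0 \<Longrightarrow> \<bar>g s + \<theta>\<^sup>2 * u s\<bar> \<le> K"
  shows "\<bar>\<theta> * u t - v 0 * sin (\<theta> * t)\<bar> \<le> 2 * K * \<bar>t\<bar>"
proof -
  define S where "S = closed_segment 0 t"
  have S: "\<bar>s\<bar> \<le> \<bar>t\<bar>" "s * t \<ge> 0" if "s \<in> S" for s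
    using that by (auto simp: S_def closed_segment_eq_real_ivl zero_le_mult_iff split: if_splits)
  define A where "A s = \<theta> * u s * cos (\<theta> * s) - v s * sin (\<theta> * s)" for s
  define B where "B s = \<theta> * u s * sin (\<theta> * s) + v s * cos (\<theta> * s)" for s
  have K: "0 \<le> K" using bound[of 0] by (rule order_trans[OF abs_ge_zero]) auto
  have "norm (A t - A 0) \<le> K * norm (t - 0)"
  proof (rule field_differentiable_bound[where S = S])
    fix s assume s: "s \<in> S"
    show "(A has_real_derivative - (g s + \<theta>\<^sup>2 * u s) * sin (\<theta> * s)) (at s within S)"
      unfolding A_def[abs_def]
      by (rule DERIV_subset[of _ _ _ UNIV])
         (auto intro!: derivative_eq_intros u[OF S[OF s]] v[OF S[OF s]] simp: algebra_simps power2_eq_square)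
    have "norm (- (g s + \<theta>\<^sup>2 * u s) * sin (\<theta> * s)) \<le> \<bar>g s + \<theta>\<^sup>2 * u s\<bar> * 1"
      unfolding real_norm_def abs_mult abs_minus_cancel by (intro mult_left_mono) auto
    then show "norm (- (g s + \<theta>\<^sup>2 * u s) * sin (\<theta> * s)) \<le> K" using bound[OF S[OF s]] by simp
  qed (auto simp: S_def)
  then have A: "\<bar>A t\<bar> \<le> K * \<bar>t\<bar>" by (simp add: A_def u0)
  have "norm (B t - B 0) \<le> K * norm (t - 0)"
  proof (rule field_differentiable_bound[where S = S])
    fix s assume s: "s \<in> S"
    show "(B has_real_derivative (g s + \<theta>\<^sup>2 * u s) * cos (\<theta> * s)) (at s within S)"
      unfolding B_def[abs_def]
      by (rule DERIV_subset[of _ _ _ UNIV])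
         (auto intro!: derivative_eq_intros u[OF S[OF s]] v[OF S[OF s]] simp: algebra_simps power2_eq_square)
    have "norm ((g s + \<theta>\<^sup>2 * u s) * cos (\<theta> * s)) \<le> \<bar>g s + \<theta>\<^sup>2 * u s\<bar> * 1"
      unfolding real_norm_def abs_mult by (intro mult_left_mono) auto
    then show "norm ((g s + \<theta>\<^sup>2 * u s) * cos (\<theta> * s)) \<le> K" using bound[OF S[OF s]] by simp
  qed (auto simp: S_def)
  then have B: "\<bar>B t - v 0\<bar> \<le> K * \<bar>t\<bar>" by (simp add: B_def u0)
  have "A t * cos (\<theta> * t) + B t * sin (\<theta> * t) = \<theta> * u t * ((cos (\<theta> * t))\<^sup>2 + (sin (\<theta> * t))\<^sup>2)"
    unfolding A_def B_def power2_eq_square by (simp only: algebra_simps)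
  then have "\<theta> * u t - v 0 * sin (\<theta> * t) = A t * cos (\<theta> * t) + (B t - v 0) * sin (\<theta> * t)"
    by (simp add: algebra_simps)
  also have "\<bar>\<dots>\<bar> \<le> \<bar>A t * cos (\<theta> * t)\<bar> + \<bar>(B t - v 0) * sin (\<theta> * t)\<bar>" by (rule abs_triangle_ineq)
  also have "\<dots> \<le> \<bar>A t\<bar> * 1 + \<bar>B t - v 0\<bar> * 1"
    unfolding abs_mult by (intro add_mono mult_left_mono) auto
  finally show ?thesis using A B by simp
qed

text \<open>As a function of \<open>y\<close> the expression \<open>u = h(x) h'(y) - h'(x) h(y)\<close> vanishes at \<open>x\<close>, where its
derivative is \<open>- sqrt p(x)\<close> times the action. It satisfies \<open>u'' = - p u + h(x) (y/2) h(y)\<close>. Between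
\<open>x\<close> and \<open>y\<close> the function \<open>p\<close> moves by at most \<open>O(sqrt n) |x - y|\<close>, and the last term is
\<open>O(1)\<close>, so \<open>harmonic_comparison\<close> applies with the frequency \<open>\<theta> = sqrt p(x)\<close>. Dividing by
\<open>\<theta>\<close>, which is of order \<open>sqrt n\<close>, gives the bound.\<close>

lemma wronskian_estimate:
  assumes a: "0 < a" "a < 2" and s: "s = sqrt (1 - a\<^sup>2 / 4)" and n: "n \<ge> 1"
    and E: "\<And>z. \<bar>z\<bar> \<le> a * sqrt (real n) \<Longrightarrow> action n z \<le> 1"
    and x: "\<bar>x\<bar> \<le> a * sqrt (real n)" and y: "\<bar>y\<bar> \<le> a * sqrt (real n)"
  shows "\<bar>(hermite_fun n x * hermite_fun_deriv n y - hermite_fun_deriv n x * hermite_fun n y)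
      - action n x * sin (sqrt (potential n x) * (x - y))\<bar> \<le>
      2 * a * sqrt (2 / s) / s * (x - y)\<^sup>2 + a / s\<^sup>2 * \<bar>x - y\<bar> / sqrt (real n)"
proof -
  define q where "q = sqrt (real n)"
  have q: "q > 0" using n by (simp add: q_def)
  define t where "t = y - x"
  define \<theta> where "\<theta> = sqrt (potential n x)"
  have P: "0 < s" "s * q \<le> sqrt (potential n z)" "0 < potential n z" "sqrt (potential n z) \<le> 2 * q"
    if "\<bar>z\<bar> \<le> a * q" for z
    using sqrt_potential_ge[OF _ a(2,1) n s] that by (auto simp: q_def)
  have xq: "\<bar>x\<bar> \<le> a * q" and yq: "\<bar>y\<bar> \<le> a * q" using x y by (simp_all add: q_def)
  have s0: "s > 0" using P(1)[OF xq] .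
  have \<theta>: "\<theta> > 0" "\<theta>\<^sup>2 = potential n x" "s * q \<le> \<theta>" using P[OF xq] by (simp_all add: \<theta>_def)
  have z: "\<bar>x + r\<bar> \<le> a * q" if "\<bar>r\<bar> \<le> \<bar>t\<bar>" "r * t \<ge> 0" for r
  proof -
    have "x \<le> x + r \<and> x + r \<le> y \<or> y \<le> x + r \<and> x + r \<le> x"
    proof -
      have "y = x + t" by (simp add: t_def)
      moreover have "0 \<le> r \<and> r \<le> t \<or> t \<le> r \<and> r \<le> 0" using that by (auto simp: zero_le_mult_iff)
      ultimately show ?thesis by linarith
    qed
    then show ?thesis using xq yq by linarith
  qed
  have h: "(hermite_fun n w)\<^sup>2 \<le> 1 / (s * q)" "(hermite_fun_deriv n w)\<^sup>2 \<le> 2 * q" if w: "\<bar>w\<bar> \<le> a * q" for w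
  proof -
    have e: "0 < action n w" "action n w \<le> 1" using action_pos[OF P(3)[OF w]] E[of w] w by (auto simp: q_def)
    have "(hermite_fun n w)\<^sup>2 \<le> action n w / sqrt (potential n w)" by (rule hermite_fun_sq_le[OF P(3)[OF w]])
    also have "\<dots> \<le> 1 / (s * q)" using e P[OF w] s0 q by (intro frac_le) auto
    finally show "(hermite_fun n w)\<^sup>2 \<le> 1 / (s * q)" .
    have "(hermite_fun_deriv n w)\<^sup>2 \<le> action n w * sqrt (potential n w)" by (rule hermite_fun_sq_le[OF P(3)[OF w]])
    also have "\<dots> \<le> 1 * (2 * q)" using e P[OF w] q by (intro mult_mono) auto
    finally show "(hermite_fun_deriv n w)\<^sup>2 \<le> 2 * q" by simp
  qed
  \<comment> \<open>The powers of \<open>q\<close> cancel: \<open>h\<^sup>2\<close> is of order \<open>1/q\<close> and \<open>h'\<^sup>2\<close> of order \<open>q\<close>.\<close>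
  have hd: "\<bar>hermite_fun n w * hermite_fun_deriv n w'\<bar> \<le> sqrt (2 / s)"
    if w: "\<bar>w\<bar> \<le> a * q" "\<bar>w'\<bar> \<le> a * q" for w w'
  proof -
    have "(hermite_fun n w * hermite_fun_deriv n w')\<^sup>2 \<le> 1 / (s * q) * (2 * q)"
      unfolding power_mult_distrib using h(1)[OF w(1)] h(2)[OF w(2)] q s0 by (intro mult_mono) auto
    also have "\<dots> = 2 / s" using q by simp
    finally have "sqrt ((hermite_fun n w * hermite_fun_deriv n w')\<^sup>2) \<le> sqrt (2 / s)"
      by (rule real_sqrt_le_mono)
    then show ?thesis unfolding real_sqrt_abs .
  qed
  define u where "u r = hermite_fun n x * hermite_fun_deriv n (x + r) - hermite_fun_deriv n x * hermite_fun n (x + r)" for r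
  define v where "v r = hermite_fun n x * (- potential n (x + r) * hermite_fun n (x + r)) - hermite_fun_deriv n x * hermite_fun_deriv n (x + r)" for r
  have D: "((\<lambda>r. hermite_fun n (x + r)) has_real_derivative hermite_fun_deriv n (x + r)) (at r)"
    "((\<lambda>r. hermite_fun_deriv n (x + r)) has_real_derivative - potential n (x + r) * hermite_fun n (x + r)) (at r)" for r
    using DERIV_shift[of "hermite_fun n" _ r x] has_real_derivative_hermite_fun[of n "r + x"]
      DERIV_shift[of "hermite_fun_deriv n" _ r x] has_real_derivative_hermite_fun_deriv[of n "r + x"]
    by (simp_all add: add.commute)
  have Dp: "((\<lambda>r. potential n (x + r)) has_real_derivative - (x + r) / 2) (at r)" for r
    unfolding potential_def by (auto intro!: derivative_eq_intros simp: field_simps)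
  have du: "(u has_real_derivative v r) (at r)" for r
    unfolding u_def[abs_def] v_def by (rule DERIV_diff DERIV_cmult D)+
  have K: "\<bar>potential n (x + r) - \<theta>\<^sup>2\<bar> * \<bar>u r\<bar> \<le> (\<bar>t\<bar> * a * q / 2) * (2 * sqrt (2 / s))"
    if r: "\<bar>r\<bar> \<le> \<bar>t\<bar>" "r * t \<ge> 0" for r
  proof (rule mult_mono)
    have "potential n (x + r) - \<theta>\<^sup>2 = - (r * (x + (x + r))) / 4"
      unfolding \<theta>(2) potential_def by (simp add: field_simps power2_eq_square)
    then have "\<bar>potential n (x + r) - \<theta>\<^sup>2\<bar> = \<bar>r\<bar> * \<bar>x + (x + r)\<bar> / 4" by (simp add: abs_mult)
    also have "\<bar>r\<bar> * \<bar>x + (x + r)\<bar> \<le> \<bar>t\<bar> * (2 * (a * q))"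
      using r xq z[OF r] by (intro mult_mono) auto
    finally show "\<bar>potential n (x + r) - \<theta>\<^sup>2\<bar> \<le> \<bar>t\<bar> * a * q / 2"
      by (simp add: mult_ac)
    have "\<bar>u r\<bar> \<le> \<bar>hermite_fun n x * hermite_fun_deriv n (x + r)\<bar> + \<bar>hermite_fun n (x + r) * hermite_fun_deriv n x\<bar>"
      unfolding u_def by (simp add: mult.commute abs_triangle_ineq4)
    then show "\<bar>u r\<bar> \<le> 2 * sqrt (2 / s)" using hd[OF xq z[OF r]] hd[OF z[OF r] xq] by linarith
  qed (use a q in auto)
  have dv: "(v has_real_derivative - potential n (x + r) * u r + hermite_fun n x * ((x + r) / 2 * hermite_fun n (x + r))) (at r)" for r
    unfolding v_def[abs_def] u_def
    by (rule DERIV_cong, (rule DERIV_diff DERIV_cmult DERIV_mult DERIV_minus D Dp)+) (simp add: field_simps)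
  have F: "\<bar>hermite_fun n x * ((x + r) / 2 * hermite_fun n (x + r))\<bar> \<le> a / (2 * s)"
    if r: "\<bar>r\<bar> \<le> \<bar>t\<bar>" "r * t \<ge> 0" for r
  proof -
    have "\<bar>hermite_fun n x * hermite_fun n (x + r)\<bar> \<le> 1 / (s * q)"
    proof -
      have *: "\<bar>e * f\<bar> \<le> k" if "e\<^sup>2 \<le> k" "f\<^sup>2 \<le> k" for e f k :: real
        using sum_squares_bound[of "\<bar>e\<bar>" "\<bar>f\<bar>"] that by (simp add: abs_mult)
      show ?thesis by (rule *[OF h(1)[OF xq] h(1)[OF z[OF r]]])
    qed
    then have "\<bar>x + r\<bar> / 2 * \<bar>hermite_fun n x * hermite_fun n (x + r)\<bar> \<le> a * q / 2 * (1 / (s * q))"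
      using z[OF r] a q by (intro mult_mono) auto
    then show ?thesis using q by (simp add: abs_mult mult_ac)
  qed
  \<comment> \<open>The first summand bounds \<open>(p - \<theta>\<^sup>2) u\<close>, the second the inhomogeneity.\<close>
  define K where "K = (\<bar>t\<bar> * a * q / 2) * (2 * sqrt (2 / s)) + a / (2 * s)"
  have "\<bar>\<theta> * u t - v 0 * sin (\<theta> * t)\<bar> \<le> 2 * K * \<bar>t\<bar>"
  proof (rule harmonic_comparison[OF du dv _ \<theta>(1)])
    show "u 0 = 0" by (simp add: u_def)
    fix r assume r: "\<bar>r\<bar> \<le> \<bar>t\<bar>" "r * t \<ge> 0"
    have "- potential n (x + r) * u r + hermite_fun n x * ((x + r) / 2 * hermite_fun n (x + r)) + \<theta>\<^sup>2 * u r
      = - ((potential n (x + r) - \<theta>\<^sup>2) * u r) + hermite_fun n x * ((x + r) / 2 * hermite_fun n (x + r))"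
      by (simp only: algebra_simps)
    also have "\<bar>\<dots>\<bar> \<le> \<bar>potential n (x + r) - \<theta>\<^sup>2\<bar> * \<bar>u r\<bar> + \<bar>hermite_fun n x * ((x + r) / 2 * hermite_fun n (x + r))\<bar>"
      by (rule order_trans[OF abs_triangle_ineq]) (simp only: abs_minus_cancel abs_mult order_refl)
    also have "\<dots> \<le> K" unfolding K_def by (rule add_mono[OF K[OF r] F[OF r]])
    finally show "\<bar>- potential n (x + r) * u r + hermite_fun n x * ((x + r) / 2 * hermite_fun n (x + r)) + \<theta>\<^sup>2 * u r\<bar> \<le> K" .
  qed
  moreover have "v 0 * sin (\<theta> * t) = \<theta> * (action n x * sin (\<theta> * (x - y)))"
  proof -
    have "\<theta> * t = - (\<theta> * (x - y))" by (simp add: t_def algebra_simps)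
    then have "sin (\<theta> * t) = - sin (\<theta> * (x - y))" by (simp only: sin_minus)
    moreover have "v 0 = - (\<theta> * action n x)"
      unfolding v_def action_def \<theta>_def[symmetric] using \<theta>(1)
      by (simp add: \<theta>(2)[symmetric] field_simps power2_eq_square)
    ultimately show ?thesis by simp
  qed
  ultimately have "\<bar>\<theta> * (u t - action n x * sin (\<theta> * (x - y)))\<bar> \<le> 2 * K * \<bar>t\<bar>"
    by (simp only: right_diff_distrib)
  then have "\<bar>u t - action n x * sin (\<theta> * (x - y))\<bar> \<le> 2 * K * \<bar>t\<bar> / \<theta>"
  proof -
    have "\<bar>z\<bar> \<le> B / \<theta>" if "\<bar>\<theta> * z\<bar> \<le> B" for z B
      using that \<theta>(1) by (simp add: abs_mult pos_le_divide_eq mult.commute)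
    then show "\<bar>\<theta> * (u t - action n x * sin (\<theta> * (x - y)))\<bar> \<le> 2 * K * \<bar>t\<bar> \<Longrightarrow>
      \<bar>u t - action n x * sin (\<theta> * (x - y))\<bar> \<le> 2 * K * \<bar>t\<bar> / \<theta>" .
  qed
  also have "\<dots> \<le> 2 * K * \<bar>t\<bar> / (s * q)"
    using \<theta> q s0 a by (intro divide_left_mono) (auto simp: K_def intro!: add_nonneg_nonneg mult_nonneg_nonneg)
  also have "\<dots> = 2 * a * sqrt (2 / s) / s * t\<^sup>2 + a / s\<^sup>2 * \<bar>t\<bar> / q"
    unfolding K_def using q s0 power2_abs[of t, symmetric] by (simp add: field_simps power2_eq_square)
  also have "\<dots> = 2 * a * sqrt (2 / s) / s * (x - y)\<^sup>2 + a / s\<^sup>2 * \<bar>x - y\<bar> / q"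
    by (simp add: t_def power2_commute[of y x] abs_minus_commute[of y x])
  also have "u t = hermite_fun n x * hermite_fun_deriv n y - hermite_fun_deriv n x * hermite_fun n y"
    by (simp add: u_def t_def)
  finally show ?thesis unfolding \<theta>_def q_def .
qed

text \<open>The distance of the points is \<open>D n / sqrt n\<close> with \<open>D n \<longrightarrow> \<delta>\<close>, so the error in
\<open>wronskian_estimate\<close>, divided by \<open>D n\<close>, is \<open>O(1/n)\<close>. The estimate needs the action to be at most 1, which holds in the
whole range \<open>|z| \<le> a sqrt n\<close> for large \<open>n\<close> because \<open>sqrt (2/\<pi>) < 1\<close>.\<close>

lemma gauss_kernel_offdiag_tendsto:
  assumes x: "(\<lambda>n. x n / sqrt (real n)) \<longlonglongrightarrow> \<xi>" and \<xi>: "\<bar>\<xi>\<bar> < 2"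
    and d: "(\<lambda>n. sqrt (real n) * (x n - y n)) \<longlonglongrightarrow> \<delta>" and \<delta>: "\<delta> \<noteq> 0"
  shows "(\<lambda>n. gauss_kernel n (x n) (y n) / sqrt (real n)) \<longlonglongrightarrow>
    sqrt (2 / pi) * (sin (sqrt (1 - \<xi>\<^sup>2 / 4) * \<delta>) / \<delta>)"
proof -
  define a where "a = (\<bar>\<xi>\<bar> + 2) / 2"
  have a: "0 < a" "a < 2" "\<bar>\<xi>\<bar> < a" using \<xi> by (simp_all add: a_def)
  define s where "s = sqrt (1 - a\<^sup>2 / 4)"
  define w where "w = sqrt (1 - \<xi>\<^sup>2 / 4)"
  define C where "C = 2 * a * sqrt (2 / s) / s"
  define C' where "C' = a / s\<^sup>2"
  define D where "D n = sqrt (real n) * (x n - y n)" for n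
  have D: "D \<longlonglongrightarrow> \<delta>" using d by (simp add: D_def[abs_def])
  have inv: "(\<lambda>n. 1 / real n) \<longlonglongrightarrow> 0" by real_asymp
  have y: "(\<lambda>n. y n / sqrt (real n)) \<longlonglongrightarrow> \<xi>"
  proof -
    have "(\<lambda>n. x n / sqrt (real n) - D n * (1 / real n)) \<longlonglongrightarrow> \<xi> - \<delta> * 0"
      by (intro tendsto_intros x D inv)
    moreover have "\<forall>\<^sub>F n in sequentially. x n / sqrt (real n) - D n * (1 / real n) = y n / sqrt (real n)"
      using eventually_gt_at_top[of 0]
    proof eventually_elim
      case (elim n)
      define q where "q = sqrt (real n)"
      have "q > 0" "real n = q * q" using elim by (simp_all add: q_def)
      then show ?case unfolding D_def q_def[symmetric] by (simp add: field_simps)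
    qed
    ultimately show ?thesis by (simp add: tendsto_cong)
  qed
  note evx = eventually_bulk[OF x a(3)] and evy = eventually_bulk[OF y a(3)]
  obtain Ct where Ct: "\<forall>\<^sub>F n in sequentially. \<forall>x. \<bar>x\<bar> \<le> a * sqrt (real n) \<longrightarrow>
    \<bar>ln (action n x) - ln (action n 0)\<bar> \<le> Ct / real n" using action_transport[OF a(1,2)] .
  have "(\<lambda>n. exp (Ct / real n) * action n 0) \<longlonglongrightarrow> exp 0 * sqrt (2 / pi)"
    by (rule tendsto_intros action_0_tendsto | real_asymp)+
  moreover have "exp 0 * sqrt (2 / pi) < 1"
    using pi_gt3 by (simp add: real_sqrt_lt_1_iff)
  ultimately have "\<forall>\<^sub>F n in sequentially. exp (Ct / real n) * action n 0 < 1" by (rule order_tendstoD)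
  then have E: "\<forall>\<^sub>F n in sequentially. \<forall>z. \<bar>z\<bar> \<le> a * sqrt (real n) \<longrightarrow> action n z \<le> 1"
    using Ct eventually_ge_at_top[of 1]
  proof eventually_elim
    case (elim n)
    show ?case
    proof (intro allI impI)
      fix z assume z: "\<bar>z\<bar> \<le> a * sqrt (real n)"
      have p: "0 < potential n z" "0 < potential n 0"
        using sqrt_potential_ge(3)[OF z a(2,1) elim(3) refl] by (auto simp: potential_def)
      have "ln (action n z) \<le> Ct / real n + ln (action n 0)" using elim(2) z by (smt (verit))
      then have "exp (ln (action n z)) \<le> exp (Ct / real n + ln (action n 0))" by simp
      then have "action n z \<le> exp (Ct / real n) * action n 0"
        using action_pos[OF p(1)] action_pos[OF p(2)] by (simp add: exp_add)
      then show "action n z \<le> 1" using elim(1) by simp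
    qed
  qed
  define W where "W n = hermite_fun n (x n) * hermite_fun_deriv n (y n) - hermite_fun_deriv n (x n) * hermite_fun n (y n)" for n
  define S where "S n = action n (x n) * sin (sqrt (potential n (x n)) * (x n - y n))" for n
  have nz: "\<forall>\<^sub>F n in sequentially. D n \<noteq> 0" using tendsto_imp_eventually_ne[OF D \<delta>] .
  have S: "(\<lambda>n. S n / D n) \<longlonglongrightarrow> sqrt (2 / pi) * sin (w * \<delta>) / \<delta>"
  proof -
    have "(\<lambda>n. action n (x n) * sin (sqrt (potential n (x n)) / sqrt (real n) * D n) / D n)
      \<longlonglongrightarrow> sqrt (2 / pi) * sin (w * \<delta>) / \<delta>"
      unfolding w_def
      by (intro tendsto_intros action_tendsto[OF a(1,2) evx] sqrt_potential_tendsto[OF x] D \<delta>)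
    moreover have "\<forall>\<^sub>F n in sequentially. action n (x n) * sin (sqrt (potential n (x n)) / sqrt (real n) * D n) / D n = S n / D n"
      using eventually_gt_at_top[of 0] by eventually_elim (simp add: S_def D_def)
    ultimately show ?thesis by (rule Lim_transform_eventually)
  qed
  have W: "(\<lambda>n. (W n - S n) / D n) \<longlonglongrightarrow> 0"
  proof (rule Lim_null_comparison)
    have "(\<lambda>n. (C * \<bar>D n\<bar> + C') * (1 / real n)) \<longlonglongrightarrow> (C * \<bar>\<delta>\<bar> + C') * 0" by (intro tendsto_intros D inv)
    then show "(\<lambda>n. (C * \<bar>D n\<bar> + C') * (1 / real n)) \<longlonglongrightarrow> 0" by simp
    show "\<forall>\<^sub>F n in sequentially. norm ((W n - S n) / D n) \<le> (C * \<bar>D n\<bar> + C') * (1 / real n)"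
      using E evx evy nz eventually_ge_at_top[of 1]
    proof eventually_elim
      case (elim n)
      define q where "q = sqrt (real n)"
      have q: "q > 0" "real n = q * q" using elim(5) by (simp_all add: q_def)
      define e where "e = \<bar>x n - y n\<bar>"
      have De: "\<bar>D n\<bar> = q * e" using q(1) by (simp add: D_def q_def[symmetric] e_def abs_mult)
      have "x n - y n \<noteq> 0" using elim(4) by (auto simp: D_def)
      then have e: "e > 0" by (simp add: e_def)
      have "\<bar>W n - S n\<bar> \<le> C * (x n - y n)\<^sup>2 + C' * \<bar>x n - y n\<bar> / sqrt (real n)"
        unfolding W_def S_def C_def C'_def
        by (rule wronskian_estimate[OF a(1,2) s_def elim(5) _ elim(2,3)]) (use elim(1) in auto)
      also have "\<dots> = C * e\<^sup>2 + C' * e / q" by (simp add: e_def q_def)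
      finally have "norm ((W n - S n) / D n) \<le> (C * e\<^sup>2 + C' * e / q) / (q * e)"
        unfolding real_norm_def abs_divide De using q e by (intro divide_right_mono) auto
      also have "\<dots> = (C * \<bar>D n\<bar> + C') * (1 / real n)"
        unfolding De q(2) using q(1) e by (simp add: field_simps power2_eq_square)
      finally show ?case .
    qed
  qed
  have H: "(\<lambda>n. hermite_fun n (x n) * hermite_fun n (y n) / sqrt (real n)) \<longlonglongrightarrow> 0"
  proof (rule Lim_null_comparison)
    have "(\<lambda>n. (hermite_fun n (x n))\<^sup>2 / sqrt (real n) + (hermite_fun n (y n))\<^sup>2 / sqrt (real n)) \<longlonglongrightarrow> 0 + 0"
      by (intro tendsto_add hermite_fun_sq_tendsto[OF a(1,2)] evx evy)
    then show "(\<lambda>n. (hermite_fun n (x n))\<^sup>2 / sqrt (real n) + (hermite_fun n (y n))\<^sup>2 / sqrt (real n)) \<longlonglongrightarrow> 0" by simp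
    have "\<bar>u * v\<bar> \<le> u\<^sup>2 + v\<^sup>2" for u v :: real
      using sum_squares_bound[of "\<bar>u\<bar>" "\<bar>v\<bar>"] mult_nonneg_nonneg[of "\<bar>u\<bar>" "\<bar>v\<bar>"]
      unfolding abs_mult power2_abs by linarith
    then have "norm (hermite_fun n (x n) * hermite_fun n (y n) / sqrt (real n)) \<le>
      (hermite_fun n (x n))\<^sup>2 / sqrt (real n) + (hermite_fun n (y n))\<^sup>2 / sqrt (real n)" for n
      unfolding real_norm_def abs_divide add_divide_distrib[symmetric] by (simp add: divide_right_mono)
    then show "\<forall>\<^sub>F n in sequentially. norm (hermite_fun n (x n) * hermite_fun n (y n) / sqrt (real n)) \<le>
      (hermite_fun n (x n))\<^sup>2 / sqrt (real n) + (hermite_fun n (y n))\<^sup>2 / sqrt (real n)" by simp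
  qed
  have "(\<lambda>n. hermite_fun n (x n) * hermite_fun n (y n) / sqrt (real n) / 2 + ((W n - S n) / D n + S n / D n))
    \<longlonglongrightarrow> 0 / 2 + (0 + sqrt (2 / pi) * sin (w * \<delta>) / \<delta>)"
    by (intro tendsto_intros H W S) simp
  moreover have "\<forall>\<^sub>F n in sequentially. hermite_fun n (x n) * hermite_fun n (y n) / sqrt (real n) / 2 +
      ((W n - S n) / D n + S n / D n) = gauss_kernel n (x n) (y n) / sqrt (real n)"
    using nz eventually_gt_at_top[of 0]
  proof eventually_elim
    case (elim n)
    define q where "q = sqrt (real n)"
    have q: "q > 0" using elim by (simp add: q_def)
    have xy: "x n - y n \<noteq> 0" using elim by (auto simp: D_def)
    have "gauss_kernel n (x n) (y n) = hermite_fun n (x n) * hermite_fun n (y n) / 2 + W n / (x n - y n)"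
      using gauss_kernel_eq[of "x n" "y n" n] xy unfolding W_def[symmetric] by (simp add: field_simps)
    then have "gauss_kernel n (x n) (y n) / q = hermite_fun n (x n) * hermite_fun n (y n) / q / 2 + W n / D n"
      by (simp add: add_divide_distrib D_def q_def mult.commute)
    then show ?case by (simp add: q_def diff_divide_distrib)
  qed
  ultimately show ?thesis by (simp add: tendsto_cong w_def)
qed

section \<open>The exact correlation function of a Wigner matrix\<close>

lemma integrable_lower_powers:
  assumes Q: "real_distribution Q" and i4: "integrable Q (\<lambda>x. x ^ 4)" and k: "k \<le> 4"
  shows "integrable Q (\<lambda>x. x ^ k)"
proof -
  interpret real_distribution Q by fact
  show ?thesis
  proof (rule Bochner_Integration.integrable_bound)
    show "integrable Q (\<lambda>x. 1 + x ^ 4)" using i4 by simp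
    show "(\<lambda>x. x ^ k) \<in> borel_measurable Q" by measurable
    have "\<bar>x\<bar> ^ k \<le> 1 + \<bar>x\<bar> ^ 4" for x :: real
    proof (cases "\<bar>x\<bar> \<le> 1")
      case True
      then have "\<bar>x\<bar> ^ k \<le> 1" by (intro power_le_one) auto
      then show ?thesis using zero_le_power[of "\<bar>x\<bar>" 4] by linarith
    next
      case False
      then have "\<bar>x\<bar> ^ k \<le> \<bar>x\<bar> ^ 4" using k by (intro power_increasing) auto
      then show ?thesis by linarith
    qed
    then show "AE x in Q. norm (x ^ k) \<le> norm (1 + x ^ 4)"
      by (simp add: power_abs)
  qed
qed

text \<open>A block is a diagonal position \<open>(i, i)\<close> or a position \<open>(i, j)\<close> above the diagonal, standing for the two
entries at \<open>(i, j)\<close> and \<open>(j, i)\<close>. Distinct blocks use disjoint sets of the underlying real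
variables, so they are independent, whereas the entries are not.\<close>

definition wigner_blocks :: "nat set \<Rightarrow> (nat \<times> nat) set" where
  "wigner_blocks S = (\<lambda>i. (i, i)) ` S \<union> pairs_below S"

definition block_indices :: "nat \<times> nat \<Rightarrow> wigner_index set" where
  "block_indices = (\<lambda>(i, j). if i = j then {Diag i} else {RePart i j, ImPart i j})"

text \<open>The upper entry of a block. The factor \<open>sqrt 2\<close> undoes the normalisation of the diagonal in
\<open>wigner_var\<close>.\<close>

definition block_value :: "nat \<times> nat \<Rightarrow> (wigner_index \<Rightarrow> real) \<Rightarrow> complex" where
  "block_value = (\<lambda>(i, j) f. if i = j then complex_of_real (sqrt 2 * f (Diag i))
     else complex_of_real (f (RePart i j)) + \<i> * complex_of_real (f (ImPart i j)))"

text \<open>What a block contributes to the term of \<open>\<sigma>\<close> in the Leibniz expansion of the determinant with shift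
\<open>\<mu>\<close>, as a function of its upper entry \<open>z\<close>.\<close>

definition block_factor :: "real \<Rightarrow> (nat \<Rightarrow> nat) \<Rightarrow> nat \<times> nat \<Rightarrow> complex \<Rightarrow> complex" where
  "block_factor \<mu> \<sigma> = (\<lambda>(i, j) z. if i = j then (if \<sigma> i = i then z - complex_of_real \<mu> else 1)
     else (if \<sigma> i = j then z else 1) * (if \<sigma> j = i then cnj z else 1))"

lemma disjoint_block_indices: "disjoint_family_on block_indices (wigner_blocks S)"
  by (auto simp: disjoint_family_on_def block_indices_def wigner_blocks_def pairs_below_def split: if_splits)

lemma block_indices_subset: "u \<in> wigner_blocks S \<Longrightarrow> block_indices u \<subseteq> wigner_indices"
  by (auto simp: block_indices_def wigner_blocks_def pairs_below_def wigner_indices_def)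

lemma finite_wigner_blocks: "finite S \<Longrightarrow> finite (wigner_blocks S)"
  by (simp add: wigner_blocks_def finite_pairs_below)

lemma prod_wigner_blocks:
  assumes "finite S"
  shows "(\<Prod>u\<in>wigner_blocks S. g u) = (\<Prod>i\<in>S. g (i, i)) * (\<Prod>u\<in>pairs_below S. g u)"
proof -
  have "(\<Prod>u\<in>wigner_blocks S. g u) = (\<Prod>u\<in>(\<lambda>i. (i, i)) ` S. g u) * (\<Prod>u\<in>pairs_below S. g u)"
    unfolding wigner_blocks_def
    by (rule prod.union_disjoint) (use assms finite_pairs_below in \<open>auto simp: pairs_below_def\<close>)
  then show ?thesis by (subst (asm) prod.reindex) (auto simp: inj_on_def)
qed

lemma measurable_block_value [measurable]:
  assumes "K = block_indices u"
  shows "block_value u \<in> borel_measurable (PiM K (\<lambda>_. borel))"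
proof (cases u)
  case (Pair i j)
  show ?thesis
  proof (cases "i = j")
    case True
    have [measurable]: "(\<lambda>f. f (Diag i)) \<in> borel_measurable (PiM K (\<lambda>_. borel))"
      using assms Pair True by (intro measurable_component_singleton) (simp add: block_indices_def)
    show ?thesis unfolding Pair block_value_def prod.case if_P[OF True] by measurable
  next
    case False
    have [measurable]: "(\<lambda>f. f (RePart i j)) \<in> borel_measurable (PiM K (\<lambda>_. borel))"
       "(\<lambda>f. f (ImPart i j)) \<in> borel_measurable (PiM K (\<lambda>_. borel))"
      using assms Pair False by (intro measurable_component_singleton; simp add: block_indices_def)+
    show ?thesis unfolding Pair block_value_def prod.case if_not_P[OF False] by measurable
  qed
qed

lemma measurable_block_factor [measurable]: "block_factor \<mu> \<sigma> u \<in> borel_measurable borel"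
proof (cases u)
  case (Pair i j)
  have [measurable]: "cnj \<in> borel_measurable borel"
    by (intro borel_measurable_continuous_onI continuous_intros)
  show ?thesis unfolding Pair block_factor_def prod.case by measurable
qed

context wigner_family
begin

abbreviation X where "X \<equiv> wigner_var Xd Xre Xim"

abbreviation Z where "Z u \<omega> \<equiv> block_value u (\<lambda>k. X k \<omega>)"

lemma measurable_X: "k \<in> wigner_indices \<Longrightarrow> X k \<in> borel_measurable M"
  using indep by (auto simp: indep_vars_def)

lemma integral_X:
  fixes g :: "real \<Rightarrow> 'b :: {banach, second_countable_topology}"
  assumes "k \<in> wigner_indices" "g \<in> borel_measurable borel"
  shows "(\<integral>\<omega>. g (X k \<omega>) \<partial>M) = (\<integral>x. g x \<partial>Q)"
  using distr_eq[OF assms(1)] integral_distr[OF measurable_X[OF assms(1)] assms(2)] by simp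

lemma integrable_X:
  fixes g :: "real \<Rightarrow> 'b :: {banach, second_countable_topology}"
  assumes "k \<in> wigner_indices" "g \<in> borel_measurable borel"
  shows "integrable M (\<lambda>\<omega>. g (X k \<omega>)) \<longleftrightarrow> integrable Q g"
  using distr_eq[OF assms(1)] integrable_distr_eq[OF measurable_X[OF assms(1)] assms(2)] by simp

lemma block_value_restrict:
  "u \<in> wigner_blocks S \<Longrightarrow> block_value u (restrict f (block_indices u)) = block_value u f"
  by (auto simp: block_value_def block_indices_def wigner_blocks_def pairs_below_def)

lemma indep_blocks:
  assumes "\<And>u. g u \<in> borel_measurable (borel :: complex measure)"
  shows "indep_vars (\<lambda>_. borel) (\<lambda>u \<omega>. g u (Z u \<omega>)) (wigner_blocks S)"
proof -
  have "indep_vars (\<lambda>u. PiM (block_indices u) (\<lambda>_. borel))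
      (\<lambda>u \<omega>. restrict (\<lambda>k. X k \<omega>) (block_indices u)) (wigner_blocks S)"
    by (rule indep_vars_restrict[OF indep block_indices_subset disjoint_block_indices])
  then have "indep_vars (\<lambda>_. borel) (\<lambda>u \<omega>. g u (block_value u (restrict (\<lambda>k. X k \<omega>) (block_indices u))))
      (wigner_blocks S)"
    by (rule indep_vars_compose2) (use assms in measurable)
  then show ?thesis
    by (rule indep_vars_cong[THEN iffD1, rotated -1]) (auto simp: block_value_restrict)
qed

lemma wigner_entry_blocks:
  "wigner_entry Xd Xre Xim i j \<omega> = (if i \<le> j then Z (i, j) \<omega> else cnj (Z (j, i) \<omega>))"
  by (auto simp: wigner_entry_def block_value_def)

lemma det_wigner_matrix:
  "Determinant.det (wigner_matrix Xd Xre Xim N \<omega> - complex_of_real \<mu> \<cdot>\<^sub>m 1\<^sub>m N) =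
    (\<Sum>\<sigma> | \<sigma> permutes {0..<N}. of_int (sign \<sigma>) *
      (\<Prod>u\<in>wigner_blocks {0..<N}. block_factor \<mu> \<sigma> u (Z u \<omega>)))"
proof -
  define A where "A i j = wigner_entry Xd Xre Xim i j \<omega> - complex_of_real \<mu> * (if i = j then 1 else 0)" for i j
  let ?A = "wigner_matrix Xd Xre Xim N \<omega> - complex_of_real \<mu> \<cdot>\<^sub>m 1\<^sub>m N"
  have "Determinant.det ?A = (\<Sum>\<sigma> | \<sigma> permutes {0..<N}. of_int (sign \<sigma>) * (\<Prod>i = 0..<N. ?A $$ (i, \<sigma> i)))"
    by (rule det_def') (auto intro!: minus_carrier_mat smult_carrier_mat)
  also have "\<dots> = (\<Sum>\<sigma> | \<sigma> permutes {0..<N}. of_int (sign \<sigma>) *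
      (\<Prod>u\<in>wigner_blocks {0..<N}. block_factor \<mu> \<sigma> u (Z u \<omega>)))"
  proof (rule sum.cong[OF refl], clarify)
    fix \<sigma> assume p: "\<sigma> permutes {0..<N}"
    have "(\<Prod>i = 0..<N. ?A $$ (i, \<sigma> i)) = (\<Prod>i = 0..<N. A i (\<sigma> i))"
    proof (rule prod.cong[OF refl])
      fix i assume i: "i \<in> {0..<N}"
      then have "\<sigma> i \<in> {0..<N}" using p by (simp add: permutes_in_image del: atLeastLessThan_iff)
      then show "?A $$ (i, \<sigma> i) = A i (\<sigma> i)" using i by (auto simp: wigner_matrix_def A_def)
    qed
    also have "\<dots> = (\<Prod>i = 0..<N. if \<sigma> i = i then A i i else 1) *
       (\<Prod>(i, j)\<in>pairs_below {0..<N}. (if \<sigma> i = j then A i j else 1) * (if \<sigma> j = i then A j i else 1))"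
      by (rule prod_permutation_upper_triangle[OF _ p]) simp
    also have "\<dots> = (\<Prod>u\<in>wigner_blocks {0..<N}. block_factor \<mu> \<sigma> u (Z u \<omega>))"
      unfolding prod_wigner_blocks[OF finite_atLeastLessThan]
      by (intro arg_cong2[of _ _ _ _ "(*)"] prod.cong refl)
         (auto simp: block_factor_def A_def wigner_entry_blocks pairs_below_def)
    finally show "of_int (sign \<sigma>) * (\<Prod>i = 0..<N. ?A $$ (i, \<sigma> i)) =
      of_int (sign \<sigma>) * (\<Prod>u\<in>wigner_blocks {0..<N}. block_factor \<mu> \<sigma> u (Z u \<omega>))" by simp
  qed
  finally show ?thesis .
qed

end

locale wigner_moments = wigner_family +
  assumes Q: "real_distribution Q" and Q4: "integrable Q (\<lambda>x. x ^ 4)"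
    and Q1: "(\<integral>x. x \<partial>Q) = 0" and Q2: "(\<integral>x. x\<^sup>2 \<partial>Q) = 1 / 2"
begin

lemma integrable_power_X:
  assumes "k \<in> wigner_indices" "n \<le> 4"
  shows "integrable M (\<lambda>\<omega>. X k \<omega> ^ n)"
  by (subst integrable_X[OF assms(1)]) (use integrable_lower_powers[OF Q Q4 assms(2)] in auto)

lemma moments_X:
  assumes "k \<in> wigner_indices"
  shows "expectation (X k) = 0" "expectation (\<lambda>\<omega>. (X k \<omega>)\<^sup>2) = 1 / 2"
    "expectation (\<lambda>\<omega>. X k \<omega> ^ 4) = (\<integral>x. x ^ 4 \<partial>Q)"
  using integral_X[OF assms, of "\<lambda>x. x"] integral_X[OF assms, of "\<lambda>x. x\<^sup>2"] integral_X[OF assms, of "\<lambda>x. x ^ 4"]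
  by (auto simp: Q1 Q2)

lemma mixed_moments:
  assumes ij: "i < j" and mn: "m \<le> 4" "n \<le> 4"
  shows "integrable M (\<lambda>\<omega>. X (RePart i j) \<omega> ^ m * X (ImPart i j) \<omega> ^ n)"
    "expectation (\<lambda>\<omega>. X (RePart i j) \<omega> ^ m * X (ImPart i j) \<omega> ^ n) =
      expectation (\<lambda>\<omega>. X (RePart i j) \<omega> ^ m) * expectation (\<lambda>\<omega>. X (ImPart i j) \<omega> ^ n)"
proof -
  let ?I = "{RePart i j, ImPart i j}"
  define e where "e k = (case k of RePart _ _ \<Rightarrow> m | _ \<Rightarrow> n)" for k
  have mem: "RePart i j \<in> wigner_indices" "ImPart i j \<in> wigner_indices"
    using ij by (auto simp: wigner_indices_def)
  have ind: "indep_vars (\<lambda>_. borel) (\<lambda>k \<omega>. X k \<omega> ^ e k) ?I"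
    by (rule indep_vars_compose2[OF indep_vars_subset[OF indep]]) (use mem in auto)
  have int: "integrable M (\<lambda>\<omega>. X k \<omega> ^ e k)" if "k \<in> ?I" for k
    using that mem mn by (auto simp: e_def intro: integrable_power_X)
  show "integrable M (\<lambda>\<omega>. X (RePart i j) \<omega> ^ m * X (ImPart i j) \<omega> ^ n)"
    using indep_vars_integrable[OF _ ind int] by (simp add: e_def)
  show "expectation (\<lambda>\<omega>. X (RePart i j) \<omega> ^ m * X (ImPart i j) \<omega> ^ n) =
      expectation (\<lambda>\<omega>. X (RePart i j) \<omega> ^ m) * expectation (\<lambda>\<omega>. X (ImPart i j) \<omega> ^ n)"
    using indep_vars_lebesgue_integral[OF _ ind int] by (simp add: e_def)
qed

text \<open>The real and imaginary parts are independent with variance \<open>1/2\<close>, so \<open>E Z\<^sup>2 = 1/2 - 1/2 = 0\<close> and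
\<open>E |Z|^4 = 2 b + 2 (1/2)\<^sup>2\<close>.\<close>

lemma block_moments:
  assumes ij: "i < j"
  shows "expectation (\<lambda>\<omega>. Z (i, j) \<omega>) = 0"
    "expectation (\<lambda>\<omega>. Z (i, j) \<omega> * Z (i, j) \<omega>) = 0"
    "expectation (\<lambda>\<omega>. Z (i, j) \<omega> * cnj (Z (i, j) \<omega>)) = 1"
    "expectation (\<lambda>\<omega>. Z (i, j) \<omega> * cnj (Z (i, j) \<omega>) * (Z (i, j) \<omega> * cnj (Z (i, j) \<omega>))) =
      complex_of_real (2 * (\<integral>x. x ^ 4 \<partial>Q) + 1 / 2)"
proof -
  let ?R = "\<lambda>\<omega>. X (RePart i j) \<omega>" and ?I = "\<lambda>\<omega>. X (ImPart i j) \<omega>"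
  have mem: "RePart i j \<in> wigner_indices" "ImPart i j \<in> wigner_indices"
    using ij by (auto simp: wigner_indices_def)
  note mR = moments_X[OF mem(1)] and mI = moments_X[OF mem(2)]
  have Zeq: "Z (i, j) \<omega> = Complex (?R \<omega>) (?I \<omega>)" for \<omega>
    using ij by (simp add: block_value_def complex_eq_iff)
  have int: "integrable M (\<lambda>\<omega>. ?R \<omega> ^ m * ?I \<omega> ^ n)" if "m \<le> 4" "n \<le> 4" for m n
    by (rule mixed_moments[OF ij that])
  have ex: "expectation (\<lambda>\<omega>. ?R \<omega> ^ m * ?I \<omega> ^ n) = expectation (\<lambda>\<omega>. ?R \<omega> ^ m) * expectation (\<lambda>\<omega>. ?I \<omega> ^ n)"
    if "m \<le> 4" "n \<le> 4" for m n
    by (rule mixed_moments[OF ij that])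
  have iC: "integrable M (\<lambda>\<omega>. Complex (f \<omega>) (g \<omega>))" "expectation (\<lambda>\<omega>. Complex (f \<omega>) (g \<omega>)) = Complex (expectation f) (expectation g)"
    if "integrable M f" "integrable M g" for f g
    using that by (simp_all add: Complex_eq)
  show "expectation (\<lambda>\<omega>. Z (i, j) \<omega>) = 0"
    unfolding Zeq by (subst iC(2)) (use int[of 1 0] int[of 0 1] mR mI in \<open>auto simp: complex_eq_iff simp del: wigner_var.simps\<close>)
  have "expectation (\<lambda>\<omega>. Z (i, j) \<omega> * Z (i, j) \<omega>) =
    expectation (\<lambda>\<omega>. Complex (?R \<omega> ^ 2 - ?I \<omega> ^ 2) (2 * (?R \<omega> ^ 1 * ?I \<omega> ^ 1)))"
    by (rule Bochner_Integration.integral_cong) (auto simp: Zeq complex_eq_iff power2_eq_square)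
  also have "\<dots> = 0"
    by (subst iC(2)) (use int[of 2 0] int[of 0 2] int[of 1 1] ex[of 1 1] mR mI in \<open>auto simp: complex_eq_iff simp del: wigner_var.simps\<close>)
  finally show "expectation (\<lambda>\<omega>. Z (i, j) \<omega> * Z (i, j) \<omega>) = 0" .
  have "expectation (\<lambda>\<omega>. Z (i, j) \<omega> * cnj (Z (i, j) \<omega>)) = expectation (\<lambda>\<omega>. complex_of_real (?R \<omega> ^ 2 + ?I \<omega> ^ 2))"
    by (rule Bochner_Integration.integral_cong) (auto simp: Zeq complex_eq_iff power2_eq_square)
  also have "\<dots> = complex_of_real (expectation (\<lambda>\<omega>. ?R \<omega> ^ 2 + ?I \<omega> ^ 2))"
    by (rule integral_complex_of_real)
  also have "expectation (\<lambda>\<omega>. ?R \<omega> ^ 2 + ?I \<omega> ^ 2) = 1"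
    using int[of 2 0] int[of 0 2] mR mI by (simp del: wigner_var.simps)
  finally show "expectation (\<lambda>\<omega>. Z (i, j) \<omega> * cnj (Z (i, j) \<omega>)) = 1" by simp
  have "expectation (\<lambda>\<omega>. Z (i, j) \<omega> * cnj (Z (i, j) \<omega>) * (Z (i, j) \<omega> * cnj (Z (i, j) \<omega>))) =
    expectation (\<lambda>\<omega>. complex_of_real (?R \<omega> ^ 4 + ?I \<omega> ^ 4 + 2 * (?R \<omega> ^ 2 * ?I \<omega> ^ 2)))"
    by (rule Bochner_Integration.integral_cong)
       (auto simp: Zeq complex_eq_iff power2_eq_square power4_eq_xxxx algebra_simps)
  also have "\<dots> = complex_of_real (expectation (\<lambda>\<omega>. ?R \<omega> ^ 4 + ?I \<omega> ^ 4 + 2 * (?R \<omega> ^ 2 * ?I \<omega> ^ 2)))"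
    by (rule integral_complex_of_real)
  also have "expectation (\<lambda>\<omega>. ?R \<omega> ^ 4 + ?I \<omega> ^ 4 + 2 * (?R \<omega> ^ 2 * ?I \<omega> ^ 2)) = 2 * (\<integral>x. x ^ 4 \<partial>Q) + 1 / 2"
    using int[of 4 0] int[of 0 4] int[of 2 2] ex[of 2 2] mR mI by (simp del: wigner_var.simps)
  finally show "expectation (\<lambda>\<omega>. Z (i, j) \<omega> * cnj (Z (i, j) \<omega>) * (Z (i, j) \<omega> * cnj (Z (i, j) \<omega>))) =
      complex_of_real (2 * (\<integral>x. x ^ 4 \<partial>Q) + 1 / 2)" .
qed


text \<open>Two determinants use each entry of a block at most twice, so the product grows at most like \<open>1 + |Z|^4\<close>.\<close>

lemma integrable_block_pair:
  assumes u: "u \<in> wigner_blocks S"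
  shows "integrable M (\<lambda>\<omega>. block_factor \<mu> \<sigma> u (Z u \<omega>) * block_factor \<nu> \<tau> u (Z u \<omega>))"
proof -
  obtain i j where ij: "u = (i, j)" by (cases u)
  have meas: "(\<lambda>\<omega>. Z u \<omega>) \<in> borel_measurable M"
    using indep_blocks[of "\<lambda>_ z. z" S] u by (auto simp: indep_vars_def)
  show ?thesis
  proof (cases "i = j")
    case True
    have mem: "Diag i \<in> wigner_indices" by (simp add: wigner_indices_def)
    have "integrable M (X (Diag i))" "integrable M (\<lambda>\<omega>. (X (Diag i) \<omega>)\<^sup>2)"
      using integrable_power_X[OF mem, of 1] integrable_power_X[OF mem, of 2] by (simp_all del: wigner_var.simps)
    then have "integrable M (\<lambda>\<omega>. complex_of_real (sqrt 2 * X (Diag i) \<omega>))"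
      "integrable M (\<lambda>\<omega>. complex_of_real ((sqrt 2 * X (Diag i) \<omega>)\<^sup>2))"
      by (simp_all add: power_mult_distrib del: wigner_var.simps of_real_mult of_real_power)
    then have i1: "integrable M (\<lambda>\<omega>. Z u \<omega>)" and i2: "integrable M (\<lambda>\<omega>. Z u \<omega> * Z u \<omega>)"
      by (simp_all add: ij True block_value_def power2_eq_square del: wigner_var.simps)
    have *: "integrable M (\<lambda>\<omega>. (if s then Z u \<omega> - m else 1) * (if t then Z u \<omega> - n else 1))" for s t m n
      using i1 i2 by (cases s; cases t) (simp_all add: algebra_simps)
    show ?thesis using *[of "\<sigma> i = i" "complex_of_real \<mu>" "\<tau> i = i" "complex_of_real \<nu>"]
      unfolding ij True by (simp add: block_factor_def)
  next
    case False
    then have lt: "i < j" using u ij by (auto simp: wigner_blocks_def pairs_below_def)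
    show ?thesis
    proof (rule Bochner_Integration.integrable_bound)
      show "integrable M (\<lambda>\<omega>. 1 + (X (RePart i j) \<omega> ^ 4 * X (ImPart i j) \<omega> ^ 0 + X (RePart i j) \<omega> ^ 0 * X (ImPart i j) \<omega> ^ 4
         + 2 * (X (RePart i j) \<omega> ^ 2 * X (ImPart i j) \<omega> ^ 2)))"
        using mixed_moments(1)[OF lt, of 4 0] mixed_moments(1)[OF lt, of 0 4] mixed_moments(1)[OF lt, of 2 2]
        by (intro Bochner_Integration.integrable_add integrable_mult_right) (auto simp del: wigner_var.simps)
      show "(\<lambda>\<omega>. block_factor \<mu> \<sigma> u (Z u \<omega>) * block_factor \<nu> \<tau> u (Z u \<omega>)) \<in> borel_measurable M"
        using meas by measurable
      have bound: "cmod (block_factor \<mu> \<sigma> u z * block_factor \<nu> \<tau> u z) \<le> 1 + ((Re z)\<^sup>2 + (Im z)\<^sup>2)\<^sup>2" for z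
      proof -
        \<comment> \<open>Each of the four factors of the product is \<open>1\<close>, \<open>z\<close> or \<open>cnj z\<close>.\<close>
        define m where "m = max 1 (cmod z)"
        have m: "1 \<le> m" "cmod z \<le> m" by (simp_all add: m_def)
        have f: "cmod (block_factor \<mu> \<sigma> u z) \<le> m * m" for \<mu> \<sigma>
          using m False mult_mono[of 1 m 1 m] mult_mono[of "cmod z" m 1 m] mult_mono[of "cmod z" m "cmod z" m]
          by (auto simp: ij block_factor_def norm_mult)
        have "cmod (block_factor \<mu> \<sigma> u z * block_factor \<nu> \<tau> u z) \<le> (m * m) * (m * m)"
          unfolding norm_mult using f m by (intro mult_mono) auto
        also have "\<dots> \<le> 1 + cmod z ^ 4"
          by (cases "cmod z \<le> 1") (auto simp: m_def max_def power4_eq_xxxx mult.assoc)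
        also have "cmod z ^ 4 = ((Re z)\<^sup>2 + (Im z)\<^sup>2)\<^sup>2"
          unfolding cmod_power2[symmetric] by simp
        finally show ?thesis .
      qed
      have "Re (Z u \<omega>) = X (RePart i j) \<omega>" "Im (Z u \<omega>) = X (ImPart i j) \<omega>" for \<omega>
        using lt by (simp_all add: ij block_value_def)
      then have le: "cmod (block_factor \<mu> \<sigma> u (Z u \<omega>) * block_factor \<nu> \<tau> u (Z u \<omega>)) \<le> 1 + ((X (RePart i j) \<omega>)\<^sup>2 + (X (ImPart i j) \<omega>)\<^sup>2)\<^sup>2" for \<omega>
        using bound[of "Z u \<omega>"] by (simp del: wigner_var.simps)
      have expand: "((X (RePart i j) \<omega>)\<^sup>2 + (X (ImPart i j) \<omega>)\<^sup>2)\<^sup>2 =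
        X (RePart i j) \<omega> ^ 4 * X (ImPart i j) \<omega> ^ 0 + X (RePart i j) \<omega> ^ 0 * X (ImPart i j) \<omega> ^ 4
         + 2 * (X (RePart i j) \<omega> ^ 2 * X (ImPart i j) \<omega> ^ 2)" for \<omega>
        by (simp add: power2_sum power_mult[symmetric] del: wigner_var.simps)
      show "AE \<omega> in M. norm (block_factor \<mu> \<sigma> u (Z u \<omega>) * block_factor \<nu> \<tau> u (Z u \<omega>)) \<le>
        norm (1 + (X (RePart i j) \<omega> ^ 4 * X (ImPart i j) \<omega> ^ 0 + X (RePart i j) \<omega> ^ 0 * X (ImPart i j) \<omega> ^ 4
         + 2 * (X (RePart i j) \<omega> ^ 2 * X (ImPart i j) \<omega> ^ 2)))"
        unfolding real_norm_def by (intro AE_I2 order_trans[OF le[unfolded expand] abs_ge_self])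
    qed
  qed
qed

definition block_pair_mean where
  "block_pair_mean \<mu> \<nu> \<sigma> \<tau> u = expectation (\<lambda>\<omega>. block_factor \<mu> \<sigma> u (Z u \<omega>) * block_factor \<nu> \<tau> u (Z u \<omega>))"

lemma block_pair_mean_diag:
  "block_pair_mean \<mu> \<nu> \<sigma> \<tau> (i, i) = complex_of_real (diag_weight \<mu> \<nu> (\<sigma> i = i) (\<tau> i = i))"
proof -
  have mem: "Diag i \<in> wigner_indices" by (simp add: wigner_indices_def)
  let ?X = "\<lambda>\<omega>. X (Diag i) \<omega>"
  have int: "integrable M ?X" "integrable M (\<lambda>\<omega>. (?X \<omega>)\<^sup>2)"
    using integrable_power_X[OF mem, of 1] integrable_power_X[OF mem, of 2] by (simp_all del: wigner_var.simps)
  note m = moments_X[OF mem]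
  have "block_pair_mean \<mu> \<nu> \<sigma> \<tau> (i, i) = expectation (\<lambda>\<omega>. complex_of_real
     ((if \<sigma> i = i then sqrt 2 * ?X \<omega> - \<mu> else 1) * (if \<tau> i = i then sqrt 2 * ?X \<omega> - \<nu> else 1)))"
    unfolding block_pair_mean_def
    by (rule Bochner_Integration.integral_cong) (auto simp: block_factor_def block_value_def simp del: wigner_var.simps)
  also have "\<dots> = complex_of_real (expectation (\<lambda>\<omega>.
     (if \<sigma> i = i then sqrt 2 * ?X \<omega> - \<mu> else 1) * (if \<tau> i = i then sqrt 2 * ?X \<omega> - \<nu> else 1)))"
    by (rule integral_complex_of_real)
  also have "expectation (\<lambda>\<omega>. (if \<sigma> i = i then sqrt 2 * ?X \<omega> - \<mu> else 1) * (if \<tau> i = i then sqrt 2 * ?X \<omega> - \<nu> else 1))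
     = diag_weight \<mu> \<nu> (\<sigma> i = i) (\<tau> i = i)"
  proof (cases "\<sigma> i = i \<and> \<tau> i = i")
    case True
    have "(sqrt 2 * ?X \<omega> - \<mu>) * (sqrt 2 * ?X \<omega> - \<nu>) = 2 * (?X \<omega>)\<^sup>2 - sqrt 2 * (\<mu> + \<nu>) * ?X \<omega> + \<mu> * \<nu>" for \<omega>
      by (simp add: algebra_simps power2_eq_square del: wigner_var.simps)
    then show ?thesis using True int m by (simp add: diag_weight_def prob_space del: wigner_var.simps)
  next
    case False
    then show ?thesis using int m by (auto simp: diag_weight_def prob_space simp del: wigner_var.simps)
  qed
  finally show ?thesis .
qed

lemma block_pair_mean_unmatched:
  assumes u: "(i, j) \<in> pairs_below S"
    and "((\<sigma> i = j \<or> \<tau> i = j) \<and> \<sigma> j \<noteq> i \<and> \<tau> j \<noteq> i) \<or> ((\<sigma> j = i \<or> \<tau> j = i) \<and> \<sigma> i \<noteq> j \<and> \<tau> i \<noteq> j)"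
  shows "block_pair_mean \<mu> \<nu> \<sigma> \<tau> (i, j) = 0"
proof -
  have ij: "i < j" using u by (simp add: pairs_below_def)
  have cnj: "expectation (\<lambda>\<omega>. cnj (f \<omega>)) = cnj (expectation f)" for f by (rule Bochner_Integration.integral_cnj)
  have "expectation (\<lambda>\<omega>. cnj (Z (i, j) \<omega>)) = 0"
    "expectation (\<lambda>\<omega>. cnj (Z (i, j) \<omega>) * cnj (Z (i, j) \<omega>)) = 0"
    unfolding complex_cnj_mult[symmetric] cnj using block_moments[OF ij] by simp_all
  then have "expectation (\<lambda>\<omega>. ((if p then Z (i, j) \<omega> else 1) * (if q then cnj (Z (i, j) \<omega>) else 1)) *
      ((if r then Z (i, j) \<omega> else 1) * (if s then cnj (Z (i, j) \<omega>) else 1))) = 0"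
    if "((p \<or> r) \<and> \<not> q \<and> \<not> s) \<or> ((q \<or> s) \<and> \<not> p \<and> \<not> r)" for p q r s
    using that block_moments(1,2)[OF ij] by (cases p; cases q; cases r; cases s) simp_all
  from this[OF assms(2)] show ?thesis using ij by (simp add: block_pair_mean_def block_factor_def)
qed

lemma block_pair_mean_matched:
  assumes u: "(i, j) \<in> pairs_below S"
    and "of_bool (\<sigma> i = j) + of_bool (\<tau> i = j) = (of_bool (\<sigma> j = i) + of_bool (\<tau> j = i) :: nat)"
  shows "block_pair_mean \<mu> \<nu> \<sigma> \<tau> (i, j) = complex_of_real
    (if \<sigma> i = j \<and> \<sigma> j = i \<and> \<tau> i = j \<and> \<tau> j = i then 2 * (\<integral>x. x ^ 4 \<partial>Q) + 1 / 2 else 1)"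
proof -
  have ij: "i < j" using u by (simp add: pairs_below_def)
  have comm: "expectation (\<lambda>\<omega>. cnj (Z (i, j) \<omega>) * Z (i, j) \<omega>) = 1"
    using block_moments(3)[OF ij] by (simp only: mult.commute)
  have "expectation (\<lambda>\<omega>. ((if p then Z (i, j) \<omega> else 1) * (if q then cnj (Z (i, j) \<omega>) else 1)) *
      ((if r then Z (i, j) \<omega> else 1) * (if s then cnj (Z (i, j) \<omega>) else 1))) =
      complex_of_real (if p \<and> q \<and> r \<and> s then 2 * (\<integral>x. x ^ 4 \<partial>Q) + 1 / 2 else 1)"
    if "of_bool p + of_bool r = (of_bool q + of_bool s :: nat)" for p q r s
    using that block_moments(3,4)[OF ij] comm
    by (cases p; cases q; cases r; cases s) (simp_all add: prob_space)
  from this[OF assms(2)] show ?thesis using ij by (simp add: block_pair_mean_def block_factor_def)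
qed

text \<open>For a balanced pair no block carries the third moment \<open>E Z\<^sup>2 (cnj Z)\<close>; for an unbalanced pair some block is
used in one direction only and has mean 0.\<close>

lemma prod_block_pair_mean:
  assumes p: "\<sigma> permutes S" "\<tau> permutes S" and fin: "finite S"
  shows "(\<Prod>u\<in>wigner_blocks S. block_pair_mean \<mu> \<nu> \<sigma> \<tau> u) =
    complex_of_real (pair_weight (2 * (\<integral>x. x ^ 4 \<partial>Q) - 1 / 2) \<mu> \<nu> S \<sigma> \<tau>)"
proof (cases "balanced S \<sigma> \<tau>")
  case True
  have "(\<Prod>u\<in>pairs_below S. block_pair_mean \<mu> \<nu> \<sigma> \<tau> u) = (\<Prod>(i, j)\<in>pairs_below S. complex_of_real
    (if \<sigma> i = j \<and> \<sigma> j = i \<and> \<tau> i = j \<and> \<tau> j = i then 2 * (\<integral>x. x ^ 4 \<partial>Q) - 1 / 2 + 1 else 1))"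
  proof (rule prod.cong[OF refl], clarify)
    fix i j assume u: "(i, j) \<in> pairs_below S"
    then have "i \<in> S" "j \<in> S" "i \<noteq> j" by (auto simp: pairs_below_def)
    then show "block_pair_mean \<mu> \<nu> \<sigma> \<tau> (i, j) = complex_of_real
      (if \<sigma> i = j \<and> \<sigma> j = i \<and> \<tau> i = j \<and> \<tau> j = i then 2 * (\<integral>x. x ^ 4 \<partial>Q) - 1 / 2 + 1 else 1)"
      using True by (subst block_pair_mean_matched[OF u]) (auto simp: balanced_def)
  qed
  then show ?thesis using True
    unfolding prod_wigner_blocks[OF fin] pair_weight_def block_pair_mean_diag
    by (simp add: case_prod_beta)
next
  case False
  then obtain i j where ij: "i \<in> S" "j \<in> S" "i \<noteq> j" "\<sigma> i = j \<or> \<tau> i = j" "\<sigma> j \<noteq> i" "\<tau> j \<noteq> i"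
    using unbalanced_imp_unmatched[OF p] by blast
  have "\<exists>u\<in>wigner_blocks S. block_pair_mean \<mu> \<nu> \<sigma> \<tau> u = 0"
  proof (cases "i < j")
    case True
    then have u: "(i, j) \<in> pairs_below S" using ij by (simp add: pairs_below_def)
    then show ?thesis using ij
      by (intro bexI[of _ "(i, j)"] block_pair_mean_unmatched[OF u]) (auto simp: wigner_blocks_def)
  next
    case False
    then have u: "(j, i) \<in> pairs_below S" using ij by (simp add: pairs_below_def)
    then show ?thesis using ij
      by (intro bexI[of _ "(j, i)"] block_pair_mean_unmatched[OF u]) (auto simp: wigner_blocks_def)
  qed
  then have "(\<Prod>u\<in>wigner_blocks S. block_pair_mean \<mu> \<nu> \<sigma> \<tau> u) = 0"
    by (subst prod_zero_iff) (use finite_wigner_blocks[OF fin] in auto)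
  then show ?thesis using False by (simp add: pair_weight_def)
qed

theorem wigner_corr_eq:
  "wigner_corr M Xd Xre Xim N \<mu> \<nu> = complex_of_real (fact N *
     (\<Sum>j | 2 * j \<le> N. ((\<integral>x. x ^ 4 \<partial>Q) - 3 / 4) ^ j / fact j * hermite_kernel (N - 2 * j) \<mu> \<nu>))"
proof -
  let ?S = "{0..<N}"
  let ?P = "{\<sigma>. \<sigma> permutes ?S}" and ?B = "wigner_blocks ?S"
  let ?f = "\<lambda>\<sigma> \<tau> u \<omega>. block_factor \<mu> \<sigma> u (Z u \<omega>) * block_factor \<nu> \<tau> u (Z u \<omega>)"
  have ind: "indep_vars (\<lambda>_. borel) (\<lambda>u \<omega>. ?f \<sigma> \<tau> u \<omega>) ?B" for \<sigma> \<tau>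
    by (rule indep_blocks[of "\<lambda>u z. block_factor \<mu> \<sigma> u z * block_factor \<nu> \<tau> u z"]) measurable
  have finB: "finite ?B" by (rule finite_wigner_blocks) simp
  have int: "integrable M (\<lambda>\<omega>. \<Prod>u\<in>?B. ?f \<sigma> \<tau> u \<omega>)" for \<sigma> \<tau>
    by (rule indep_vars_integrable[OF finB ind integrable_block_pair])
  have "wigner_corr M Xd Xre Xim N \<mu> \<nu> = expectation (\<lambda>\<omega>. \<Sum>\<sigma>\<in>?P. \<Sum>\<tau>\<in>?P.
      of_int (sign \<sigma>) * of_int (sign \<tau>) * (\<Prod>u\<in>?B. ?f \<sigma> \<tau> u \<omega>))"
    unfolding wigner_corr_def det_wigner_matrix sum_product prod.distrib
    by (simp only: mult_ac)
  also have "\<dots> = (\<Sum>\<sigma>\<in>?P. \<Sum>\<tau>\<in>?P. of_int (sign \<sigma>) * of_int (sign \<tau>) * expectation (\<lambda>\<omega>. \<Prod>u\<in>?B. ?f \<sigma> \<tau> u \<omega>))"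
    using int by (simp add: Bochner_Integration.integral_sum)
  also have "\<dots> = (\<Sum>\<sigma>\<in>?P. \<Sum>\<tau>\<in>?P. of_int (sign \<sigma>) * of_int (sign \<tau>) *
      complex_of_real (pair_weight (2 * (\<integral>x. x ^ 4 \<partial>Q) - 1 / 2) \<mu> \<nu> ?S \<sigma> \<tau>))"
  proof (intro sum.cong refl, clarify)
    fix \<sigma> \<tau> assume p: "\<sigma> permutes ?S" "\<tau> permutes ?S"
    have "expectation (\<lambda>\<omega>. \<Prod>u\<in>?B. ?f \<sigma> \<tau> u \<omega>) = (\<Prod>u\<in>?B. block_pair_mean \<mu> \<nu> \<sigma> \<tau> u)"
      unfolding block_pair_mean_def by (rule indep_vars_lebesgue_integral[OF finB ind integrable_block_pair])
    then show "of_int (sign \<sigma>) * of_int (sign \<tau>) * expectation (\<lambda>\<omega>. \<Prod>u\<in>?B. ?f \<sigma> \<tau> u \<omega>) =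
       of_int (sign \<sigma>) * of_int (sign \<tau>) * complex_of_real (pair_weight (2 * (\<integral>x. x ^ 4 \<partial>Q) - 1 / 2) \<mu> \<nu> ?S \<sigma> \<tau>)"
      by (simp add: prod_block_pair_mean[OF p])
  qed
  also have "\<dots> = complex_of_real (\<Sum>\<sigma>\<in>?P. \<Sum>\<tau>\<in>?P. of_int (sign \<sigma>) * of_int (sign \<tau>) *
      pair_weight (2 * (\<integral>x. x ^ 4 \<partial>Q) - 1 / 2) \<mu> \<nu> ?S \<sigma> \<tau>)"
    by simp
  also have "(\<Sum>\<sigma>\<in>?P. \<Sum>\<tau>\<in>?P. of_int (sign \<sigma>) * of_int (sign \<tau>) *
      pair_weight (2 * (\<integral>x. x ^ 4 \<partial>Q) - 1 / 2) \<mu> \<nu> ?S \<sigma> \<tau>) =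
    fact N * (\<Sum>j | 2 * j \<le> N. ((\<integral>x. x ^ 4 \<partial>Q) - 3 / 4) ^ j / fact j * hermite_kernel (N - 2 * j) \<mu> \<nu>)"
  proof -
    \<comment> \<open>Here \<open>c + 1 = 2 b + 1/2\<close> is the fourth absolute moment.\<close>
    have c: "(2 * (\<integral>x. x ^ 4 \<partial>Q) - 1 / 2 - 1) / 2 = (\<integral>x. x ^ 4 \<partial>Q) - 3 / 4" by (simp add: field_simps)
    show ?thesis
      using sum_pair_weight[OF finite_atLeastLessThan, of "2 * (\<integral>x. x ^ 4 \<partial>Q) - 1 / 2" \<mu> \<nu> 0 N]
      unfolding c card_atLeastLessThan diff_zero .
  qed
  finally show ?thesis .
qed

end

section \<open>The limit\<close>

text \<open>This dominates all terms of the outer sum by diagonal values that do not depend on \<open>m\<close>.\<close>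

lemma abs_gauss_kernel_le:
  assumes "m \<le> n"
  shows "\<bar>gauss_kernel m x y\<bar> \<le> (gauss_kernel n x x + gauss_kernel n y y) / 2"
proof -
  have "\<bar>gauss_kernel m x y\<bar> \<le> (\<Sum>k\<le>m. \<bar>hermite_fun k x * hermite_fun k y\<bar>)"
    unfolding gauss_kernel_sum by (rule sum_abs)
  also have "\<dots> \<le> (\<Sum>k\<le>n. \<bar>hermite_fun k x * hermite_fun k y\<bar>)"
    using assms by (intro sum_mono2) auto
  also have "\<dots> \<le> (\<Sum>k\<le>n. (hermite_fun k x * hermite_fun k x + hermite_fun k y * hermite_fun k y) / 2)"
  proof (rule sum_mono)
    fix k
    show "\<bar>hermite_fun k x * hermite_fun k y\<bar> \<le> (hermite_fun k x * hermite_fun k x + hermite_fun k y * hermite_fun k y) / 2"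
      using sum_squares_bound[of "\<bar>hermite_fun k x\<bar>" "\<bar>hermite_fun k y\<bar>"]
      by (simp add: abs_mult power2_eq_square)
  qed
  also have "\<dots> = (gauss_kernel n x x + gauss_kernel n y y) / 2"
    by (simp add: gauss_kernel_sum sum.distrib sum_divide_distrib[symmetric])
  finally show ?thesis .
qed

lemma scaled_point_tendsto:
  fixes \<xi> c :: real
  shows "(\<lambda>n. (sqrt (real (n + d)) * \<xi> + c / sqrt (real (n + d))) / sqrt (real n)) \<longlonglongrightarrow> \<xi>"
  by real_asymp

text \<open>The points are scaled with \<open>n + d\<close> while the degree of the kernel is \<open>n\<close>; a bounded shift is invisible to
the limit. For \<open>\<mu> = \<nu>\<close> the two points coincide and the diagonal asymptotics takes the place of the
sine.\<close>

lemma gauss_kernel_bulk_tendsto: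
  fixes \<xi> \<mu> \<nu> :: real and d :: nat
  assumes \<xi>: "\<bar>\<xi>\<bar> < 2"
  defines "\<rho> \<equiv> semicircle_density \<xi>"
  defines "x \<equiv> (\<lambda>n. sqrt (real n) * \<xi> + \<mu> / (sqrt (real n) * \<rho>))"
    and "y \<equiv> (\<lambda>n. sqrt (real n) * \<xi> + \<nu> / (sqrt (real n) * \<rho>))"
  shows "(\<lambda>n. gauss_kernel n (x (n + d)) (y (n + d)) / sqrt (real n)) \<longlonglongrightarrow>
    sqrt (2 / pi) * (pi * \<rho> * sinc (pi * (\<mu> - \<nu>)))"
proof -
  have "\<xi>\<^sup>2 < 4" using \<xi> abs_square_less_1[of "\<xi> / 2"] by (simp add: power_divide)
  then have \<rho>: "\<rho> > 0" by (simp add: \<rho>_def semicircle_density_def)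
  have w: "sqrt (1 - \<xi>\<^sup>2 / 4) = pi * \<rho>"
  proof -
    have "sqrt (1 - \<xi>\<^sup>2 / 4) = sqrt ((4 - \<xi>\<^sup>2) / 4)" by (simp add: diff_divide_distrib)
    also have "\<dots> = sqrt (4 - \<xi>\<^sup>2) / 2" by (simp add: real_sqrt_divide)
    finally show ?thesis by (simp add: \<rho>_def semicircle_density_def)
  qed
  have xlim: "(\<lambda>n. x (n + d) / sqrt (real n)) \<longlonglongrightarrow> \<xi>"
    using scaled_point_tendsto[of d \<xi> "\<mu> / \<rho>"] by (simp add: x_def mult.commute)
  show ?thesis
  proof (cases "\<mu> = \<nu>")
    case True
    then have "y = x" by (simp add: x_def y_def)
    then show ?thesis using gauss_kernel_diag_tendsto[OF xlim \<xi>] True by (simp add: w)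
  next
    case False
    define \<delta> where "\<delta> = (\<mu> - \<nu>) / \<rho>"
    have \<delta>: "\<delta> \<noteq> 0" using False \<rho> by (simp add: \<delta>_def)
    have "(\<lambda>n. sqrt (real n) / sqrt (real (n + d)) * \<delta>) \<longlonglongrightarrow> 1 * \<delta>"
      by (intro tendsto_mult tendsto_const) real_asymp
    moreover have "sqrt (real n) * (x (n + d) - y (n + d)) = sqrt (real n) / sqrt (real (n + d)) * \<delta>" for n
      using \<rho> by (simp add: x_def y_def \<delta>_def diff_divide_distrib[symmetric])
    ultimately have "(\<lambda>n. sqrt (real n) * (x (n + d) - y (n + d))) \<longlonglongrightarrow> \<delta>" by simp
    from gauss_kernel_offdiag_tendsto[OF xlim \<xi> this \<delta>]
    have "(\<lambda>n. gauss_kernel n (x (n + d)) (y (n + d)) / sqrt (real n)) \<longlonglongrightarrow>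
      sqrt (2 / pi) * (sin (pi * \<rho> * \<delta>) / \<delta>)" by (simp add: w)
    moreover have "sin (pi * \<rho> * \<delta>) / \<delta> = pi * \<rho> * sinc (pi * (\<mu> - \<nu>))"
    proof -
      have "pi * \<rho> * \<delta> = pi * (\<mu> - \<nu>)" using \<rho> by (simp add: \<delta>_def)
      then show ?thesis using False \<rho> by (simp add: \<delta>_def)
    qed
    ultimately show ?thesis by simp
  qed
qed

text \<open>Tannery's theorem. The dominating series is \<open>|\<beta>|^j / j! * B\<close>, where \<open>B\<close> bounds the convergent, hence
bounded, diagonal values.\<close>

lemma weighted_kernel_sum_tendsto:
  fixes \<xi> \<mu> \<nu> \<beta> :: real
  assumes \<xi>: "\<bar>\<xi>\<bar> < 2"
  defines "\<rho> \<equiv> semicircle_density \<xi>"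
  defines "x \<equiv> (\<lambda>n. sqrt (real n) * \<xi> + \<mu> / (sqrt (real n) * \<rho>))"
    and "y \<equiv> (\<lambda>n. sqrt (real n) * \<xi> + \<nu> / (sqrt (real n) * \<rho>))"
  shows "(\<lambda>N. (\<Sum>j | 2 * j \<le> N. \<beta> ^ j / fact j * gauss_kernel (N - 2 * j) (x N) (y N)) / sqrt (real N))
    \<longlonglongrightarrow> exp \<beta> * (sqrt (2 / pi) * (pi * \<rho> * sinc (pi * (\<mu> - \<nu>))))"
proof -
  define L where "L = sqrt (2 / pi) * (pi * \<rho> * sinc (pi * (\<mu> - \<nu>)))"
  define a where "a j N = (if 2 * j \<le> N then \<beta> ^ j / fact j * (gauss_kernel (N - 2 * j) (x N) (y N) / sqrt (real N)) else 0)" for j N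
  have lim: "a j \<longlonglongrightarrow> \<beta> ^ j / fact j * L" for j
  proof (rule LIMSEQ_offset[where k = "2 * j"])
    have "(\<lambda>n. \<beta> ^ j / fact j * (gauss_kernel n (x (n + 2 * j)) (y (n + 2 * j)) / sqrt (real n) *
       (sqrt (real n) / sqrt (real (n + 2 * j))))) \<longlonglongrightarrow> \<beta> ^ j / fact j * (L * 1)"
      unfolding L_def \<rho>_def x_def y_def
      by (intro tendsto_mult tendsto_const gauss_kernel_bulk_tendsto[OF \<xi>]) real_asymp
    moreover have "\<forall>\<^sub>F n in sequentially. \<beta> ^ j / fact j * (gauss_kernel n (x (n + 2 * j)) (y (n + 2 * j)) / sqrt (real n) *
       (sqrt (real n) / sqrt (real (n + 2 * j)))) = a j (n + 2 * j)"
      using eventually_gt_at_top[of 0] by eventually_elim (simp add: a_def)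
    ultimately show "(\<lambda>n. a j (n + 2 * j)) \<longlonglongrightarrow> \<beta> ^ j / fact j * L"
      by (simp add: tendsto_cong)
  qed
  have "(\<lambda>n. (gauss_kernel n (x n) (x n) / sqrt (real n) + gauss_kernel n (y n) (y n) / sqrt (real n)) / 2)
     \<longlonglongrightarrow> (sqrt (2 / pi) * (pi * \<rho> * sinc (pi * (\<mu> - \<mu>))) + sqrt (2 / pi) * (pi * \<rho> * sinc (pi * (\<nu> - \<nu>)))) / 2"
    using gauss_kernel_bulk_tendsto[OF \<xi>, of 0 \<mu> \<mu>] gauss_kernel_bulk_tendsto[OF \<xi>, of 0 \<nu> \<nu>]
    unfolding \<rho>_def x_def y_def add_0_right by (intro tendsto_intros) auto
  then have "Bseq (\<lambda>n. (gauss_kernel n (x n) (x n) / sqrt (real n) + gauss_kernel n (y n) (y n) / sqrt (real n)) / 2)"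
    by (intro convergent_imp_Bseq convergentI)
  then obtain B where B: "\<And>n. \<bar>(gauss_kernel n (x n) (x n) / sqrt (real n) + gauss_kernel n (y n) (y n) / sqrt (real n)) / 2\<bar> \<le> B"
    by (auto simp: Bseq_def)
  have bound: "norm (a j N) \<le> \<bar>\<beta>\<bar> ^ j / fact j * B" for j N
  proof (cases "2 * j \<le> N")
    case True
    have "\<bar>gauss_kernel (N - 2 * j) (x N) (y N) / sqrt (real N)\<bar> \<le>
      (gauss_kernel N (x N) (x N) + gauss_kernel N (y N) (y N)) / 2 / sqrt (real N)"
      using divide_right_mono[OF abs_gauss_kernel_le[OF diff_le_self, of N "2 * j" "x N" "y N"], of "sqrt (real N)"]
      by (simp only: abs_divide abs_of_nonneg real_sqrt_ge_zero of_nat_0_le_iff simp_thms)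
    also have "\<dots> = (gauss_kernel N (x N) (x N) / sqrt (real N) + gauss_kernel N (y N) (y N) / sqrt (real N)) / 2"
      by (simp add: add_divide_distrib)
    also have "\<dots> \<le> B" using B[of N] by linarith
    finally have le: "\<bar>gauss_kernel (N - 2 * j) (x N) (y N) / sqrt (real N)\<bar> \<le> B" .
    have "norm (a j N) = \<bar>\<beta>\<bar> ^ j / fact j * \<bar>gauss_kernel (N - 2 * j) (x N) (y N) / sqrt (real N)\<bar>"
      using True by (simp add: a_def abs_mult power_abs)
    then show ?thesis using mult_left_mono[OF le, of "\<bar>\<beta>\<bar> ^ j / fact j"] by simp
  next
    case False
    have "0 \<le> B" using B[of 0] by linarith
    then show ?thesis using False by (simp add: a_def)
  qed
  have sum: "summable (\<lambda>j. \<bar>\<beta>\<bar> ^ j / fact j * B)"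
    using summable_exp[of "\<bar>\<beta>\<bar>"] by (intro summable_mult2) (simp add: field_simps)
  have "((\<lambda>N. \<Sum>j. a j N) \<longlonglongrightarrow> (\<Sum>j. \<beta> ^ j / fact j * L))"
    using tannerys_theorem[of a "\<lambda>j. \<beta> ^ j / fact j * L" sequentially "\<lambda>j. \<bar>\<beta>\<bar> ^ j / fact j * B", OF lim _ sum]
      bound by (auto intro: always_eventually)
  moreover have "(\<Sum>j. \<beta> ^ j / fact j * L) = exp \<beta> * L"
  proof -
    have "(\<lambda>j. \<beta> ^ j / fact j) sums exp \<beta>" using exp_converges[of \<beta>] by (simp add: field_simps)
    then show ?thesis using sums_mult2 sums_unique by metis
  qed
  moreover have "(\<Sum>j. a j N) = (\<Sum>j | 2 * j \<le> N. \<beta> ^ j / fact j * gauss_kernel (N - 2 * j) (x N) (y N)) / sqrt (real N)" for N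
  proof -
    have "finite {j. 2 * j \<le> N}" by (rule finite_subset[of _ "{..N}"]) auto
    then have "(\<Sum>j. a j N) = (\<Sum>j | 2 * j \<le> N. a j N)"
      by (rule suminf_finite) (simp add: a_def)
    then show ?thesis by (simp add: a_def sum_divide_distrib)
  qed
  ultimately show ?thesis by (simp add: L_def)
qed

text \<open>The Gaussian factor is accounted for by
\<open>(x\<^sup>2 + y\<^sup>2) / 4 = N \<xi>\<^sup>2 / 2 + \<xi> (\<mu> + \<nu>) / (2 \<rho>) + C / N\<close> with
\<open>C = (\<mu>\<^sup>2 + \<nu>\<^sup>2) / (4 \<rho>\<^sup>2)\<close>, and the constants by
\<open>sqrt (1 / (2 \<pi>)) * sqrt (2 / \<pi>) * \<pi> = 1\<close>.\<close>

theorem theorem1p1: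
  fixes M :: "'a measure" and Q :: "real measure"
    and Xd :: "nat \<Rightarrow> 'a \<Rightarrow> real" and Xre Xim :: "nat \<Rightarrow> nat \<Rightarrow> 'a \<Rightarrow> real"
    and b \<xi> \<mu> \<nu> :: real
  assumes "real_distribution Q"
    and "integrable Q (\<lambda>x. x ^ 4)"
    and "(\<integral>x. x \<partial>Q) = 0"
    and "(\<integral>x. x\<^sup>2 \<partial>Q) = 1 / 2"
    and "b = (\<integral>x. x ^ 4 \<partial>Q)"
    and "wigner_family M Q Xd Xre Xim"
    and "\<xi> \<in> {-2<..<2}"
  shows "(\<lambda>N. complex_of_real (sqrt (1 / (2 * pi * real N)) * (1 / fact N) * exp (- real N * \<xi>\<^sup>2 / 2)) *
            wigner_corr M Xd Xre Xim N
              (sqrt (real N) * \<xi> + \<mu> / (sqrt (real N) * semicircle_density \<xi>))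
              (sqrt (real N) * \<xi> + \<nu> / (sqrt (real N) * semicircle_density \<xi>)))
          \<longlonglongrightarrow>
          complex_of_real (exp (b - 3 / 4) * exp (\<xi> * (\<mu> + \<nu>) / (2 * semicircle_density \<xi>)) *
            semicircle_density \<xi> * sinc (pi * (\<mu> - \<nu>)))"
proof -
  interpret wigner_moments M Q Xd Xre Xim
    using assms(1-4,6) by (simp add: wigner_moments_def wigner_moments_axioms_def)
  define \<rho> where "\<rho> = semicircle_density \<xi>"
  define \<beta> where "\<beta> = b - 3 / 4"
  define x where "x n = sqrt (real n) * \<xi> + \<mu> / (sqrt (real n) * \<rho>)" for n
  define y where "y n = sqrt (real n) * \<xi> + \<nu> / (sqrt (real n) * \<rho>)" for n
  have \<xi>: "\<bar>\<xi>\<bar> < 2" using assms(7) by auto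
  have "\<xi>\<^sup>2 < 4" using \<xi> abs_square_less_1[of "\<xi> / 2"] by (simp add: power_divide)
  then have \<rho>: "\<rho> > 0" by (simp add: \<rho>_def semicircle_density_def)
  define s where "s N = (\<Sum>j | 2 * j \<le> N. \<beta> ^ j / fact j * gauss_kernel (N - 2 * j) (x N) (y N)) / sqrt (real N)" for N
  define C where "C = (\<mu>\<^sup>2 + \<nu>\<^sup>2) / (4 * \<rho>\<^sup>2)"
  have s: "s \<longlonglongrightarrow> exp \<beta> * (sqrt (2 / pi) * (pi * \<rho> * sinc (pi * (\<mu> - \<nu>))))"
    unfolding s_def[abs_def] x_def y_def \<rho>_def by (rule weighted_kernel_sum_tendsto[OF \<xi>])
  have "(\<lambda>N. sqrt (1 / (2 * pi)) * (exp (\<xi> * (\<mu> + \<nu>) / (2 * \<rho>)) * exp (C * (1 / real N))) * s N)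
    \<longlonglongrightarrow> sqrt (1 / (2 * pi)) * (exp (\<xi> * (\<mu> + \<nu>) / (2 * \<rho>)) * exp (C * 0)) *
      (exp \<beta> * (sqrt (2 / pi) * (pi * \<rho> * sinc (pi * (\<mu> - \<nu>)))))"
    by (intro tendsto_mult tendsto_const tendsto_exp s) real_asymp
  also have "sqrt (1 / (2 * pi)) * (exp (\<xi> * (\<mu> + \<nu>) / (2 * \<rho>)) * exp (C * 0)) *
      (exp \<beta> * (sqrt (2 / pi) * (pi * \<rho> * sinc (pi * (\<mu> - \<nu>))))) =
      (sqrt (1 / (2 * pi)) * sqrt (2 / pi) * pi) * (exp \<beta> * exp (\<xi> * (\<mu> + \<nu>) / (2 * \<rho>)) * \<rho> * sinc (pi * (\<mu> - \<nu>)))"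
    by (simp only: mult_ac mult_zero_right exp_zero mult_1_left)
  also have "sqrt (1 / (2 * pi)) * sqrt (2 / pi) * pi = 1"
    unfolding real_sqrt_mult[symmetric] by (simp add: real_sqrt_divide)
  finally have main: "(\<lambda>N. sqrt (1 / (2 * pi)) * (exp (\<xi> * (\<mu> + \<nu>) / (2 * \<rho>)) * exp (C * (1 / real N))) * s N)
    \<longlonglongrightarrow> exp \<beta> * exp (\<xi> * (\<mu> + \<nu>) / (2 * \<rho>)) * \<rho> * sinc (pi * (\<mu> - \<nu>))" by simp
  have eq: "complex_of_real (sqrt (1 / (2 * pi * real N)) * (1 / fact N) * exp (- real N * \<xi>\<^sup>2 / 2)) *
      wigner_corr M Xd Xre Xim N (x N) (y N) =
    complex_of_real (sqrt (1 / (2 * pi)) * (exp (\<xi> * (\<mu> + \<nu>) / (2 * \<rho>)) * exp (C * (1 / real N))) * s N)"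
    if N: "N > 0" for N
  proof -
    define q where "q = sqrt (real N)"
    have q: "q > 0" "real N = q\<^sup>2" using N by (simp_all add: q_def)
    have K: "hermite_kernel n (x N) (y N) = exp (((x N)\<^sup>2 + (y N)\<^sup>2) / 4) * gauss_kernel n (x N) (y N)" for n
    proof -
      have "exp (((x N)\<^sup>2 + (y N)\<^sup>2) / 4) * exp (- ((x N)\<^sup>2 + (y N)\<^sup>2) / 4) = 1"
        using exp_minus_inverse[of "((x N)\<^sup>2 + (y N)\<^sup>2) / 4"] by (simp only: minus_divide_left)
      then have "hermite_kernel n (x N) (y N) =
        hermite_kernel n (x N) (y N) * (exp (((x N)\<^sup>2 + (y N)\<^sup>2) / 4) * exp (- ((x N)\<^sup>2 + (y N)\<^sup>2) / 4))" by simp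
      then show ?thesis by (simp only: gauss_kernel_def mult_ac)
    qed
    have sq: "s N * q = (\<Sum>j | 2 * j \<le> N. \<beta> ^ j / fact j * gauss_kernel (N - 2 * j) (x N) (y N))"
      using q(1) by (simp add: s_def q_def[symmetric])
    have corr: "wigner_corr M Xd Xre Xim N (x N) (y N) = complex_of_real (fact N *
      (exp (((x N)\<^sup>2 + (y N)\<^sup>2) / 4) * (s N * q)))"
      unfolding wigner_corr_eq K sq \<beta>_def assms(5) sum_distrib_left by (simp only: mult_ac)
    have ex: "((x N)\<^sup>2 + (y N)\<^sup>2) / 4 = real N * \<xi>\<^sup>2 / 2 + (\<xi> * (\<mu> + \<nu>) / (2 * \<rho>) + C * (1 / real N))"
      unfolding x_def y_def q_def[symmetric] q(2) C_def using q(1) \<rho>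
      by (simp add: divide_simps power2_eq_square) (simp add: algebra_simps)
    have "sqrt (1 / (2 * pi * real N)) = sqrt (1 / (2 * pi)) / q"
      by (simp add: q_def real_sqrt_divide real_sqrt_mult)
    then have "sqrt (1 / (2 * pi * real N)) * (1 / fact N) * exp (- real N * \<xi>\<^sup>2 / 2) *
        (fact N * (exp (((x N)\<^sup>2 + (y N)\<^sup>2) / 4) * (s N * q))) =
      sqrt (1 / (2 * pi)) * (exp (- real N * \<xi>\<^sup>2 / 2) * exp (((x N)\<^sup>2 + (y N)\<^sup>2) / 4)) * s N"
      using q(1) by simp
    also have "exp (- real N * \<xi>\<^sup>2 / 2) * exp (((x N)\<^sup>2 + (y N)\<^sup>2) / 4) =
       exp (\<xi> * (\<mu> + \<nu>) / (2 * \<rho>)) * exp (C * (1 / real N))"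
      unfolding ex exp_add[symmetric] by (rule arg_cong[where f = exp]) simp
    finally show ?thesis unfolding corr of_real_mult[symmetric] by (rule arg_cong)
  qed
  have "(\<lambda>N. complex_of_real (sqrt (1 / (2 * pi)) * (exp (\<xi> * (\<mu> + \<nu>) / (2 * \<rho>)) * exp (C * (1 / real N))) * s N))
    \<longlonglongrightarrow> complex_of_real (exp \<beta> * exp (\<xi> * (\<mu> + \<nu>) / (2 * \<rho>)) * \<rho> * sinc (pi * (\<mu> - \<nu>)))"
    by (rule tendsto_of_real[OF main])
  then have "(\<lambda>N. complex_of_real (sqrt (1 / (2 * pi * real N)) * (1 / fact N) * exp (- real N * \<xi>\<^sup>2 / 2)) *
      wigner_corr M Xd Xre Xim N (x N) (y N))
    \<longlonglongrightarrow> complex_of_real (exp \<beta> * exp (\<xi> * (\<mu> + \<nu>) / (2 * \<rho>)) * \<rho> * sinc (pi * (\<mu> - \<nu>)))"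
    by (rule Lim_transform_eventually) (use eventually_gt_at_top[of 0] in eventually_elim, simp only: eq)
  then show ?thesis unfolding x_def y_def \<rho>_def \<beta>_def .
qed

end
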